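(* The generic Temperley-Lieb-Jones category $\mathrm{TLJ}$ is semisimple: every object $P$ of $\mathrm{TLJ}$ is isomorphic to a (finite) direct sum of Jones-Wenzl idempotents $p_n$, $n\ge 0$.
   Context: Let $\mathbb{F}=\mathbb{C}(q)$ with $q$ a formal parameter, and $[m]=\frac{q^m-q^{-m}}{q-q^{-1}}$. A simple Temperley-Lieb (TL) diagram from $m$ to $n$ points is a planar diagram in the unit square with $m$ marked points on the bottom edge and $n$ on the top edge, consisting of pairwise disjoint smooth arcs matching the marked points in pairs, together with finitely many disjoint closed loops, up to planar isotopy (there are none if $m+n$ is odd). The generic Temperley-Lieb category $\mathrm{TL}$ has objects the non-negative integers; $\mathrm{Hom}(m,n)$ is the $\mathbb{F}$-span of simple TL diagrams from $m$ to $n$ points modulo the relation that a diagram with a closed loop equals $d=[2]=q+q^{-1}$ times the diagram with the loop removed. Composition $g\circ f$ stacks $g$ on top of $f$; the tensor product is addition on objects and horizontal juxtaposition on diagrams; $\mathrm{id}_n$ is the diagram with $n$ vertical strands. The Jones-Wenzl idempotents $p_n\in\mathrm{Hom}(n,n)$ are defined by: $p_0$ is the empty diagram, $p_1=\mathrm{id}_1$, and $p_{n+1}=p_n\otimes \mathrm{id}_1-\frac{[n]}{[n+1]}(p_n\otimes\mathrm{id}_1)\,U_n\,(p_n\otimes\mathrm{id}_1)$ for $n\ge1$, where $U_n\in\mathrm{Hom}(n+1,n+1)$ has a cup joining the last two top points, a cap joining the last two bottom points and vertical strands elsewhere. The Karoubi envelope $\mathrm{Kar}\,\mathcal{C}$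 of a category $\mathcal C$ has as objects the idempotents $p\colon x\to x$ of $\mathcal C$; a morphism from $p\colon x\to x$ to $r\colon y\to y$ is a morphism $f\colon x\to y$ of $\mathcal{C}$ with $fp=f=rf$. For $\mathcal{C}$ enriched in abelian groups, the additive completion $\mathrm{Mat}\,\mathcal C$ has as objects formal finite direct sums of objects of $\mathcal C$ and as morphisms matrices of morphisms of $\mathcal C$, with matrix multiplication as composition. The tensor product extends from $\mathrm{TL}$ to $\mathrm{Kar}\,\mathrm{TL}$ (tensor product of diagrams) and then bilinearly over $\oplus$ to $\mathrm{Mat}(\mathrm{Kar}\,\mathrm{TL})$. The category $\mathrm{TLJ}$ is the full subcategory of $\mathrm{Mat}(\mathrm{Kar}\,\mathrm{TL})$ whose objects are the closure of the set $\{p_n : n\ge0\}$ under direct sum and tensor product. An object $x$ of an $\mathbb{F}$-linear category is simple if $\mathrm{Hom}(x,x)=\mathrm{span}_{\mathbb F}\{1_x\}$; a collection $S$ of simple objects is a collection of disjoint simple objects if $\mathrm{Hom}(x,y)=0$ for all $x\ne y$ in $S$. An $\mathbb{F}$-linear category with biproduct $\oplus$ is semisimple if there is a collection $S$ of disjoint simple objects such that every object is isomorphic to a finite biproduct of objects of $S$. *)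

theory Defs
  imports
    "HOL-Computational_Algebra.Polynomial"
    "HOL-Computational_Algebra.Fraction_Field"
    "HOL-Library.Poly_Mapping"
    "HOL-Library.Function_Algebras"
    "HOL-Library.Disjoint_Sets"
begin

section \<open>Linear categories\<close>

text \<open>
  Morphisms are elements of one ambient abelian group, and the set of morphisms \<open>x \<rightarrow> y\<close> is
  \<open>Hom C x y\<close>. These sets need not be disjoint for different pairs of objects (they all contain
  \<open>0\<close>), so \<open>Comp C x y z g f\<close>, the composite of \<open>f : x \<rightarrow> y\<close> with \<open>g : y \<rightarrow> z\<close>, carries the three
  objects.
\<close>

record ('k, 'o, 'm) lincat =
  Obj :: "'o set"
  Hom :: "'o \<Rightarrow> 'o \<Rightarrow> 'm set"
  Comp :: "'o \<Rightarrow> 'o \<Rightarrow> 'o \<Rightarrow> 'm \<Rightarrow> 'm \<Rightarrow> 'm"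
  Ident :: "'o \<Rightarrow> 'm"
  Scale :: "'k \<Rightarrow> 'm \<Rightarrow> 'm"

locale linear_category =
  fixes C :: "('k::field, 'o, 'm::ab_group_add) lincat"
  assumes hom_zero: "\<lbrakk>x \<in> Obj C; y \<in> Obj C\<rbrakk> \<Longrightarrow> 0 \<in> Hom C x y"
    and hom_add: "\<lbrakk>x \<in> Obj C; y \<in> Obj C; f \<in> Hom C x y; g \<in> Hom C x y\<rbrakk> \<Longrightarrow> f + g \<in> Hom C x y"
    and hom_scale: "\<lbrakk>x \<in> Obj C; y \<in> Obj C; f \<in> Hom C x y\<rbrakk> \<Longrightarrow> Scale C a f \<in> Hom C x y"
    and scale_add_right: "\<lbrakk>x \<in> Obj C; y \<in> Obj C; f \<in> Hom C x y; g \<in> Hom C x y\<rbrakk>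
          \<Longrightarrow> Scale C a (f + g) = Scale C a f + Scale C a g"
    and scale_add_left: "\<lbrakk>x \<in> Obj C; y \<in> Obj C; f \<in> Hom C x y\<rbrakk>
          \<Longrightarrow> Scale C (a + b) f = Scale C a f + Scale C b f"
    and scale_scale: "\<lbrakk>x \<in> Obj C; y \<in> Obj C; f \<in> Hom C x y\<rbrakk>
          \<Longrightarrow> Scale C a (Scale C b f) = Scale C (a * b) f"
    and scale_one: "\<lbrakk>x \<in> Obj C; y \<in> Obj C; f \<in> Hom C x y\<rbrakk> \<Longrightarrow> Scale C 1 f = f"
    and ident_hom: "x \<in> Obj C \<Longrightarrow> Ident C x \<in> Hom C x x"
    and comp_hom: "\<lbrakk>x \<in> Obj C; y \<in> Obj C; z \<in> Obj C; f \<in> Hom C x y; g \<in> Hom C y z\<rbrakk>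
          \<Longrightarrow> Comp C x y z g f \<in> Hom C x z"
    and comp_ident_right: "\<lbrakk>x \<in> Obj C; y \<in> Obj C; f \<in> Hom C x y\<rbrakk>
          \<Longrightarrow> Comp C x x y f (Ident C x) = f"
    and comp_ident_left: "\<lbrakk>x \<in> Obj C; y \<in> Obj C; f \<in> Hom C x y\<rbrakk>
          \<Longrightarrow> Comp C x y y (Ident C y) f = f"
    and comp_assoc: "\<lbrakk>w \<in> Obj C; x \<in> Obj C; y \<in> Obj C; z \<in> Obj C;
            f \<in> Hom C w x; g \<in> Hom C x y; h \<in> Hom C y z\<rbrakk>
          \<Longrightarrow> Comp C w x z (Comp C x y z h g) f = Comp C w y z h (Comp C w x y g f)"
    and comp_add_right: "\<lbrakk>x \<in> Obj C; y \<in> Obj C; z \<in> Obj C;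
            f \<in> Hom C x y; f' \<in> Hom C x y; g \<in> Hom C y z\<rbrakk>
          \<Longrightarrow> Comp C x y z g (f + f') = Comp C x y z g f + Comp C x y z g f'"
    and comp_add_left: "\<lbrakk>x \<in> Obj C; y \<in> Obj C; z \<in> Obj C;
            f \<in> Hom C x y; g \<in> Hom C y z; g' \<in> Hom C y z\<rbrakk>
          \<Longrightarrow> Comp C x y z (g + g') f = Comp C x y z g f + Comp C x y z g' f"
    and comp_scale_right: "\<lbrakk>x \<in> Obj C; y \<in> Obj C; z \<in> Obj C; f \<in> Hom C x y; g \<in> Hom C y z\<rbrakk>
          \<Longrightarrow> Comp C x y z g (Scale C a f) = Scale C a (Comp C x y z g f)"
    and comp_scale_left: "\<lbrakk>x \<in> Obj C; y \<in> Obj C; z \<in> Obj C; f \<in> Hom C x y; g \<in> Hom C y z\<rbrakk>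
          \<Longrightarrow> Comp C x y z (Scale C a g) f = Scale C a (Comp C x y z g f)"

definition isomorphic :: "('k, 'o, 'm) lincat \<Rightarrow> 'o \<Rightarrow> 'o \<Rightarrow> bool" where
  "isomorphic C x y \<longleftrightarrow> x \<in> Obj C \<and> y \<in> Obj C \<and>
     (\<exists>f \<in> Hom C x y. \<exists>g \<in> Hom C y x.
        Comp C x y x g f = Ident C x \<and> Comp C y x y f g = Ident C y)"

text \<open>The empty list is allowed; its biproducts are the zero objects.\<close>

definition is_biproduct :: "('k, 'o, 'm::ab_group_add) lincat \<Rightarrow> 'o list \<Rightarrow> 'o \<Rightarrow> bool" where
  "is_biproduct C xs z \<longleftrightarrow> set xs \<subseteq> Obj C \<and> z \<in> Obj C \<and>
     (\<exists>\<iota> \<pi>. (\<forall>i < length xs. \<iota> i \<in> Hom C (xs ! i) z \<and> \<pi> i \<in> Hom C z (xs ! i)) \<and>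
        (\<forall>i < length xs. \<forall>j < length xs.
           Comp C (xs ! j) z (xs ! i) (\<pi> i) (\<iota> j) = (if i = j then Ident C (xs ! i) else 0)) \<and>
        (\<Sum>i < length xs. Comp C z (xs ! i) z (\<iota> i) (\<pi> i)) = Ident C z)"

definition has_biproducts :: "('k, 'o, 'm::ab_group_add) lincat \<Rightarrow> bool" where
  "has_biproducts C \<longleftrightarrow> (\<forall>xs. set xs \<subseteq> Obj C \<longrightarrow> (\<exists>z. is_biproduct C xs z))"

definition simple_object :: "('k, 'o, 'm) lincat \<Rightarrow> 'o \<Rightarrow> bool" where
  "simple_object C x \<longleftrightarrow> x \<in> Obj C \<and> Hom C x x = {Scale C a (Ident C x) | a. True}"

definition disjoint_simples :: "('k, 'o, 'm::zero) lincat \<Rightarrow> 'o set \<Rightarrow> bool" where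
  "disjoint_simples C S \<longleftrightarrow> (\<forall>x \<in> S. simple_object C x) \<and>
     (\<forall>x \<in> S. \<forall>y \<in> S. x \<noteq> y \<longrightarrow> Hom C x y = {0})"

definition semisimple :: "('k::field, 'o, 'm::ab_group_add) lincat \<Rightarrow> bool" where
  "semisimple C \<longleftrightarrow> linear_category C \<and> has_biproducts C \<and>
     (\<exists>S. disjoint_simples C S \<and>
        (\<forall>x \<in> Obj C. \<exists>xs z. set xs \<subseteq> S \<and> is_biproduct C xs z \<and> isomorphic C x z))"

definition full_subcategory :: "('k, 'o, 'm) lincat \<Rightarrow> 'o set \<Rightarrow> ('k, 'o, 'm) lincat" where
  "full_subcategory C T = C\<lparr>Obj := T\<rparr>"


section \<open>Karoubi envelope and additive completion\<close>

definition Kar :: "('k, 'o, 'm) lincat \<Rightarrow> ('k, 'o \<times> 'm, 'm) lincat" where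
  "Kar C = \<lparr>
     Obj = {(x, p). x \<in> Obj C \<and> p \<in> Hom C x x \<and> Comp C x x x p p = p},
     Hom = (\<lambda>(x, p) (y, r). {f \<in> Hom C x y. Comp C x x y f p = f \<and> Comp C x y y r f = f}),
     Comp = (\<lambda>(x, _) (y, _) (z, _). Comp C x y z),
     Ident = (\<lambda>(x, p). p),
     Scale = Scale C\<rparr>"

text \<open>
  A formal direct sum is the list of its summands. A morphism \<open>A\<close> from \<open>xs\<close> to \<open>ys\<close> is a matrix
  with \<open>A i j : xs ! j \<rightarrow> ys ! i\<close>, extended by \<open>0\<close> outside the index range.
\<close>

definition Mat :: "('k, 'o, 'm::ab_group_add) lincat \<Rightarrow> ('k, 'o list, nat \<Rightarrow> nat \<Rightarrow> 'm) lincat" where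
  "Mat C = \<lparr>
     Obj = {xs. set xs \<subseteq> Obj C},
     Hom = (\<lambda>xs ys. {A. \<forall>i j. if i < length ys \<and> j < length xs
                               then A i j \<in> Hom C (xs ! j) (ys ! i) else A i j = 0}),
     Comp = (\<lambda>xs ys zs B A. \<lambda>i k.
               if i < length zs \<and> k < length xs
               then \<Sum>j < length ys. Comp C (xs ! k) (ys ! j) (zs ! i) (B i j) (A j k) else 0),
     Ident = (\<lambda>xs. \<lambda>i j. if i = j \<and> i < length xs then Ident C (xs ! i) else 0),
     Scale = (\<lambda>a A. \<lambda>i j. Scale C a (A i j))\<rparr>"

abbreviation direct_sum :: "'o list list \<Rightarrow> 'o list" where
  "direct_sum \<equiv> concat"


section \<open>The ground field\<close>

type_synonym ground = "complex poly fract"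

definition qvar :: ground where
  "qvar = Fract [:0, 1:] 1"

definition qint :: "nat \<Rightarrow> ground" where
  "qint m = (qvar ^ m - inverse qvar ^ m) / (qvar - inverse qvar)"

definition loop_value :: ground where
  "loop_value = qvar + inverse qvar"

lemma loop_value_eq_qint: "loop_value = qint 2"
proof -
  have nz: "qvar \<noteq> 0"
    by (simp add: qvar_def Zero_fract_def eq_fract)
  have "qvar * qvar \<noteq> 1"
    by (simp add: qvar_def One_fract_def eq_fract one_pCons)
  then have "qvar - inverse qvar \<noteq> 0"
    using nz by (auto simp: field_simps)
  moreover have "qvar ^ 2 - inverse qvar ^ 2 = loop_value * (qvar - inverse qvar)"
    by (simp add: loop_value_def power2_eq_square algebra_simps)
  ultimately show ?thesis
    by (simp add: qint_def)
qed


section \<open>Temperley-Lieb diagrams\<close>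

datatype point = Bot nat | Top nat

text \<open>
  Up to planar isotopy, a diagram without closed loops is determined by the matching of the marked
  points it induces. Points are numbered from left to right, starting with \<open>0\<close>. A matching is
  the set of the two-element sets \<open>{a, b}\<close> of end points of its arcs.
\<close>

type_synonym diagram = "point set set"

definition marked_points :: "nat \<Rightarrow> nat \<Rightarrow> point set" where
  "marked_points m n = Bot ` {..<m} \<union> Top ` {..<n}"

text \<open>
  Position of a marked point when running counterclockwise around the boundary of the square,
  starting at its lower left corner.
\<close>

fun boundary_pos :: "nat \<Rightarrow> nat \<Rightarrow> point \<Rightarrow> nat" where
  "boundary_pos m n (Bot i) = i"
| "boundary_pos m n (Top j) = m + (n - 1 - j)"

definition planar :: "nat \<Rightarrow> nat \<Rightarrow> diagram \<Rightarrow> bool" where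
  "planar m n D \<longleftrightarrow> \<not> (\<exists>a b c e. {a, b} \<in> D \<and> {c, e} \<in> D \<and>
     boundary_pos m n a < boundary_pos m n c \<and> boundary_pos m n c < boundary_pos m n b \<and>
     boundary_pos m n b < boundary_pos m n e)"

definition tl_diagrams :: "nat \<Rightarrow> nat \<Rightarrow> diagram set" where
  "tl_diagrams m n =
     {D. partition_on (marked_points m n) D \<and> (\<forall>a \<in> D. card a = 2) \<and> planar m n D}"

text \<open>
  Modulo the loop relation every diagram is a power of \<open>loop_value\<close> times a diagram without
  closed loops, and these remaining diagrams are linearly independent. So \<open>Hom(m, n)\<close> is
  represented by its basis of diagrams without closed loops, as formal linear combinations of them,
  and a diagram consisting of the matching \<open>D\<close> and \<open>k\<close> closed loops represents the morphism
  \<open>diagram_class (D, k)\<close>.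
\<close>

type_synonym tl_morphism = "diagram \<Rightarrow>\<^sub>0 ground"

definition tl_hom :: "nat \<Rightarrow> nat \<Rightarrow> tl_morphism set" where
  "tl_hom m n = {f. Poly_Mapping.keys f \<subseteq> tl_diagrams m n}"

definition tl_scale :: "ground \<Rightarrow> tl_morphism \<Rightarrow> tl_morphism" where
  "tl_scale c f = Poly_Mapping.map ((*) c) f"

fun diagram_class :: "diagram \<times> nat \<Rightarrow> tl_morphism" where
  "diagram_class (D, k) = Poly_Mapping.single D (loop_value ^ k)"

text \<open>
  The justification: extending \<open>diagram_class\<close> linearly to the span of all diagrams identifies the
  quotient by the loop relation with the span of the diagrams without closed loops.
\<close>

inductive_set loop_relations :: "((diagram \<times> nat) \<Rightarrow>\<^sub>0 ground) set" where
  zero: "0 \<in> loop_relations"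
| step: "f \<in> loop_relations \<Longrightarrow>
    f + (Poly_Mapping.single (D, Suc k) c - Poly_Mapping.single (D, k) (loop_value * c)) \<in> loop_relations"

definition linear_class :: "((diagram \<times> nat) \<Rightarrow>\<^sub>0 ground) \<Rightarrow> tl_morphism" where
  "linear_class f = (\<Sum>x \<in> Poly_Mapping.keys f. tl_scale (Poly_Mapping.lookup f x) (diagram_class x))"

lemma additive_extension:
  fixes h :: "'a \<Rightarrow> 'b::comm_monoid_add \<Rightarrow> 'c::comm_monoid_add"
  assumes "\<And>x. h x 0 = 0" and "\<And>x a b. h x (a + b) = h x a + h x b"
  shows "(\<Sum>x \<in> Poly_Mapping.keys (f + g). h x (Poly_Mapping.lookup (f + g) x))
       = (\<Sum>x \<in> Poly_Mapping.keys f. h x (Poly_Mapping.lookup f x))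
       + (\<Sum>x \<in> Poly_Mapping.keys g. h x (Poly_Mapping.lookup g x))"
proof -
  let ?A = "Poly_Mapping.keys f \<union> Poly_Mapping.keys g"
  have *: "(\<Sum>x \<in> Poly_Mapping.keys e. h x (Poly_Mapping.lookup e x))
       = (\<Sum>x \<in> ?A. h x (Poly_Mapping.lookup e x))" if "Poly_Mapping.keys e \<subseteq> ?A" for e
    by (rule sum.mono_neutral_left) (use that assms(1) in \<open>auto simp: in_keys_iff\<close>)
  show ?thesis
    by (subst (1 2 3) *) (auto simp: Poly_Mapping.keys_add lookup_add assms(2) sum.distrib)
qed

lemma formal_sum_induct [case_names single sum]:
  fixes e :: "'a \<Rightarrow>\<^sub>0 'b::ab_group_add"
  assumes single: "\<And>x c. P (Poly_Mapping.single x c)"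
    and sum: "\<And>e e'. P e \<Longrightarrow> P e' \<Longrightarrow> P (e + e')"
  shows "P e"
proof -
  have "finite A \<Longrightarrow> Poly_Mapping.keys e \<subseteq> A \<Longrightarrow> P e" for A
  proof (induction A arbitrary: e rule: finite_induct)
    case empty
    then have "e = Poly_Mapping.single undefined 0" by simp
    then show ?case using single by metis
  next
    case (insert x A)
    let ?s = "Poly_Mapping.single x (Poly_Mapping.lookup e x)"
    have "Poly_Mapping.keys (e - ?s) \<subseteq> A"
      using insert.prems by (auto simp: in_keys_iff lookup_minus lookup_single when_def split: if_splits)
    then have "P ((e - ?s) + ?s)"
      by (intro sum single insert.IH)
    then show ?case by simp
  qed
  then show ?thesis using finite_keys by blast
qed

lemma tl_scale_simps: "tl_scale 0 f = 0" "tl_scale (a + b) f = tl_scale a f + tl_scale b f"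
  "tl_scale c (Poly_Mapping.single D a) = Poly_Mapping.single D (c * a)"
  by (auto intro!: poly_mapping_eqI
      simp: tl_scale_def Poly_Mapping.map.rep_eq when_def lookup_add lookup_single ring_distribs)

lemma linear_class_add: "linear_class (f + g) = linear_class f + linear_class g"
  unfolding linear_class_def by (rule additive_extension) (simp_all add: tl_scale_simps)

lemma linear_class_single:
  "linear_class (Poly_Mapping.single (D, k) c) = Poly_Mapping.single D (c * loop_value ^ k)"
  by (simp add: linear_class_def tl_scale_simps)

lemma linear_class_diff: "linear_class (f - g) = linear_class f - linear_class g"
  using linear_class_add[of "f - g" g] by (simp add: algebra_simps)

lemma loop_relations_add: "g \<in> loop_relations \<Longrightarrow> f \<in> loop_relations \<Longrightarrow> f + g \<in> loop_relations"
  by (induction rule: loop_relations.induct)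
    (auto simp: add.assoc[symmetric] simp del: add_diff_eq intro: loop_relations.intros)

lemma linear_class_eq_iff: "linear_class f = linear_class g \<longleftrightarrow> f - g \<in> loop_relations"
proof -
  define N :: "((diagram \<times> nat) \<Rightarrow>\<^sub>0 ground) \<Rightarrow> (diagram \<times> nat) \<Rightarrow>\<^sub>0 ground" where
    "N e = (\<Sum>x \<in> Poly_Mapping.keys e.
              Poly_Mapping.single (fst x, 0) (Poly_Mapping.lookup e x * loop_value ^ snd x))" for e
  have N_add: "N (e + e') = N e + N e'" for e e'
    unfolding N_def by (rule additive_extension) (simp_all add: single_add ring_distribs)
  have N_single: "N (Poly_Mapping.single (D, k) c) = Poly_Mapping.single (D, 0) (c * loop_value ^ k)"
    for D k c
    by (simp add: N_def)
  have monomial: "Poly_Mapping.single (D, k) c - Poly_Mapping.single (D, 0) (c * loop_value ^ k)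
                  \<in> loop_relations" for D k c
  proof (induction k arbitrary: c)
    case 0
    show ?case by (simp add: loop_relations.zero)
  next
    case (Suc k)
    show ?case
      using loop_relations.step[OF Suc[of "loop_value * c"], of D k c] by (simp add: mult_ac)
  qed
  have normal: "e - N e \<in> loop_relations" for e
  proof (induction e rule: formal_sum_induct)
    case (single x c)
    show ?case by (cases x) (simp add: N_single monomial)
  next
    case (sum e e')
    show ?case
      using loop_relations_add[OF sum(2) sum(1)] by (simp add: N_add algebra_simps)
  qed
  have lookup_N: "Poly_Mapping.lookup (N e) (D, k) =
                    (if k = 0 then Poly_Mapping.lookup (linear_class e) D else 0)" for e D k
  proof (induction e rule: formal_sum_induct)
    case (single x c)
    show ?case by (cases x) (simp add: N_single linear_class_single lookup_single when_def)
  next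
    case (sum e e')
    then show ?case by (simp add: N_add linear_class_add lookup_add)
  qed
  have "linear_class e = 0 \<longleftrightarrow> e \<in> loop_relations" for e
  proof
    assume "linear_class e = 0"
    then have "N e = 0"
      by (intro poly_mapping_eqI) (auto simp: lookup_N)
    then show "e \<in> loop_relations" using normal[of e] by simp
  next
    show "e \<in> loop_relations \<Longrightarrow> linear_class e = 0"
      by (induction rule: loop_relations.induct)
        (auto simp: linear_class_add linear_class_diff linear_class_single mult_ac
          linear_class_def[of 0] simp del: add_diff_eq)
  qed
  from this[of "f - g"] show ?thesis by (simp add: linear_class_diff)
qed

text \<open>
  Stacking \<open>E\<close> on top of \<open>D\<close> identifies the top points of \<open>D\<close> with the bottom points of \<open>E\<close>.
  The connected components of the resulting picture that reach the boundary are the arcs of the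
  stacked diagram, and the others are its closed loops.
\<close>

datatype level_point = Lower nat | Middle nat | Upper nat

fun place_below :: "point \<Rightarrow> level_point" where
  "place_below (Bot i) = Lower i"
| "place_below (Top j) = Middle j"

fun place_above :: "point \<Rightarrow> level_point" where
  "place_above (Bot i) = Middle i"
| "place_above (Top j) = Upper j"

fun place_outer :: "point \<Rightarrow> level_point" where
  "place_outer (Bot i) = Lower i"
| "place_outer (Top j) = Upper j"

definition stack_arcs :: "diagram \<Rightarrow> diagram \<Rightarrow> level_point set set" where
  "stack_arcs E D = image place_below ` D \<union> image place_above ` E"

definition components :: "'a set set \<Rightarrow> 'a set set" where
  "components A = \<Union>A // ({(a, b). {a, b} \<in> A}\<^sup>* \<inter> \<Union>A \<times> \<Union>A)"

definition stack :: "diagram \<Rightarrow> diagram \<Rightarrow> diagram \<times> nat" where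
  "stack E D =
     ({place_outer -` K | K. K \<in> components (stack_arcs E D) \<and> place_outer -` K \<noteq> {}},
      card {K \<in> components (stack_arcs E D). place_outer -` K = {}})"

definition tl_comp :: "tl_morphism \<Rightarrow> tl_morphism \<Rightarrow> tl_morphism" where
  "tl_comp g f = (\<Sum>E \<in> Poly_Mapping.keys g. \<Sum>D \<in> Poly_Mapping.keys f.
     tl_scale (Poly_Mapping.lookup g E * Poly_Mapping.lookup f D) (diagram_class (stack E D)))"

definition id_diagram :: "nat \<Rightarrow> diagram" where
  "id_diagram n = {{Bot i, Top i} | i. i < n}"

definition tl_id :: "nat \<Rightarrow> tl_morphism" where
  "tl_id n = Poly_Mapping.single (id_diagram n) 1"

text \<open>Juxtaposition: the second diagram is moved to the right of a diagram from \<open>m\<close> to \<open>n\<close> points.\<close>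

fun shift_point :: "nat \<Rightarrow> nat \<Rightarrow> point \<Rightarrow> point" where
  "shift_point m n (Bot i) = Bot (m + i)"
| "shift_point m n (Top j) = Top (n + j)"

definition juxtapose :: "nat \<Rightarrow> nat \<Rightarrow> diagram \<Rightarrow> diagram \<Rightarrow> diagram" where
  "juxtapose m n D E = D \<union> image (shift_point m n) ` E"

definition tl_tensor :: "nat \<Rightarrow> nat \<Rightarrow> tl_morphism \<Rightarrow> tl_morphism \<Rightarrow> tl_morphism" where
  "tl_tensor m n f g = (\<Sum>D \<in> Poly_Mapping.keys f. \<Sum>E \<in> Poly_Mapping.keys g.
     Poly_Mapping.single (juxtapose m n D E) (Poly_Mapping.lookup f D * Poly_Mapping.lookup g E))"

definition TL :: "(ground, nat, tl_morphism) lincat" where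
  "TL = \<lparr>Obj = UNIV, Hom = tl_hom, Comp = (\<lambda>_ _ _. tl_comp), Ident = tl_id, Scale = tl_scale\<rparr>"


section \<open>Jones-Wenzl idempotents and the category TLJ\<close>

text \<open>\<open>cup_cap n\<close> is \<open>U\<^sub>n \<in> Hom(n + 1, n + 1)\<close>, for \<open>n \<ge> 1\<close>.\<close>

definition cup_cap :: "nat \<Rightarrow> tl_morphism" where
  "cup_cap n = Poly_Mapping.single
     ({{Bot i, Top i} | i. i < n - 1} \<union> {{Bot (n - 1), Bot n}, {Top (n - 1), Top n}}) 1"

fun jones_wenzl :: "nat \<Rightarrow> tl_morphism" where
  "jones_wenzl 0 = tl_id 0"
| "jones_wenzl (Suc 0) = tl_id 1"
| "jones_wenzl (Suc (Suc k)) =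
     (let n = Suc k; P = tl_tensor n n (jones_wenzl n) (tl_id 1)
      in P - tl_scale (qint n / qint (n + 1)) (tl_comp (tl_comp P (cup_cap n)) P))"

type_synonym kar_object = "nat \<times> tl_morphism"

definition jw_object :: "nat \<Rightarrow> kar_object list" where
  "jw_object n = [(n, jones_wenzl n)]"

fun kar_tensor :: "kar_object \<Rightarrow> kar_object \<Rightarrow> kar_object" where
  "kar_tensor (m, p) (n, r) = (m + n, tl_tensor m m p r)"

definition mat_tensor :: "kar_object list \<Rightarrow> kar_object list \<Rightarrow> kar_object list" where
  "mat_tensor xs ys = [kar_tensor x y. x \<leftarrow> xs, y \<leftarrow> ys]"

text \<open>Direct sums are finite and include the empty one, the zero object.\<close>

inductive_set tlj_objects :: "kar_object list set" where
  jw: "jw_object n \<in> tlj_objects"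
| sum: "(\<forall>X \<in> set Xs. X \<in> tlj_objects) \<Longrightarrow> direct_sum Xs \<in> tlj_objects"
| tensor: "\<lbrakk>X \<in> tlj_objects; Y \<in> tlj_objects\<rbrakk> \<Longrightarrow> mat_tensor X Y \<in> tlj_objects"

definition TLJ :: "(ground, kar_object list, nat \<Rightarrow> nat \<Rightarrow> tl_morphism) lincat" where
  "TLJ = full_subcategory (Mat (Kar TL)) tlj_objects"

end

theory Submission
  imports Defs
begin

text \<open>
  An object of \<open>TLJ\<close> is a list of idempotents of \<open>TL\<close>, so the theorem comes down to two facts.
  Schur's lemma: in \<open>Kar TL\<close> the endomorphisms of \<open>p\<^sub>n\<close> are the multiples of \<open>p\<^sub>n\<close>, and there are
  no nonzero morphisms between \<open>p\<^sub>m\<close> and \<open>p\<^sub>n\<close> for \<open>m \<noteq> n\<close>. Splitting: every idempotent of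
  \<open>TL\<close> is, as an object of \<open>Kar TL\<close>, a biproduct of Jones-Wenzl idempotents.

  Diagrams are handled by counting two-colourings. A diagram \<open>D\<close> defines a matrix \<open>weight D\<close> of zeros
  and ones, indexed by the two-colourings of its bottom and of its top points, which records
  whether all arcs are monochromatic. A colouring of the boundary of a stacked picture extends to
  the middle points either not at all or in \<open>2\<^sup>k\<close> ways, where \<open>k\<close> is the number of closed loops, so the
  product of the matrices computes the stacked diagram together with its loops (\<open>stack_weight\<close>). As
  a matching is determined by its matrix (\<open>diagram_eqI\<close>), associativity of stacking with its loop counts,
  the interchange law with juxtaposition and the Temperley-Lieb relations become identities between
  finite sums. Planarity is invisible to the matrices. It follows from factorization: a planar
  diagram other than an identity has an arc between neighbouring points on the top or on the bottom edge, so
  it is an elementary cup or cap stacked with a smaller diagram (\<open>tl_diagram_cases\<close>); composing with one cup or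
  cap preserves planarity for a direct geometric reason, and an induction gives all composites
  (\<open>tl_stack\<close>).

  The recursion for \<open>p\<^sub>n\<close> yields by one induction that \<open>p\<^sub>n\<close> is idempotent, absorbs
  \<open>p\<^sub>n\<^sub>-\<^sub>1 \<otimes> id\<^sub>1\<close>, is annihilated by all cups and caps, and has partial trace
  \<open>[n+1]/[n] p\<^sub>n\<^sub>-\<^sub>1\<close> (\<open>jw_relations\<close>). That \<open>q\<close> is generic enters here, as \<open>[n] \<noteq> 0\<close> for \<open>n \<ge> 1\<close>. In
  \<open>p\<^sub>n D p\<^sub>m\<close> only an identity diagram \<open>D\<close> survives, which is Schur's lemma
  (\<open>schur_distinct\<close>, \<open>schur_endo\<close>).

  Read backwards, the recursion writes \<open>p\<^sub>n \<otimes> id\<^sub>1\<close> as \<open>p\<^sub>n\<^sub>+\<^sub>1\<close> plus a morphism through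
  \<open>p\<^sub>n\<^sub>-\<^sub>1\<close>, so each identity of \<open>TL\<close> is a sum of morphisms that factor through Jones-Wenzl idempotents
  (\<open>identity_jw_sum\<close>), and hence so is each idempotent \<open>e\<close>. If \<open>e = \<Sum>\<^sub>l a\<^sub>l b\<^sub>l\<close> is nonzero, some
  \<open>b\<^sub>l a\<^sub>m\<close> is nonzero, and by Schur's lemma it is an invertible multiple of some \<open>p\<^sub>k\<close>; after rescaling
  \<open>b\<^sub>l\<close> this splits a copy of \<open>p\<^sub>k\<close> off \<open>e\<close>, and the remaining idempotent is a sum with one term
  fewer (\<open>idempotent_sum_decomposition\<close>). This covers the tensor products \<open>p\<^sub>m \<otimes> p\<^sub>n\<close>, which are idempotents of \<open>TL\<close>.

  The rest is formal: Karoubi envelopes and additive completions of linear categories are linear,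
  concatenation of lists is a biproduct, and biproducts are unique up to isomorphism.
\<close>

section \<open>Two-colourings of stacked diagrams\<close>

text \<open>
  A set of points is the set of black points of a two-colouring; it is saturated if no block
  contains points of both colours.
\<close>

definition saturated :: "'a set set \<Rightarrow> 'a set \<Rightarrow> bool" where
  "saturated A S \<longleftrightarrow> (\<forall>a \<in> A. a \<subseteq> S \<or> a \<inter> S = {})"

lemma saturated_Un: "saturated (A \<union> B) S \<longleftrightarrow> saturated A S \<and> saturated B S"
  by (auto simp: saturated_def)

lemma saturated_image: "saturated (image f ` A) S \<longleftrightarrow> saturated A (f -` S)"
  by (auto simp: saturated_def image_subset_iff subset_iff)

lemma saturated_block:
  assumes "partition_on V D" "a \<in> D"
  shows "saturated D a"
  using assms by (auto simp: saturated_def partition_on_def disjoint_def)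

text \<open>
  The blocks of a partition are its minimal nonempty saturated sets, so a partition can be recovered from
  its monochromatic colourings.
\<close>

lemma partition_eqI:
  assumes D: "partition_on V D" and D': "partition_on V D'"
    and sat: "\<And>S. S \<subseteq> V \<Longrightarrow> saturated D S \<longleftrightarrow> saturated D' S"
  shows "D = D'"
proof -
  have sub: "P \<subseteq> Q" if P: "partition_on V P" and Q: "partition_on V Q"
    and sat: "\<And>S. S \<subseteq> V \<Longrightarrow> saturated P S \<longleftrightarrow> saturated Q S" for P Q
  proof
    fix a assume a: "a \<in> P"
    then have "a \<noteq> {}" "a \<subseteq> V" using P by (auto simp: partition_on_def)
    then obtain v where v: "v \<in> a" "v \<in> V" by blast
    then obtain b where b: "b \<in> Q" "v \<in> b" using Q by (auto simp: partition_on_def)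
    have aV: "a \<subseteq> V" and bV: "b \<subseteq> V" using P Q a b by (auto simp: partition_on_def)
    have "saturated Q a" using saturated_block[OF P a] sat aV by simp
    then have "b \<subseteq> a" using b v by (auto simp: saturated_def)
    moreover have "saturated P b" using saturated_block[OF Q b(1)] sat bV by simp
    then have "a \<subseteq> b" using a b v by (auto simp: saturated_def)
    ultimately show "a \<in> Q" using b by simp
  qed
  show ?thesis using sub[OF D D'] sub[OF D' D] sat by blast
qed

lemma arc_relation_equiv:
  "equiv (\<Union>A) ({(a, b). {a, b} \<in> A}\<^sup>* \<inter> \<Union>A \<times> \<Union>A)"
proof (rule equivI)
  have "sym {(a, b). {a, b} \<in> A}" by (auto simp: sym_def insert_commute)
  from sym_rtrancl[OF this] show "sym ({(a, b). {a, b} \<in> A}\<^sup>* \<inter> \<Union>A \<times> \<Union>A)"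
    by (auto simp: sym_def)
qed (auto simp: refl_on_def intro!: transI intro: rtrancl_trans)

lemma components_partition: "partition_on (\<Union>A) (components A)"
  unfolding components_def by (rule partition_on_quotient[OF arc_relation_equiv])

text \<open>
  A colouring that is constant along each arc is constant along each path of arcs, hence on
  components. This is the only point where connectedness of a stacked picture is used.
\<close>

lemma saturated_components:
  assumes arcs: "\<And>a. a \<in> A \<Longrightarrow> card a = 2"
  shows "saturated (components A) S \<longleftrightarrow> saturated A S"
proof
  let ?r = "{(a, b). {a, b} \<in> A}"
  assume S: "saturated A S"
  have *: "a \<in> S \<longleftrightarrow> b \<in> S" if "(a, b) \<in> ?r\<^sup>*" for a b
    using that
  proof (induction rule: rtrancl_induct)
    case (step y z)
    then show ?case using S by (fastforce simp: saturated_def)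
  qed simp
  then show "saturated (components A) S"
    unfolding saturated_def components_def by (auto elim!: quotientE)
next
  let ?r = "{(a, b). {a, b} \<in> A}\<^sup>* \<inter> \<Union>A \<times> \<Union>A"
  assume S: "saturated (components A) S"
  show "saturated A S" unfolding saturated_def
  proof
    fix a assume a: "a \<in> A"
    then obtain u v where uv: "a = {u, v}" using arcs card_2_iff by metis
    have "?r `` {u} \<in> components A"
      unfolding components_def using a uv by (intro quotientI) auto
    moreover have "u \<in> ?r `` {u}" "v \<in> ?r `` {u}" using a uv by auto
    ultimately obtain K where "K \<in> components A" "u \<in> K" "v \<in> K" by blast
    moreover from this(1) S have "K \<subseteq> S \<or> K \<inter> S = {}" unfolding saturated_def by blast
    ultimately show "a \<subseteq> S \<or> a \<inter> S = {}" unfolding uv by blast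
  qed
qed

text \<open>
  A colouring of the boundary \<open>B\<close> fixes the colour of each component that meets \<open>B\<close>, or is contradictory there;
  the components disjoint from \<open>B\<close> are coloured freely and independently.
\<close>

lemma card_saturated_extensions:
  assumes C: "partition_on V C" and fin: "finite V" and B: "B \<subseteq> V" and T: "T \<subseteq> B"
  shows "card {S. S \<subseteq> V \<and> S \<inter> B = T \<and> saturated C S} =
    (if \<forall>K \<in> C. K \<inter> B \<subseteq> T \<or> K \<inter> T = {} then 2 ^ card {K \<in> C. K \<inter> B = {}} else 0)"
proof (cases "\<forall>K \<in> C. K \<inter> B \<subseteq> T \<or> K \<inter> T = {}")
  case False
  have "\<not> saturated C S" if "S \<inter> B = T" for S
  proof
    assume "saturated C S"
    then have "\<forall>K \<in> C. K \<inter> B \<subseteq> T \<or> K \<inter> T = {}"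
      unfolding saturated_def using that by blast
    then show False using False by blast
  qed
  then have "{S. S \<subseteq> V \<and> S \<inter> B = T \<and> saturated C S} = {}" by blast
  then show ?thesis by (simp only: if_not_P[OF False] card.empty)
next
  case True
  let ?I = "{K \<in> C. K \<inter> B = {}}" and ?O = "{K \<in> C. K \<inter> T \<noteq> {}}"
  let ?f = "\<lambda>J. \<Union>(J \<union> ?O)"
  have disj: "K = L" if "K \<in> C" "L \<in> C" "v \<in> K" "v \<in> L" for K L v
    using that C by (auto simp: partition_on_def disjoint_def)
  have ne: "K \<noteq> {}" if "K \<in> C" for K using that C by (auto simp: partition_on_def)
  have VC: "\<Union>C = V" using C by (auto simp: partition_on_def)
  have "bij_betw ?f (Pow ?I) {S. S \<subseteq> V \<and> S \<inter> B = T \<and> saturated C S}"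
  proof (rule bij_betw_byWitness[where f' = "\<lambda>S. {K \<in> ?I. K \<subseteq> S}"])
    show "\<forall>J\<in>Pow ?I. {K \<in> ?I. K \<subseteq> ?f J} = J"
    proof
      fix J assume J: "J \<in> Pow ?I"
      show "{K \<in> ?I. K \<subseteq> ?f J} = J"
      proof (intro equalityI subsetI)
        fix K assume K: "K \<in> {K \<in> ?I. K \<subseteq> ?f J}"
        then obtain v where v: "v \<in> K" using ne by blast
        then obtain L where L: "v \<in> L" "L \<in> J \<union> ?O" using K by blast
        have "L \<in> C" using L J by auto
        then have "K = L" using disj v L K by blast
        then show "K \<in> J" using L K T by auto
      qed (use J in auto)
    qed
    show "\<forall>S\<in>{S. S \<subseteq> V \<and> S \<inter> B = T \<and> saturated C S}. ?f {K \<in> ?I. K \<subseteq> S} = S"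
    proof
      fix S assume S: "S \<in> {S. S \<subseteq> V \<and> S \<inter> B = T \<and> saturated C S}"
      show "?f {K \<in> ?I. K \<subseteq> S} = S"
      proof (intro equalityI subsetI)
        fix v assume "v \<in> ?f {K \<in> ?I. K \<subseteq> S}"
        then show "v \<in> S" using S by (auto simp: saturated_def)
      next
        fix v assume v: "v \<in> S"
        then obtain K where K: "K \<in> C" "v \<in> K" using S VC by blast
        then have "K \<subseteq> S" using S v by (auto simp: saturated_def)
        then have "K \<in> {K \<in> ?I. K \<subseteq> S} \<union> ?O" using S K by auto
        then show "v \<in> ?f {K \<in> ?I. K \<subseteq> S}" using K(2) by blast
      qed
    qed
    show "?f ` Pow ?I \<subseteq> {S. S \<subseteq> V \<and> S \<inter> B = T \<and> saturated C S}"
    proof (intro image_subsetI CollectI conjI)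
      fix J assume J: "J \<in> Pow ?I"
      show "?f J \<subseteq> V" using J VC by auto
      show "?f J \<inter> B = T"
      proof (intro equalityI subsetI)
        fix v assume "v \<in> ?f J \<inter> B"
        then show "v \<in> T" using J True by auto
      next
        fix v assume v: "v \<in> T"
        then obtain K where "K \<in> C" "v \<in> K" using VC B T by blast
        then show "v \<in> ?f J \<inter> B" using v T by auto
      qed
      show "saturated C (?f J)" unfolding saturated_def
      proof
        fix K assume K: "K \<in> C"
        show "K \<subseteq> ?f J \<or> K \<inter> ?f J = {}"
        proof (cases "K \<in> J \<union> ?O")
          case True
          then show ?thesis by blast
        next
          case False
          have "L \<in> C" if "L \<in> J \<union> ?O" for L using that J by auto
          then have "K \<inter> ?f J = {}" using disj[OF K] False by blast
          then show ?thesis ..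
        qed
      qed
    qed
    show "(\<lambda>S. {K \<in> ?I. K \<subseteq> S}) ` {S. S \<subseteq> V \<and> S \<inter> B = T \<and> saturated C S} \<subseteq> Pow ?I"
      by auto
  qed
  then have "card {S. S \<subseteq> V \<and> S \<inter> B = T \<and> saturated C S} = card (Pow ?I)"
    by (rule bij_betw_same_card[symmetric])
  also have "\<dots> = 2 ^ card ?I" using finite_elements[OF fin C] by (simp add: card_Pow)
  finally show ?thesis using True by simp
qed

lemma sum_of_bool_card: "finite A \<Longrightarrow> (\<Sum>x \<in> A. of_bool (P x)) = card {x \<in> A. P x}"
  by (simp add: Collect_conj_eq)

definition coloured :: "nat set \<Rightarrow> nat set \<Rightarrow> point set" where
  "coloured x y = Bot ` x \<union> Top ` y"

text \<open>
  The entry at \<open>(x, y)\<close> of the matrix of \<open>D\<close> on tensor powers of a two-dimensional space, where a closed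
  loop has the value \<open>2\<close>.
\<close>

definition weight :: "diagram \<Rightarrow> nat set \<Rightarrow> nat set \<Rightarrow> nat" where
  "weight D x y = of_bool (saturated D (coloured x y))"

definition matching :: "nat \<Rightarrow> nat \<Rightarrow> diagram \<Rightarrow> bool" where
  "matching m n D \<longleftrightarrow> partition_on (marked_points m n) D \<and> (\<forall>a \<in> D. card a = 2)"

text \<open>
  The number of loops is read off from the colouring with no black point, whose weight is \<open>1\<close>, and
  the matching from the vanishing of the other entries.
\<close>

lemma diagram_eqI:
  assumes D: "partition_on (marked_points m n) (fst X)" and E: "partition_on (marked_points m n) (fst Y)"
    and eq: "\<And>x y. x \<subseteq> {..<m} \<Longrightarrow> y \<subseteq> {..<n} \<Longrightarrow>
      2 ^ snd X * weight (fst X) x y = 2 ^ snd Y * weight (fst Y) x y"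
  shows "X = Y"
proof -
  have empty: "weight P {} {} = 1" for P by (simp add: weight_def saturated_def coloured_def)
  have "(2::nat) ^ snd X = 2 ^ snd Y" using eq[of "{}" "{}"] by (simp add: empty)
  then have s: "snd X = snd Y" by simp
  have "fst X = fst Y"
  proof (rule partition_eqI[OF D E])
    fix S assume S: "S \<subseteq> marked_points m n"
    let ?x = "{i. Bot i \<in> S}" and ?y = "{i. Top i \<in> S}"
    have S': "coloured ?x ?y = S"
    proof (intro set_eqI)
      fix p show "p \<in> coloured ?x ?y \<longleftrightarrow> p \<in> S" by (cases p) (auto simp: coloured_def)
    qed
    have "?x \<subseteq> {..<m}" "?y \<subseteq> {..<n}"
      using S by (auto simp: marked_points_def)
    then have "weight (fst X) ?x ?y = weight (fst Y) ?x ?y"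
      using eq[of ?x ?y] s by simp
    then show "saturated (fst X) S \<longleftrightarrow> saturated (fst Y) S"
      unfolding weight_def S' by (simp add: of_bool_def split: if_splits)
  qed
  with s show ?thesis by (simp add: prod_eq_iff)
qed

lemma inj_places: "inj place_below" "inj place_above" "inj place_outer"
proof -
  show "inj place_below"
  proof (rule injI)
    fix a b assume "place_below a = place_below b" then show "a = b" by (cases a; cases b) auto
  qed
  show "inj place_above"
  proof (rule injI)
    fix a b assume "place_above a = place_above b" then show "a = b" by (cases a; cases b) auto
  qed
  show "inj place_outer"
  proof (rule injI)
    fix a b assume "place_outer a = place_outer b" then show "a = b" by (cases a; cases b) auto
  qed
qed

definition outer :: "nat set \<Rightarrow> nat set \<Rightarrow> level_point set" where
  "outer x z = Lower ` x \<union> Upper ` z"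

lemma outer_eq: "outer x z = place_outer ` coloured x z"
  by (auto simp: outer_def coloured_def image_Un image_image)

lemma stack_arcs_points:
  assumes "matching m n D" "matching n k E"
  shows "\<Union>(stack_arcs E D) = outer {..<m} {..<k} \<union> Middle ` {..<n}"
proof -
  have "\<Union>(stack_arcs E D) = place_below ` \<Union>D \<union> place_above ` \<Union>E"
    by (auto simp: stack_arcs_def)
  also have "\<dots> = place_below ` marked_points m n \<union> place_above ` marked_points n k"
    using assms by (simp add: matching_def partition_on_def)
  finally show ?thesis by (auto simp: outer_def marked_points_def image_Un image_image)
qed

lemma stack_arcs_card:
  assumes "matching m n D" "matching n k E" "a \<in> stack_arcs E D"
  shows "card a = 2"
  using assms inj_places
  by (auto simp: stack_arcs_def matching_def) (metis card_image inj_on_subset subset_UNIV)+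

text \<open>
  That the blocks are pairs comes later, together with planarity (\<open>tl_stack\<close>).
\<close>

lemma stack_partition:
  assumes "matching m n D" "matching n k E"
  shows "partition_on (marked_points m k) (fst (stack E D))"
proof -
  let ?C = "components (stack_arcs E D)"
  have C: "partition_on (outer {..<m} {..<k} \<union> Middle ` {..<n}) ?C"
    using components_partition stack_arcs_points[OF assms] by metis
  show ?thesis
  proof (rule partition_onI)
    show "{} \<notin> fst (stack E D)" by (auto simp: stack_def)
  next
    have "\<Union>(fst (stack E D)) = place_outer -` \<Union>?C"
      by (auto simp: stack_def)
    also have "\<Union>?C = outer {..<m} {..<k} \<union> Middle ` {..<n}"
      using C by (auto simp: partition_on_def)
    also have "place_outer -` \<dots> = marked_points m k"
    proof (rule set_eqI)
      fix p show "p \<in> place_outer -` (outer {..<m} {..<k} \<union> Middle ` {..<n}) \<longleftrightarrow> p \<in> marked_points m k"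
        by (cases p) (auto simp: outer_def marked_points_def)
    qed
    finally show "\<Union>(fst (stack E D)) = marked_points m k" .
  next
    fix p q assume "p \<in> fst (stack E D)" "q \<in> fst (stack E D)" "p \<noteq> q"
    then obtain K L where KL: "K \<in> ?C" "L \<in> ?C" "p = place_outer -` K" "q = place_outer -` L"
      by (auto simp: stack_def)
    with \<open>p \<noteq> q\<close> have "K \<noteq> L" by blast
    then have "K \<inter> L = {}" using KL(1,2) C unfolding partition_on_def disjoint_def by blast
    then show "disjnt p q" unfolding KL disjnt_def by (simp add: vimage_Int[symmetric])
  qed
qed

text \<open>
  Only the middle points are coloured freely once the boundary colouring is prescribed.
\<close>

lemma middle_colourings:
  assumes x: "x \<subseteq> {..<m}" and z: "z \<subseteq> {..<k}"
  shows "card {y \<in> Pow {..<n}. saturated C (outer x z \<union> Middle ` y)} =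
    card {S. S \<subseteq> outer {..<m} {..<k} \<union> Middle ` {..<n} \<and>
      S \<inter> (outer {..<m} {..<k}) = outer x z \<and> saturated C S}"
    (is "card ?L = card ?R")
proof (rule bij_betw_same_card[where f = "\<lambda>y. outer x z \<union> Middle ` y"])
  show "bij_betw (\<lambda>y. outer x z \<union> Middle ` y) ?L ?R"
  proof (rule bij_betw_byWitness[where f' = "\<lambda>S. {j. Middle j \<in> S}"])
    have inv: "outer x z \<union> Middle ` {j. Middle j \<in> S} = S" if V: "S \<subseteq> outer {..<m} {..<k} \<union> Middle ` {..<n}" and B: "S \<inter> outer {..<m} {..<k} = outer x z" for S
    proof (intro set_eqI)
      fix v
      have outer_iff: "v \<in> S \<longleftrightarrow> v \<in> outer x z" if v: "v \<notin> range Middle"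
      proof
        assume vS: "v \<in> S"
        with V have "v \<in> outer {..<m} {..<k} \<union> Middle ` {..<n}" by (rule subsetD)
        with v have "v \<in> outer {..<m} {..<k}" by auto
        with vS show "v \<in> outer x z" unfolding B[symmetric] by simp
      next
        assume "v \<in> outer x z"
        then show "v \<in> S" unfolding B[symmetric] by simp
      qed
      show "v \<in> outer x z \<union> Middle ` {j. Middle j \<in> S} \<longleftrightarrow> v \<in> S"
      proof (cases "v \<in> range Middle")
        case True
        then show ?thesis by (auto simp: outer_def)
      next
        case False
        then show ?thesis using outer_iff by (auto simp: outer_def)
      qed
    qed
    then show "\<forall>S\<in>?R. outer x z \<union> Middle ` {j. Middle j \<in> S} = S"
      by simp
    show "(\<lambda>S. {j. Middle j \<in> S}) ` ?R
      \<subseteq> ?L"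
    proof (intro image_subsetI)
      fix S assume "S \<in> ?R"
      then have S: "S \<subseteq> outer {..<m} {..<k} \<union> Middle ` {..<n}" "S \<inter> outer {..<m} {..<k} = outer x z" "saturated C S" by simp_all
      have "{j. Middle j \<in> S} \<subseteq> {..<n}" using S(1) by (auto simp: outer_def)
      then show "{j. Middle j \<in> S} \<in> ?L"
        using S(3) by (simp add: inv[OF S(1,2)])
    qed
    show "\<forall>y\<in>?L. {j. Middle j \<in> outer x z \<union> Middle ` y} = y"
      by (auto simp: outer_def)
    show "(\<lambda>y. outer x z \<union> Middle ` y) ` ?L
      \<subseteq> ?R"
    proof (intro image_subsetI CollectI conjI)
      fix y assume y: "y \<in> ?L"
      show "outer x z \<union> Middle ` y \<subseteq> outer {..<m} {..<k} \<union> Middle ` {..<n}" using x z y by (auto simp: outer_def)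
      show "(outer x z \<union> Middle ` y) \<inter> outer {..<m} {..<k} = outer x z" using x z by (auto simp: outer_def)
      show "saturated C (outer x z \<union> Middle ` y)" using y by simp
    qed
  qed
qed

text \<open>
  Each component of the stacked picture carries a single colour: prescribed if it reaches the boundary, and
  free if it is a closed loop.
\<close>

lemma stack_weight:
  assumes D: "matching m n D" and E: "matching n k E"
    and x: "x \<subseteq> {..<m}" and z: "z \<subseteq> {..<k}"
  shows "(\<Sum>y \<in> Pow {..<n}. weight D x y * weight E y z)
       = 2 ^ snd (stack E D) * weight (fst (stack E D)) x z"
proof -
  let ?A = "stack_arcs E D" let ?C = "components ?A"
  let ?V = "outer {..<m} {..<k} \<union> Middle ` {..<n}"
  let ?B = "outer {..<m} {..<k}" let ?T = "outer x z"
  have C: "partition_on ?V ?C"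
    using components_partition stack_arcs_points[OF D E] by metis
  have CV: "K \<subseteq> ?V" if "K \<in> ?C" for K using that C by (auto simp: partition_on_def)
  have *: "weight D x y * weight E y z = of_bool (saturated ?C (?T \<union> Middle ` y))" for y
  proof -
    have 1: "saturated (image place_below ` D) (?T \<union> Middle ` y) \<longleftrightarrow> saturated D (coloured x y)"
    proof -
      have "place_below p \<in> ?T \<union> Middle ` y \<longleftrightarrow> p \<in> coloured x y" for p
        by (cases p) (auto simp: outer_def coloured_def)
      then have "place_below -` (?T \<union> Middle ` y) = coloured x y" by (intro set_eqI) (simp only: vimage_eq)
      then show ?thesis by (simp add: saturated_image)
    qed
    have 2: "saturated (image place_above ` E) (?T \<union> Middle ` y) \<longleftrightarrow> saturated E (coloured y z)"
    proof -
      have "place_above p \<in> ?T \<union> Middle ` y \<longleftrightarrow> p \<in> coloured y z" for p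
        by (cases p) (auto simp: outer_def coloured_def)
      then have "place_above -` (?T \<union> Middle ` y) = coloured y z" by (intro set_eqI) (simp only: vimage_eq)
      then show ?thesis by (simp add: saturated_image)
    qed
    have "saturated ?C (?T \<union> Middle ` y) \<longleftrightarrow> saturated ?A (?T \<union> Middle ` y)"
      using saturated_components stack_arcs_card[OF D E] by blast
    then show ?thesis by (auto simp: stack_arcs_def saturated_Un 1 2 weight_def)
  qed
  have sum_eq: "(\<Sum>y \<in> Pow {..<n}. weight D x y * weight E y z) = card {y \<in> Pow {..<n}. saturated ?C (?T \<union> Middle ` y)}"
    unfolding * by (rule sum_of_bool_card) simp
  have card_eq: "card {S. S \<subseteq> ?V \<and> S \<inter> ?B = ?T \<and> saturated ?C S} =
    (if \<forall>K \<in> ?C. K \<inter> ?B \<subseteq> ?T \<or> K \<inter> ?T = {} then 2 ^ card {K \<in> ?C. K \<inter> ?B = {}} else 0)"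
    using x z by (intro card_saturated_extensions[OF C]) (auto simp: outer_def)
  have KB: "K \<inter> ?B = place_outer ` (place_outer -` K)" if "K \<in> ?C" for K
  proof (intro equalityI subsetI)
    fix v assume v: "v \<in> K \<inter> ?B"
    then obtain p where "v = place_outer p" by (auto simp: outer_eq)
    then show "v \<in> place_outer ` (place_outer -` K)" using v by blast
  next
    fix v assume "v \<in> place_outer ` (place_outer -` K)"
    then obtain p where "v = place_outer p" "place_outer p \<in> K" by auto
    then show "v \<in> K \<inter> ?B" using CV[OF that] by (cases p) (auto simp: outer_def)
  qed
  have inner: "{K \<in> ?C. K \<inter> ?B = {}} = {K \<in> ?C. place_outer -` K = {}}"
  proof -
    have "K \<inter> ?B = {} \<longleftrightarrow> place_outer -` K = {}" if "K \<in> ?C" for K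
      unfolding KB[OF that] by (rule image_is_empty)
    then show ?thesis by (intro Collect_cong conj_cong refl)
  qed
  have loops: "card {K \<in> ?C. place_outer -` K = {}} = snd (stack E D)" by (simp add: stack_def)
  have outer_iff: "(\<forall>K \<in> ?C. K \<inter> ?B \<subseteq> ?T \<or> K \<inter> ?T = {}) \<longleftrightarrow> saturated (fst (stack E D)) (coloured x z)"
  proof -
    have "K \<inter> ?B \<subseteq> ?T \<or> K \<inter> ?T = {} \<longleftrightarrow>
      place_outer -` K \<subseteq> coloured x z \<or> place_outer -` K \<inter> coloured x z = {}" if "K \<in> ?C" for K
    proof -
      have "K \<inter> ?B \<subseteq> ?T \<longleftrightarrow> place_outer -` K \<subseteq> coloured x z"
        unfolding KB[OF that] outer_eq[of x z] by (rule inj_image_subset_iff[OF inj_places(3)])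
      moreover have "K \<inter> ?T = {} \<longleftrightarrow> place_outer -` K \<inter> coloured x z = {}"
        unfolding outer_eq[of x z] by blast
      ultimately show ?thesis by blast
    qed
    moreover have "fst (stack E D) = {place_outer -` K | K. K \<in> ?C \<and> place_outer -` K \<noteq> {}}"
      by (simp add: stack_def)
    moreover have "saturated {f K | K. K \<in> Q \<and> f K \<noteq> {}} S \<longleftrightarrow> (\<forall>K \<in> Q. f K \<subseteq> S \<or> f K \<inter> S = {})" for f and Q :: "level_point set set" and S :: "point set"
      by (auto simp: saturated_def)
    ultimately show ?thesis by simp
  qed
  show ?thesis
    unfolding sum_eq middle_colourings[OF x z] card_eq inner loops outer_iff
    by (simp add: weight_def)
qed

lemma tl_diagrams_iff: "D \<in> tl_diagrams m n \<longleftrightarrow> matching m n D \<and> planar m n D"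
  by (auto simp: tl_diagrams_def matching_def)

text \<open>
  A composite can be computed by guessing the result and comparing matrices.
\<close>

lemma stack_eqI:
  assumes D: "matching m n D" and E: "matching n k E" and X: "partition_on (marked_points m k) X"
    and eq: "\<And>x z. x \<subseteq> {..<m} \<Longrightarrow> z \<subseteq> {..<k} \<Longrightarrow>
      (\<Sum>y \<in> Pow {..<n}. weight D x y * weight E y z) = 2 ^ l * weight X x z"
  shows "stack E D = (X, l)"
proof (rule diagram_eqI[OF stack_partition[OF D E], where Y = "(X, l)"])
  show "partition_on (marked_points m k) (fst (X, l))" using X by simp
qed (simp add: stack_weight[OF D E, symmetric] eq)

text \<open>
  Both bracketings have the matrix product of all three weights; since matrices also see the factor
  \<open>2\<close> of each loop, the total numbers of loops agree as well.
\<close>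

lemma stack_assoc:
  assumes D: "matching m n D" and E: "matching n k E" and G: "matching k l G"
    and ED: "matching m k (fst (stack E D))" and GE: "matching n l (fst (stack G E))"
  shows "fst (stack G (fst (stack E D))) = fst (stack (fst (stack G E)) D)"
    and "snd (stack G (fst (stack E D))) + snd (stack E D) = snd (stack (fst (stack G E)) D) + snd (stack G E)"
proof -
  let ?X = "(fst (stack G (fst (stack E D))), snd (stack G (fst (stack E D))) + snd (stack E D))"
  let ?Y = "(fst (stack (fst (stack G E)) D), snd (stack (fst (stack G E)) D) + snd (stack G E))"
  have "?X = ?Y"
  proof (rule diagram_eqI)
    show "partition_on (marked_points m l) (fst ?X)" using stack_partition[OF ED G] by simp
    show "partition_on (marked_points m l) (fst ?Y)" using stack_partition[OF D GE] by simp
    fix x w assume x: "x \<subseteq> {..<m}" and w: "w \<subseteq> {..<l}"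
    have "2 ^ snd ?X * weight (fst ?X) x w
        = 2 ^ snd (stack E D) * (2 ^ snd (stack G (fst (stack E D))) * weight (fst ?X) x w)"
      by (simp add: power_add)
    also have "\<dots> = (\<Sum>z \<in> Pow {..<k}. (2 ^ snd (stack E D) * weight (fst (stack E D)) x z) * weight G z w)"
      unfolding fst_conv stack_weight[OF ED G x w, symmetric] by (simp add: sum_distrib_left mult.assoc)
    also have "\<dots> = (\<Sum>z \<in> Pow {..<k}. \<Sum>y \<in> Pow {..<n}. weight D x y * weight E y z * weight G z w)"
      using stack_weight[OF D E x] by (intro sum.cong refl) (simp add: sum_distrib_right[symmetric])
    also have "\<dots> = (\<Sum>y \<in> Pow {..<n}. \<Sum>z \<in> Pow {..<k}. weight D x y * weight E y z * weight G z w)"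
      by (rule sum.swap)
    also have "\<dots> = (\<Sum>y \<in> Pow {..<n}. weight D x y * (2 ^ snd (stack G E) * weight (fst (stack G E)) y w))"
      using stack_weight[OF E G _ w] by (intro sum.cong refl) (simp add: sum_distrib_left[symmetric] mult.assoc)
    also have "\<dots> = 2 ^ snd (stack G E) * (2 ^ snd (stack (fst (stack G E)) D) * weight (fst ?Y) x w)"
      unfolding fst_conv stack_weight[OF D GE x w, symmetric] by (simp add: sum_distrib_left mult_ac)
    finally show "2 ^ snd ?X * weight (fst ?X) x w = 2 ^ snd ?Y * weight (fst ?Y) x w"
      by (simp add: power_add mult_ac)
  qed
  then show "fst (stack G (fst (stack E D))) = fst (stack (fst (stack G E)) D)"
    and "snd (stack G (fst (stack E D))) + snd (stack E D) = snd (stack (fst (stack G E)) D) + snd (stack G E)"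
    by simp_all
qed

lemma matching_block_subset: "matching m n D \<Longrightarrow> a \<in> D \<Longrightarrow> a \<subseteq> marked_points m n"
  by (auto simp: matching_def partition_on_def)

text \<open>
  With this, sums over colourings can be reindexed without keeping track of supports.
\<close>

lemma weight_restrict:
  assumes "matching m n D"
  shows "weight D x y = weight D (x \<inter> {..<m}) (y \<inter> {..<n})"
proof -
  have "a \<inter> coloured x y = a \<inter> coloured (x \<inter> {..<m}) (y \<inter> {..<n})" if "a \<in> D" for a
    using matching_block_subset[OF assms that] by (auto simp: coloured_def marked_points_def)
  moreover have "a \<subseteq> S \<longleftrightarrow> a \<inter> S = a" for a S :: "point set" by blast
  ultimately show ?thesis unfolding weight_def saturated_def by simp
qed

lemma weight_insert_Un:
  "weight (insert a D) x y = of_bool (a \<subseteq> coloured x y \<or> a \<inter> coloured x y = {}) * weight D x y"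
  "weight (D \<union> E) x y = weight D x y * weight E x y"
  by (auto simp: weight_def saturated_def)

lemma weight_image: "f -` coloured x y = coloured x' y' \<Longrightarrow> weight (image f ` D) x y = weight D x' y'"
  by (simp add: weight_def saturated_image)

lemma mem_coloured [simp]: "Bot i \<in> coloured x y \<longleftrightarrow> i \<in> x" "Top j \<in> coloured x y \<longleftrightarrow> j \<in> y"
  by (auto simp: coloured_def)

lemma mem_marked_points [simp]: "Bot i \<in> marked_points m n \<longleftrightarrow> i < m" "Top j \<in> marked_points m n \<longleftrightarrow> j < n"
  by (auto simp: marked_points_def)

lemma point_set_eqI: "(\<And>i. Bot i \<in> A \<longleftrightarrow> Bot i \<in> B) \<Longrightarrow> (\<And>j. Top j \<in> A \<longleftrightarrow> Top j \<in> B) \<Longrightarrow> A = B"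
  by (metis point.exhaust set_eqI)

lemma partition_image:
  assumes P: "partition_on A P" and f: "inj f"
  shows "partition_on (f ` A) (image f ` P)"
proof -
  have "partition_on (f ` A) (image f ` P - {{}})"
    by (rule partition_on_inj_image[OF P inj_on_subset[OF f]]) simp
  moreover have "{} \<notin> image f ` P" using P by (auto simp: partition_on_def)
  ultimately show ?thesis by simp
qed

lemma matching_image:
  assumes D: "matching m n D" and f: "inj f"
  shows "partition_on (f ` marked_points m n) (image f ` D)" "\<And>a. a \<in> image f ` D \<Longrightarrow> card a = 2"
proof -
  have f': "inj_on f A" for A using f by (rule inj_on_subset) simp
  show "partition_on (f ` marked_points m n) (image f ` D)"
    using partition_image[OF _ f] D by (simp add: matching_def)
  show "card a = 2" if "a \<in> image f ` D" for a
    using that D card_image[OF f'] by (auto simp: matching_def)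
qed

lemma arc_image:
  assumes f: "inj f"
  shows "{f a, f b} \<in> image f ` D \<longleftrightarrow> {a, b} \<in> D"
proof -
  have "inj (image f)" using f by (simp add: inj_def inj_image_eq_iff)
  from inj_image_mem_iff[OF this, of "{a, b}" D] show ?thesis by simp
qed

section \<open>Reflection in a horizontal line\<close>

fun flip :: "point \<Rightarrow> point" where
  "flip (Bot i) = Top i"
| "flip (Top i) = Bot i"

lemma flip_flip [simp]: "flip (flip p) = p" by (cases p) auto

lemma inj_flip: "inj flip" by (metis flip_flip injI)

definition mirror :: "diagram \<Rightarrow> diagram" where
  "mirror D = image flip ` D"

lemma mirror_mirror [simp]: "mirror (mirror D) = D"
  by (simp add: mirror_def image_image)

lemma flip_marked_points: "flip ` marked_points m n = marked_points n m"
  by (auto simp: marked_points_def image_Un image_image)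

lemma matching_mirror: "matching m n D \<Longrightarrow> matching n m (mirror D)"
  using matching_image[of m n D flip] inj_flip by (auto simp: flip_marked_points mirror_def matching_def)

lemma weight_mirror: "weight (mirror D) x y = weight D y x"
  unfolding mirror_def by (rule weight_image) (auto intro!: point_set_eqI)

text \<open>
  Reflection transposes matrices, so it reverses the order of stacking.
\<close>

lemma stack_mirror:
  assumes D: "matching m n D" and E: "matching n k E"
  shows "stack (mirror D) (mirror E) = (mirror (fst (stack E D)), snd (stack E D))"
proof (rule stack_eqI[OF matching_mirror[OF E] matching_mirror[OF D]])
  have "partition_on (flip ` marked_points m k) (image flip ` fst (stack E D))"
    by (rule partition_image[OF stack_partition[OF D E] inj_flip])
  then show "partition_on (marked_points k m) (mirror (fst (stack E D)))"
    by (simp add: flip_marked_points mirror_def)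
next
  fix x z assume "x \<subseteq> {..<k}" "z \<subseteq> {..<m}"
  then show "(\<Sum>y \<in> Pow {..<n}. weight (mirror E) x y * weight (mirror D) y z)
    = 2 ^ snd (stack E D) * weight (mirror (fst (stack E D))) x z"
    using stack_weight[OF D E, of z x] by (simp add: weight_mirror mult.commute)
qed

lemma arc_mirror: "{a, b} \<in> mirror D \<longleftrightarrow> {flip a, flip b} \<in> D"
  using arc_image[OF inj_flip, of "flip a" "flip b" D] by (simp add: mirror_def)

text \<open>
  Reflection reverses the boundary circle, cut open at the lower left corner.
\<close>

lemma boundary_pos_flip:
  "p \<in> marked_points m n \<Longrightarrow> boundary_pos n m (flip p) = m + n - 1 - boundary_pos m n p"
  by (cases p) auto

lemma planar_mirror:
  assumes D: "matching m n D" and pl: "planar m n D"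
  shows "planar n m (mirror D)"
  unfolding planar_def
proof (intro notI, elim exE conjE)
  fix a b c e
  assume *: "{a, b} \<in> mirror D" "{c, e} \<in> mirror D" "boundary_pos n m a < boundary_pos n m c"
    "boundary_pos n m c < boundary_pos n m b" "boundary_pos n m b < boundary_pos n m e"
  have arcs: "{flip b, flip a} \<in> D" "{flip e, flip c} \<in> D" using * by (auto simp: arc_mirror insert_commute)
  have mem: "flip a \<in> marked_points m n" "flip b \<in> marked_points m n" "flip c \<in> marked_points m n" "flip e \<in> marked_points m n"
    using arcs matching_block_subset[OF D] by blast+
  have "boundary_pos n m p = m + n - 1 - boundary_pos m n (flip p)" if "flip p \<in> marked_points m n" for p
    using boundary_pos_flip[OF that] by simp
  then have "boundary_pos m n (flip e) < boundary_pos m n (flip b)"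
    "boundary_pos m n (flip b) < boundary_pos m n (flip c)" "boundary_pos m n (flip c) < boundary_pos m n (flip a)"
    using * mem by simp_all
  then show False using arcs pl unfolding planar_def by blast
qed

lemma tl_mirror: "D \<in> tl_diagrams m n \<Longrightarrow> mirror D \<in> tl_diagrams n m"
  by (simp add: tl_diagrams_iff matching_mirror planar_mirror)

text \<open>
  The position of top point \<open>j\<close> after two new points \<open>i\<close> and \<open>i + 1\<close> have been inserted.
\<close>

definition skip :: "nat \<Rightarrow> nat \<Rightarrow> nat" where
  "skip i j = (if j < i then j else j + 2)"

fun raise :: "nat \<Rightarrow> point \<Rightarrow> point" where
  "raise i (Bot j) = Bot j"
| "raise i (Top j) = Top (skip i j)"

definition add_cup :: "nat \<Rightarrow> diagram \<Rightarrow> diagram" where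
  "add_cup i D = insert {Top i, Top (Suc i)} (image (raise i) ` D)"

lemma skip_simps [simp]: "skip i j \<noteq> i" "skip i j \<noteq> Suc i" "skip i j = skip i k \<longleftrightarrow> j = k"
  "skip i j < skip i k \<longleftrightarrow> j < k" "i \<le> n \<Longrightarrow> skip i j < Suc (Suc n) \<longleftrightarrow> j < n"
  by (auto simp: skip_def)

lemma skip_cases: "j = i \<or> j = Suc i \<or> (\<exists>k. j = skip i k)"
proof -
  have "j < i \<Longrightarrow> j = skip i j" "j > Suc i \<Longrightarrow> j = skip i (j - 2)" by (auto simp: skip_def)
  moreover have "j < i \<or> j = i \<or> j = Suc i \<or> j > Suc i" by linarith
  ultimately show ?thesis by blast
qed

lemma inj_raise: "inj (raise i)"
proof (rule injI)
  fix p q assume "raise i p = raise i q" then show "p = q" by (cases p; cases q) auto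
qed

lemma raise_neq [simp]: "raise i p \<noteq> Top i" "raise i p \<noteq> Top (Suc i)"
  "Top i \<noteq> raise i p" "Top (Suc i) \<noteq> raise i p"
proof -
  show "raise i p \<noteq> Top i" "raise i p \<noteq> Top (Suc i)" by (cases p, simp, simp)+
  then show "Top i \<noteq> raise i p" "Top (Suc i) \<noteq> raise i p" by metis+
qed

lemmas raise_eq_iff [simp] = inj_eq[OF inj_raise]

lemma raise_mem_marked_points [simp]:
  "i \<le> n \<Longrightarrow> raise i p \<in> marked_points m (Suc (Suc n)) \<longleftrightarrow> p \<in> marked_points m n"
  by (cases p) simp_all

lemma raise_cases: "p = Top i \<or> p = Top (Suc i) \<or> (\<exists>q. p = raise i q)"
proof (cases p)
  case (Bot j)
  then have "p = raise i (Bot j)" by simp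
  then show ?thesis by blast
next
  case (Top j)
  consider "j = i" | "j = Suc i" | k where "j = skip i k" using skip_cases by blast
  then show ?thesis
  proof cases
    case 3
    then have "p = raise i (Top k)" using Top by simp
    then show ?thesis by blast
  qed (use Top in simp_all)
qed

lemma marked_points_raise:
  assumes "i \<le> n"
  shows "marked_points m (Suc (Suc n)) = {Top i, Top (Suc i)} \<union> raise i ` marked_points m n"
proof (intro equalityI subsetI)
  fix p assume "p \<in> marked_points m (Suc (Suc n))"
  then show "p \<in> {Top i, Top (Suc i)} \<union> raise i ` marked_points m n"
    using raise_cases[of p i] assms by auto
qed (use assms in auto)

lemma matching_add_cup:
  assumes D: "matching m n D" and i: "i \<le> n"
  shows "matching m (Suc (Suc n)) (add_cup i D)"
proof -
  have "partition_on ({Top i, Top (Suc i)} \<union> raise i ` marked_points m n) (add_cup i D)"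
  proof -
    have P: "partition_on (raise i ` marked_points m n) (image (raise i) ` D)"
      using matching_image[OF D inj_raise] by blast
    have "{Top i, Top (Suc i)} \<union> raise i ` marked_points m n - {Top i, Top (Suc i)} = raise i ` marked_points m n"
      by auto
    moreover have "disjnt {Top i, Top (Suc i)} (\<Union>(image (raise i) ` D))" by (auto simp: disjnt_def)
    ultimately show ?thesis using P by (simp add: add_cup_def partition_on_insert)
  qed
  then show ?thesis
    using matching_image(2)[OF D inj_raise[of i]] i
    by (auto simp: matching_def marked_points_raise add_cup_def)
qed

lemmas arc_raise = arc_image[OF inj_raise]

lemma boundary_pos_raise:
  assumes "i \<le> n" "p \<in> marked_points m n" "q \<in> marked_points m n"
  shows "boundary_pos m (Suc (Suc n)) (raise i p) < boundary_pos m (Suc (Suc n)) (raise i q)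
    \<longleftrightarrow> boundary_pos m n p < boundary_pos m n q"
  using assms by (cases p; cases q) (auto simp: skip_def)

text \<open>
  The two new points are neighbours on the boundary: every other point lies on the same side of both.
\<close>

lemma boundary_pos_raise_cup:
  assumes "i \<le> n" "p \<in> marked_points m n"
  shows "boundary_pos m (Suc (Suc n)) (raise i p) < boundary_pos m (Suc (Suc n)) (Top (Suc i)) \<longleftrightarrow>
    boundary_pos m (Suc (Suc n)) (raise i p) < boundary_pos m (Suc (Suc n)) (Top i)"
    and "boundary_pos m (Suc (Suc n)) (raise i p) \<noteq> boundary_pos m (Suc (Suc n)) (Top (Suc i))"
    and "boundary_pos m (Suc (Suc n)) (raise i p) \<noteq> boundary_pos m (Suc (Suc n)) (Top i)"
  using assms by (cases p; auto simp: skip_def)+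

section \<open>Cups, caps and identities\<close>

text \<open>
  An arc between neighbouring points cannot be crossed, and inserting it keeps the order of the old points.
\<close>

lemma planar_add_cup:
  assumes D: "matching m n D" and pl: "planar m n D" and i: "i \<le> n"
  shows "planar m (Suc (Suc n)) (add_cup i D)"
  unfolding planar_def
proof (intro notI, elim exE conjE)
  let ?pos = "boundary_pos m (Suc (Suc n))"
  fix a b c e
  assume arcs: "{a, b} \<in> add_cup i D" "{c, e} \<in> add_cup i D"
    and less: "?pos a < ?pos c" "?pos c < ?pos b" "?pos b < ?pos e"
  have adj: "?pos (Top i) = Suc (?pos (Top (Suc i)))" using i by simp
  have cases: "{u, v} = {Top i, Top (Suc i)} \<or> (\<exists>u' v'. u = raise i u' \<and> v = raise i v' \<and> {u', v'} \<in> D)"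
    if uv: "{u, v} \<in> add_cup i D" for u v
  proof (cases "{u, v} = {Top i, Top (Suc i)}")
    case False
    then have "{u, v} \<in> image (raise i) ` D" using uv by (simp add: add_cup_def)
    moreover from this obtain u' v' where "u = raise i u'" "v = raise i v'" by blast
    ultimately show ?thesis by (auto simp: arc_raise)
  qed simp
  from cases[OF arcs(1)] show False
  proof (elim disjE exE conjE)
    assume "{a, b} = {Top i, Top (Suc i)}"
    then show False using less(1,2) adj by (auto simp: doubleton_eq_iff)
  next
    fix a' b' assume ab: "a = raise i a'" "b = raise i b'" "{a', b'} \<in> D"
    from cases[OF arcs(2)] show False
    proof (elim disjE exE conjE)
      assume "{c, e} = {Top i, Top (Suc i)}"
      then show False using less(2,3) adj by (auto simp: doubleton_eq_iff)
    next
      fix c' e' assume ce: "c = raise i c'" "e = raise i e'" "{c', e'} \<in> D"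
      have mem: "a' \<in> marked_points m n" "b' \<in> marked_points m n" "c' \<in> marked_points m n" "e' \<in> marked_points m n"
        using ab(3) ce(3) matching_block_subset[OF D] by blast+
      have "boundary_pos m n a' < boundary_pos m n c'" "boundary_pos m n c' < boundary_pos m n b'"
        "boundary_pos m n b' < boundary_pos m n e'"
        using less ab ce mem boundary_pos_raise[OF i] by simp_all
      then show False using pl ab(3) ce(3) unfolding planar_def by blast
    qed
  qed
qed

lemma tl_add_cup: "D \<in> tl_diagrams m n \<Longrightarrow> i \<le> n \<Longrightarrow> add_cup i D \<in> tl_diagrams m (Suc (Suc n))"
  by (simp add: tl_diagrams_iff matching_add_cup planar_add_cup)

lemma id_diagram_image: "id_diagram n = (\<lambda>i. {Bot i, Top i}) ` {..<n}"
  by (auto simp: id_diagram_def)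

lemma matching_id: "matching n n (id_diagram n)"
  unfolding matching_def
proof (intro conjI ballI partition_onI)
  show "\<Union>(id_diagram n) = marked_points n n"
    by (auto simp: id_diagram_def marked_points_def)
  show "card a = 2" if "a \<in> id_diagram n" for a using that by (auto simp: id_diagram_def)
qed (auto simp: id_diagram_def disjnt_def)

lemma tl_id_diagram: "id_diagram n \<in> tl_diagrams n n"
proof -
  have "planar n n (id_diagram n)"
    unfolding planar_def
  proof (intro notI, elim exE conjE)
    fix a b c e
    assume "{a, b} \<in> id_diagram n" "{c, e} \<in> id_diagram n"
    and less: "boundary_pos n n a < boundary_pos n n c" "boundary_pos n n c < boundary_pos n n b" "boundary_pos n n b < boundary_pos n n e"
    then obtain i j where "i < n" "{a, b} = {Bot i, Top i}" "j < n" "{c, e} = {Bot j, Top j}"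
      by (auto simp: id_diagram_def)
    then show False using less by (auto simp: doubleton_eq_iff)
  qed
  then show ?thesis using matching_id by (simp add: tl_diagrams_iff)
qed

definition cup :: "nat \<Rightarrow> nat \<Rightarrow> diagram" where
  "cup n i = add_cup i (id_diagram n)"

definition cap :: "nat \<Rightarrow> nat \<Rightarrow> diagram" where
  "cap n i = mirror (cup n i)"

lemma tl_cup: "i \<le> n \<Longrightarrow> cup n i \<in> tl_diagrams n (Suc (Suc n))"
  unfolding cup_def by (rule tl_add_cup[OF tl_id_diagram])

lemma tl_cap: "i \<le> n \<Longrightarrow> cap n i \<in> tl_diagrams (Suc (Suc n)) n"
  unfolding cap_def by (rule tl_mirror[OF tl_cup])

lemma matching_cup: "i \<le> n \<Longrightarrow> matching n (Suc (Suc n)) (cup n i)"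
  and matching_cap: "i \<le> n \<Longrightarrow> matching (Suc (Suc n)) n (cap n i)"
  using tl_cup tl_cap by (simp_all add: tl_diagrams_iff)

lemma weight_id: "weight (id_diagram n) x y = of_bool (x \<inter> {..<n} = y \<inter> {..<n})"
proof -
  have "saturated (id_diagram n) (coloured x y) \<longleftrightarrow> (\<forall>i<n. i \<in> x \<longleftrightarrow> i \<in> y)"
    unfolding saturated_def id_diagram_image by auto
  also have "\<dots> \<longleftrightarrow> x \<inter> {..<n} = y \<inter> {..<n}" by auto
  finally show ?thesis by (simp add: weight_def)
qed

lemma weight_add_cup: "weight (add_cup i D) x y = of_bool (i \<in> y \<longleftrightarrow> Suc i \<in> y) * weight D x {j. skip i j \<in> y}"
proof -
  have "weight (image (raise i) ` D) x y = weight D x {j. skip i j \<in> y}"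
    by (rule weight_image) (auto intro!: point_set_eqI)
  then show ?thesis by (auto simp: add_cup_def weight_insert_Un)
qed

text \<open>
  The colourings of \<open>n + 2\<close> points compatible with a cap at \<open>i\<close> and with the colouring \<open>z\<close> of the
  other points; \<open>b\<close> is the colour of the two ends of the cap.
\<close>

definition widen :: "nat \<Rightarrow> nat set \<Rightarrow> bool \<Rightarrow> nat set" where
  "widen i z b = skip i ` z \<union> (if b then {i, Suc i} else {})"

lemma mem_widen [simp]: "i \<in> widen i z b \<longleftrightarrow> b" "Suc i \<in> widen i z b \<longleftrightarrow> b" "skip i j \<in> widen i z b \<longleftrightarrow> j \<in> z"
  using skip_simps(1,2)[of i] by (auto simp: widen_def dest: sym)

lemma weight_cap_widen:
  assumes i: "i \<le> n" and z: "z \<subseteq> {..<n}" and y: "y \<subseteq> {..<Suc (Suc n)}"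
  shows "weight (cap n i) y z = of_bool (y = widen i z (i \<in> y))"
proof -
  have "(i \<in> y \<longleftrightarrow> Suc i \<in> y) \<and> z \<inter> {..<n} = {j. skip i j \<in> y} \<inter> {..<n} \<longleftrightarrow> y = widen i z (i \<in> y)"
    (is "?L \<longleftrightarrow> ?R")
  proof
    assume L: ?L
    show ?R
    proof (intro set_eqI)
      fix j
      consider "j = i" | "j = Suc i" | k where "j = skip i k" using skip_cases by blast
      then show "j \<in> y \<longleftrightarrow> j \<in> widen i z (i \<in> y)"
      proof cases
        case 3
        then have "k < n \<longleftrightarrow> j < Suc (Suc n)" using i by simp
        then show ?thesis using L 3 y z by auto
      qed (use L in simp_all)
    qed
  next
    assume R: ?R
    then obtain b where "y = widen i z b" by blast
    then show ?L by auto
  qed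
  then show ?thesis
    unfolding cap_def weight_mirror cup_def weight_add_cup weight_id of_bool_conj[symmetric] by (rule arg_cong)
qed

lemma widen_subset: "i \<le> n \<Longrightarrow> z \<subseteq> {..<n} \<Longrightarrow> widen i z b \<subseteq> {..<Suc (Suc n)}"
  by (auto simp: widen_def skip_def split: if_splits)

text \<open>
  A column of the matrix of a cap has exactly two nonzero entries, one for each colour of its arc.
\<close>

lemma sum_weight_cap:
  fixes f :: "nat set \<Rightarrow> nat"
  assumes i: "i \<le> n" and z: "z \<subseteq> {..<n}"
  shows "(\<Sum>y \<in> Pow {..<Suc (Suc n)}. f y * weight (cap n i) y z) = f (widen i z False) + f (widen i z True)"
proof -
  have ne: "widen i z False \<noteq> widen i z True" using mem_widen(1) by metis
  have "(\<Sum>y \<in> Pow {..<Suc (Suc n)}. f y * weight (cap n i) y z)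
     = (\<Sum>y \<in> {widen i z False, widen i z True}. f y * weight (cap n i) y z)"
  proof (rule sum.mono_neutral_right)
    show "\<forall>y\<in>Pow {..<Suc (Suc n)} - {widen i z False, widen i z True}. f y * weight (cap n i) y z = 0"
    proof
      fix y assume y: "y \<in> Pow {..<Suc (Suc n)} - {widen i z False, widen i z True}"
      then have "y \<noteq> widen i z (i \<in> y)" by (cases "i \<in> y") auto
      then show "f y * weight (cap n i) y z = 0" using weight_cap_widen[OF i z, of y] y by simp
    qed
  qed (use widen_subset[OF i z] in auto)
  also have "\<dots> = f (widen i z False) + f (widen i z True)"
    using ne by (simp add: weight_cap_widen[OF i z widen_subset[OF i z]])
  finally show ?thesis .
qed

lemma sum_weight_id:
  fixes f :: "nat set \<Rightarrow> nat"
  assumes "A \<subseteq> {..<n}"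
  shows "(\<Sum>x \<in> Pow {..<n}. f x * weight (id_diagram n) x A) = f A"
proof -
  have "f x * weight (id_diagram n) x A = (if A = x then f x else 0)" if "x \<in> Pow {..<n}" for x
    using that assms by (auto simp: weight_id Int_absorb2)
  then have "(\<Sum>x \<in> Pow {..<n}. f x * weight (id_diagram n) x A) = (\<Sum>x \<in> Pow {..<n}. if A = x then f x else 0)"
    by (intro sum.cong refl)
  also have "\<dots> = f A" using assms by (subst sum.delta') auto
  finally show ?thesis .
qed

lemma weight_id_restrict: "weight (id_diagram n) x y = weight (id_diagram n) x (y \<inter> {..<n})"
  by (simp add: weight_id Int_assoc)

text \<open>
  The colours of the through strands of a cup determine the colours of its bottom points.
\<close>

lemma sum_weight_cup:
  fixes f :: "nat set \<Rightarrow> nat"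
  shows "(\<Sum>x \<in> Pow {..<n}. f x * weight (cup n i) x y) = of_bool (i \<in> y \<longleftrightarrow> Suc i \<in> y) * f ({j. skip i j \<in> y} \<inter> {..<n})"
proof -
  have "(\<Sum>x \<in> Pow {..<n}. f x * weight (cup n i) x y) =
    of_bool (i \<in> y \<longleftrightarrow> Suc i \<in> y) * (\<Sum>x \<in> Pow {..<n}. f x * weight (id_diagram n) x ({j. skip i j \<in> y} \<inter> {..<n}))"
    unfolding cup_def weight_add_cup sum_distrib_left
    by (subst weight_id_restrict) (simp add: mult_ac)
  then show ?thesis by (simp add: sum_weight_id)
qed

lemma stack_id_left:
  assumes D: "matching m n D"
  shows "stack (id_diagram n) D = (D, 0)"
proof (rule stack_eqI[OF D matching_id])
  show "partition_on (marked_points m n) D" using D by (simp add: matching_def)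
qed (simp add: sum_weight_id)

lemma mirror_id: "mirror (id_diagram n) = id_diagram n"
  by (simp add: id_diagram_image mirror_def image_image insert_commute)

lemma stack_id_right:
  assumes D: "matching m n D"
  shows "stack D (id_diagram m) = (D, 0)"
  using stack_mirror[OF matching_mirror[OF D] matching_id[of m]]
  by (simp add: mirror_id stack_id_left[OF matching_mirror[OF D]])

lemma stack_cup:
  assumes D: "matching m n D" and i: "i \<le> n"
  shows "stack (cup n i) D = (add_cup i D, 0)"
proof (rule stack_eqI[OF D matching_cup[OF i]])
  show "partition_on (marked_points m (Suc (Suc n))) (add_cup i D)"
    using matching_add_cup[OF D i] by (simp add: matching_def)
  fix x z :: "nat set" assume x: "x \<subseteq> {..<m}"
  have "(\<Sum>y \<in> Pow {..<n}. weight D x y * weight (cup n i) y z)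
    = of_bool (i \<in> z \<longleftrightarrow> Suc i \<in> z) * weight D x ({j. skip i j \<in> z} \<inter> {..<n})"
    by (rule sum_weight_cup)
  also have "\<dots> = weight (add_cup i D) x z"
    unfolding weight_add_cup weight_restrict[OF D, of x "{j. skip i j \<in> z} \<inter> {..<n}"]
      weight_restrict[OF D, of x "{j. skip i j \<in> z}"] by (simp add: Int_assoc)
  finally show "(\<Sum>y \<in> Pow {..<n}. weight D x y * weight (cup n i) y z) = 2 ^ 0 * weight (add_cup i D) x z"
    by simp
qed

lemma stack_cap_add_cup:
  assumes D: "matching m n D" and i: "i \<le> n"
  shows "stack (cap n i) (add_cup i D) = (D, 1)"
proof (rule stack_eqI[OF matching_add_cup[OF D i] matching_cap[OF i]])
  show "partition_on (marked_points m n) D" using D by (simp add: matching_def)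
qed (simp add: sum_weight_cap[OF i] weight_add_cup)

section \<open>Factoring planar diagrams\<close>

text \<open>
  The arcs of \<open>D\<close> that avoid the top points \<open>i\<close> and \<open>i + 1\<close>, renumbered.
\<close>

definition core :: "nat \<Rightarrow> diagram \<Rightarrow> diagram" where
  "core i D = {a. raise i ` a \<in> D}"

lemma matching_disjoint: "matching m n D \<Longrightarrow> a \<in> D \<Longrightarrow> b \<in> D \<Longrightarrow> p \<in> a \<Longrightarrow> p \<in> b \<Longrightarrow> a = b"
  unfolding matching_def partition_on_def disjoint_def by blast

lemma matching_point:
  assumes D: "matching m n D" and p: "p \<in> marked_points m n"
  obtains q where "{p, q} \<in> D" "p \<noteq> q"
proof -
  obtain a where a: "a \<in> D" "p \<in> a" using D p unfolding matching_def partition_on_def by blast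
  then have "card a = 2" using D by (simp add: matching_def)
  then obtain q where "a = {p, q}" "p \<noteq> q" using a(2) by (auto simp: card_2_iff)
  then show thesis using that a(1) by blast
qed

lemma blocks_split:
  assumes D: "matching m (Suc (Suc n)) D" and i: "i \<le> n"
  shows "D = {a \<in> D. a \<inter> {Top i, Top (Suc i)} \<noteq> {}} \<union> image (raise i) ` core i D" (is "D = ?T \<union> ?R")
proof (intro equalityI subsetI)
  fix a assume a: "a \<in> D"
  show "a \<in> ?T \<union> ?R"
  proof (cases "a \<inter> {Top i, Top (Suc i)} = {}")
    case True
    then have "a \<subseteq> range (raise i)" using raise_cases by blast
    then have "a = raise i ` (raise i -` a)" by blast
    then have "a \<in> ?R" using a unfolding core_def by (metis (mono_tags, lifting) image_eqI mem_Collect_eq)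
    then show ?thesis ..
  qed (use a in simp)
qed (auto simp: core_def)

lemma matching_core:
  assumes D: "matching m (Suc (Suc n)) D" and i: "i \<le> n"
    and p: "p \<in> core i D"
  shows "p \<subseteq> marked_points m n" "card p = 2"
proof -
  have "raise i ` p \<in> D" using p by (simp add: core_def)
  from matching_block_subset[OF D this] show "p \<subseteq> marked_points m n" using i by auto
  have "card (raise i ` p) = 2" using D \<open>raise i ` p \<in> D\<close> by (simp add: matching_def)
  then show "card p = 2" using card_image[OF inj_on_subset[OF inj_raise]] by (metis subset_UNIV)
qed

lemma disjnt_core:
  assumes D: "matching m n D" and pq: "p \<in> core i D" "q \<in> core i D" "p \<noteq> q"
  shows "disjnt p q"
proof -
  have "raise i ` p \<noteq> raise i ` q" using pq(3) by (simp add: inj_image_eq_iff[OF inj_raise])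
  moreover have "raise i ` p \<in> D" "raise i ` q \<in> D" using pq by (simp_all add: core_def)
  ultimately have "raise i ` p \<inter> raise i ` q = {}" using matching_disjoint[OF D] by blast
  then show ?thesis by (auto simp: disjnt_def)
qed

lemma core_point:
  assumes D: "matching m (Suc (Suc n)) D" and i: "i \<le> n" and p: "p \<in> marked_points m n"
  obtains b where "p \<in> b" "b \<in> core i D"
  | "{Top i, raise i p} \<in> D" | "{Top (Suc i), raise i p} \<in> D"
proof -
  obtain q where q: "{raise i p, q} \<in> D" "raise i p \<noteq> q"
    using matching_point[OF D, of "raise i p"] p i by auto
  consider "q = Top i" | "q = Top (Suc i)" | r where "q = raise i r" using raise_cases by blast
  then show thesis
  proof cases
    case 3
    then have "{p, r} \<in> core i D" using q by (simp add: core_def)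
    then show thesis using that(1)[of "{p, r}"] by blast
  qed (use q that in \<open>auto simp: insert_commute\<close>)
qed

lemma remove_cup:
  assumes D: "matching m (Suc (Suc n)) D" and i: "i \<le> n" and arc: "{Top i, Top (Suc i)} \<in> D"
  shows "D = add_cup i (core i D)" "matching m n (core i D)"
proof -
  have T: "{a \<in> D. a \<inter> {Top i, Top (Suc i)} \<noteq> {}} = {{Top i, Top (Suc i)}}" (is "?L = ?R")
  proof
    show "?L \<subseteq> ?R" using matching_disjoint[OF D _ arc] by blast
  qed (use arc in auto)
  show "D = add_cup i (core i D)"
    using blocks_split[OF D i] unfolding T add_cup_def by simp
  show "matching m n (core i D)" unfolding matching_def
  proof (intro conjI ballI partition_onI)
    show "\<Union>(core i D) = marked_points m n"
    proof
      show "\<Union>(core i D) \<subseteq> marked_points m n" using matching_core(1)[OF D i] by blast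
      show "marked_points m n \<subseteq> \<Union>(core i D)"
      proof
        fix p assume p: "p \<in> marked_points m n"
        show "p \<in> \<Union>(core i D)"
        proof (rule core_point[OF D i p])
          assume "{Top i, raise i p} \<in> D"
          from matching_disjoint[OF D this arc, of "Top i"] show ?thesis by (auto simp: doubleton_eq_iff)
        next
          assume "{Top (Suc i), raise i p} \<in> D"
          from matching_disjoint[OF D this arc, of "Top (Suc i)"] show ?thesis by (auto simp: doubleton_eq_iff)
        qed blast
      qed
    qed
    show "{} \<notin> core i D" using matching_core(2)[OF D i, of "{}"] by auto
  qed (use matching_core(2)[OF D i] disjnt_core[OF D] in auto)
qed

text \<open>
  If a cap is put on top of \<open>D\<close> at two points that are not joined in \<open>D\<close>, it joins the other ends \<open>u\<close> and \<open>v\<close>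
  of their arcs to a single new arc.
\<close>

lemma bend_arcs:
  assumes D: "matching m (Suc (Suc n)) D" and i: "i \<le> n" and arc: "{Top i, Top (Suc i)} \<notin> D"
  obtains u v where "u \<noteq> v" "{Top i, raise i u} \<in> D" "{Top (Suc i), raise i v} \<in> D"
    "D = insert {Top i, raise i u} (insert {Top (Suc i), raise i v} (image (raise i) ` core i D))"
    "matching m n (insert {u, v} (core i D))"
proof -
  have other: "\<exists>u. {t, raise i u} \<in> D" if t: "t = Top i \<or> t = Top (Suc i)" for t
  proof -
    have "t \<in> marked_points m (Suc (Suc n))" using t i by auto
    then obtain q where q: "{t, q} \<in> D" "t \<noteq> q" using matching_point[OF D] by blast
    then have "q \<noteq> Top i" "q \<noteq> Top (Suc i)" using t arc by (auto simp: insert_commute)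
    then show ?thesis using raise_cases[of q i] q by auto
  qed
  obtain u where u: "{Top i, raise i u} \<in> D" using other by blast
  obtain v where v: "{Top (Suc i), raise i v} \<in> D" using other by blast
  have uv: "u \<noteq> v"
    using matching_disjoint[OF D u v, of "raise i u"] by (auto simp: doubleton_eq_iff)
  have T: "{a \<in> D. a \<inter> {Top i, Top (Suc i)} \<noteq> {}} = {{Top i, raise i u}, {Top (Suc i), raise i v}}" (is "?L = ?R")
  proof
    show "?L \<subseteq> ?R" using matching_disjoint[OF D _ u] matching_disjoint[OF D _ v] by blast
  qed (use u v in auto)
  have eq: "D = insert {Top i, raise i u} (insert {Top (Suc i), raise i v} (image (raise i) ` core i D))"
    using blocks_split[OF D i] unfolding T by simp
  have mem: "u \<in> marked_points m n" "v \<in> marked_points m n"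
    using matching_block_subset[OF D u] matching_block_subset[OF D v] i by auto
  have fresh: "u \<notin> p \<and> v \<notin> p" if p: "p \<in> core i D" for p
  proof -
    have "raise i ` p \<in> D" using p by (simp add: core_def)
    then show ?thesis
      using matching_disjoint[OF D u, of "raise i ` p" "raise i u"] matching_disjoint[OF D v, of "raise i ` p" "raise i v"]
      by (metis image_eqI imageE insertI1 insertI2 raise_neq(3,4))
  qed
  have "matching m n (insert {u, v} (core i D))" unfolding matching_def
  proof (intro conjI ballI partition_onI)
    show "\<Union>(insert {u, v} (core i D)) = marked_points m n"
    proof
      show "\<Union>(insert {u, v} (core i D)) \<subseteq> marked_points m n" using matching_core(1)[OF D i] mem by blast
      show "marked_points m n \<subseteq> \<Union>(insert {u, v} (core i D))"
      proof
        fix p assume p: "p \<in> marked_points m n"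
        show "p \<in> \<Union>(insert {u, v} (core i D))"
        proof (rule core_point[OF D i p])
          assume "{Top i, raise i p} \<in> D"
          from matching_disjoint[OF D this u, of "Top i"] show ?thesis by (auto simp: doubleton_eq_iff)
        next
          assume "{Top (Suc i), raise i p} \<in> D"
          from matching_disjoint[OF D this v, of "Top (Suc i)"] show ?thesis by (auto simp: doubleton_eq_iff)
        qed blast
      qed
    qed
    show "{} \<notin> insert {u, v} (core i D)" using matching_core(2)[OF D i, of "{}"] by auto
    show "disjnt p q" if "p \<in> insert {u, v} (core i D)" "q \<in> insert {u, v} (core i D)" "p \<noteq> q" for p q
    proof -
      have "disjnt {u, v} p" "disjnt p {u, v}" if "p \<in> core i D" for p
        using fresh[OF that] by (auto simp: disjnt_def)
      then show ?thesis using that disjnt_core[OF D, of p i q] by blast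
    qed
    show "card a = 2" if "a \<in> insert {u, v} (core i D)" for a
      using that uv matching_core(2)[OF D i] by auto
  qed
  then show thesis using that uv u v eq by blast
qed

lemma planar_core:
  assumes D: "matching m (Suc (Suc n)) D" and pl: "planar m (Suc (Suc n)) D" and i: "i \<le> n"
  shows "planar m n (core i D)"
  unfolding planar_def
proof (intro notI, elim exE conjE)
  fix a b c e
  assume *: "{a, b} \<in> core i D" "{c, e} \<in> core i D" "boundary_pos m n a < boundary_pos m n c"
    "boundary_pos m n c < boundary_pos m n b" "boundary_pos m n b < boundary_pos m n e"
  then have arcs: "{raise i a, raise i b} \<in> D" "{raise i c, raise i e} \<in> D" by (simp_all add: core_def)
  have "a \<in> marked_points m n" "b \<in> marked_points m n" "c \<in> marked_points m n" "e \<in> marked_points m n"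
    using matching_core(1)[OF D i] * by blast+
  then show False using * arcs pl boundary_pos_raise[OF i, of _ m] unfolding planar_def by meson
qed

text \<open>
  The arc from \<open>u\<close> to \<open>v\<close> runs along the old arcs at the neighbouring points \<open>Top i\<close> and
  \<open>Top (Suc i)\<close>. Any arc that crosses it therefore crosses one of these two, because its ends lie on the
  same side of both neighbours.
\<close>

lemma planar_bend:
  assumes D: "matching m (Suc (Suc n)) D" and pl: "planar m (Suc (Suc n)) D" and i: "i \<le> n"
    and u: "{Top i, raise i u} \<in> D" and v: "{Top (Suc i), raise i v} \<in> D"
  shows "planar m n (insert {u, v} (core i D))"
  unfolding planar_def
proof (intro notI, elim exE conjE)
  let ?X = "insert {u, v} (core i D)" and ?pos = "boundary_pos m (Suc (Suc n))"
  fix a b c e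
  assume arcs: "{a, b} \<in> ?X" "{c, e} \<in> ?X" and less: "boundary_pos m n a < boundary_pos m n c"
    "boundary_pos m n c < boundary_pos m n b" "boundary_pos m n b < boundary_pos m n e"
  let ?a = "?pos (raise i a)" and ?b = "?pos (raise i b)" and ?c = "?pos (raise i c)" and ?e = "?pos (raise i e)"
  have uv: "u \<in> marked_points m n" "v \<in> marked_points m n"
    using matching_block_subset[OF D u] matching_block_subset[OF D v] i by auto
  then have X: "p \<in> marked_points m n" if "{p, q} \<in> ?X" for p q
    using that matching_core(1)[OF D i] by (auto simp: doubleton_eq_iff)
  have mem: "a \<in> marked_points m n" "b \<in> marked_points m n" "c \<in> marked_points m n" "e \<in> marked_points m n"
    using X arcs by (metis insert_commute)+
  have less': "?a < ?c" "?c < ?b" "?b < ?e" using less mem boundary_pos_raise[OF i] by simp_all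
  have no: False if "{p, q} \<in> D" "{r, s} \<in> D" "?pos p < ?pos r" "?pos r < ?pos q" "?pos q < ?pos s" for p q r s
    using pl that unfolding planar_def by blast
  have adj: "?pos (Top i) = Suc (?pos (Top (Suc i)))" using i by simp
  \<comment> \<open>Being before one of the two neighbours is the same as being before the other.\<close>
  have side: "?pos (raise i p) < ?pos t \<longleftrightarrow> ?pos (raise i p) < ?pos (Top i)" "?pos t < ?pos (raise i p) \<longleftrightarrow> \<not> ?pos (raise i p) < ?pos (Top i)"
    if "p \<in> marked_points m n" "t \<in> {Top i, Top (Suc i)}" for p t
  proof -
    show *: "?pos (raise i p) < ?pos t \<longleftrightarrow> ?pos (raise i p) < ?pos (Top i)"
      using that(2) boundary_pos_raise_cup(1)[OF i that(1)] by blast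
    have "?pos (raise i p) \<noteq> ?pos t"
      using that(2) boundary_pos_raise_cup(2,3)[OF i that(1)] by blast
    then show "?pos t < ?pos (raise i p) \<longleftrightarrow> \<not> ?pos (raise i p) < ?pos (Top i)"
      using * by linarith
  qed
  have bend: "\<exists>t t'. t \<in> {Top i, Top (Suc i)} \<and> t' \<in> {Top i, Top (Suc i)} \<and>
     {raise i p, t} \<in> D \<and> {raise i q, t'} \<in> D" if "{p, q} = {u, v}" for p q
    using that u v by (auto simp: doubleton_eq_iff insert_commute)
  show False
  proof (cases "{a, b} = {u, v}")
    case True
    then have "{c, e} \<noteq> {u, v}" using less by (auto simp: doubleton_eq_iff)
    then have ce: "{raise i c, raise i e} \<in> D" using arcs(2) by (simp add: core_def)
    obtain t t' where t: "t \<in> {Top i, Top (Suc i)}" "t' \<in> {Top i, Top (Suc i)}"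
      "{raise i a, t} \<in> D" "{raise i b, t'} \<in> D" using bend[OF True] by blast
    note s = side[OF mem(3) t(1)] side[OF mem(4) t(1)] side[OF mem(3) t(2)] side[OF mem(4) t(2)]
    consider "?c < ?pos t \<and> ?pos t < ?e" | "?e < ?pos t'" | "?pos t' < ?c"
      using s by blast
    then show False
    proof cases
      case 1 then show False using no[OF t(3) ce] less' by simp
    next
      case 2 then show False using no[OF ce, of "raise i b" t'] t(4) less' by simp
    next
      case 3 then show False using no[of t' "raise i b", OF _ ce] t(4) less' by (simp add: insert_commute)
    qed
  next
    case False
    then have ab: "{raise i a, raise i b} \<in> D" using arcs(1) by (simp add: core_def)
    show False
    proof (cases "{c, e} = {u, v}")
      case True
      obtain t t' where t: "t \<in> {Top i, Top (Suc i)}" "t' \<in> {Top i, Top (Suc i)}"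
        "{raise i c, t} \<in> D" "{raise i e, t'} \<in> D" using bend[OF True] by blast
      note s = side[OF mem(1) t(1)] side[OF mem(2) t(1)] side[OF mem(1) t(2)] side[OF mem(2) t(2)]
      consider "?a < ?pos t' \<and> ?pos t' < ?b" | "?b < ?pos t" | "?pos t < ?a"
        using s by blast
      then show False
      proof cases
        case 1 then show False using no[OF ab, of t' "raise i e"] t(4) less' by (simp add: insert_commute)
      next
        case 2 then show False using no[OF ab t(3)] less' by simp
      next
        case 3 then show False using no[of t "raise i c", OF _ ab] t(3) less' by (simp add: insert_commute)
      qed
    next
      case False
      then have "{raise i c, raise i e} \<in> D" using arcs(2) by (simp add: core_def)
      then show False using no[OF ab] less' by blast
    qed
  qed
qed

lemma stack_cap_bend:
  assumes D: "matching m (Suc (Suc n)) D" and i: "i \<le> n"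
    and eq: "D = insert {Top i, raise i u} (insert {Top (Suc i), raise i v} (image (raise i) ` D'))"
    and X: "matching m n (insert {u, v} D')"
  shows "stack (cap n i) D = (insert {u, v} D', 0)"
proof (rule stack_eqI[OF D matching_cap[OF i]])
  show "partition_on (marked_points m n) (insert {u, v} D')" using X by (simp add: matching_def)
  fix x z :: "nat set" assume x: "x \<subseteq> {..<m}" and z: "z \<subseteq> {..<n}"
  have raised: "raise i p \<in> coloured x (widen i z b) \<longleftrightarrow> p \<in> coloured x z" for p b
    by (cases p) simp_all
  have "weight (image (raise i) ` D') x (widen i z b) = weight D' x z" for b
    by (rule weight_image) (auto intro!: point_set_eqI)
  then have "weight D x (widen i z b) = of_bool (b \<longleftrightarrow> u \<in> coloured x z) * (of_bool (b \<longleftrightarrow> v \<in> coloured x z) * weight D' x z)" for b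
    unfolding eq weight_insert_Un by (auto simp: raised)
  then show "(\<Sum>y\<in>Pow {..<Suc (Suc n)}. weight D x y * weight (cap n i) y z) = 2 ^ 0 * weight (insert {u, v} D') x z"
    unfolding sum_weight_cap[OF i z] weight_insert_Un by auto
qed

text \<open>
  The two cases are the closing of a loop and the joining of two arcs.
\<close>

lemma tl_stack_cap:
  assumes D: "D \<in> tl_diagrams m (Suc (Suc n))" and i: "i \<le> n"
  shows "fst (stack (cap n i) D) \<in> tl_diagrams m n"
proof (cases "{Top i, Top (Suc i)} \<in> D")
  case True
  have D': "matching m (Suc (Suc n)) D" "planar m (Suc (Suc n)) D" using D by (simp_all add: tl_diagrams_iff)
  note r = remove_cup[OF D'(1) i True]
  have "stack (cap n i) D = (core i D, 1)" using stack_cap_add_cup[OF r(2) i] r(1) by simp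
  then show ?thesis using r(2) planar_core[OF D' i] by (simp add: tl_diagrams_iff)
next
  case False
  have D': "matching m (Suc (Suc n)) D" "planar m (Suc (Suc n)) D" using D by (simp_all add: tl_diagrams_iff)
  obtain u v where "u \<noteq> v" and uv: "{Top i, raise i u} \<in> D" "{Top (Suc i), raise i v} \<in> D"
    "D = insert {Top i, raise i u} (insert {Top (Suc i), raise i v} (image (raise i) ` core i D))"
    "matching m n (insert {u, v} (core i D))" by (rule bend_arcs[OF D'(1) i False])
  have "stack (cap n i) D = (insert {u, v} (core i D), 0)"
    using stack_cap_bend[OF D'(1) i uv(3,4)] .
  then show ?thesis using uv(4) planar_bend[OF D' i uv(1,2)] by (simp add: tl_diagrams_iff)
qed

text \<open>
  A top point between the ends of an arc joining two top points can only be joined to another point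
  between them, so a shortest such arc joins neighbours.
\<close>

lemma adjacent_cup:
  assumes D: "matching m n D" and pl: "planar m n D" and arc: "{Top i, Top j} \<in> D" "i < j"
  shows "\<exists>k. Suc k < n \<and> {Top k, Top (Suc k)} \<in> D"
  using arc
proof (induction "j - i" arbitrary: i j rule: less_induct)
  case less
  have j: "j < n" using matching_block_subset[OF D less.prems(1)] by simp
  show ?case
  proof (cases "j = Suc i")
    case True
    then show ?thesis using less.prems j by blast
  next
    case False
    then have i': "Suc i < j" using less.prems by simp
    obtain q where q: "{Top (Suc i), q} \<in> D" "Top (Suc i) \<noteq> q"
      using matching_point[OF D, of "Top (Suc i)"] i' j by auto
    have ne: "q \<noteq> Top i" "q \<noteq> Top j"
      using matching_disjoint[OF D q(1) less.prems(1), of q] i' q by (auto simp: doubleton_eq_iff)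
    have qm: "q \<in> marked_points m n" using matching_block_subset[OF D q(1)] by simp
    have nc: "\<not> (boundary_pos m n a < boundary_pos m n c \<and> boundary_pos m n c < boundary_pos m n b \<and>
      boundary_pos m n b < boundary_pos m n e)" if "{a, b} \<in> D" "{c, e} \<in> D" for a b c e
      using pl that unfolding planar_def by blast
    have ji: "{Top j, Top i} \<in> D" "{q, Top (Suc i)} \<in> D" using less.prems q by (simp_all add: insert_commute)
    have "\<exists>k. q = Top k \<and> Suc i < k \<and> k < j"
    proof (cases q)
      case (Bot k)
      then show ?thesis using nc[OF ji(2) ji(1)] i' j qm by auto
    next
      case (Top k)
      then have "k < n" using qm by simp
      then show ?thesis using nc[OF ji(2) ji(1)] nc[OF ji(1) q(1)] i' j Top ne q(2) less.prems(2) by auto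
    qed
    then obtain k where k: "q = Top k" "Suc i < k" "k < j" by blast
    show ?thesis using less.hyps[of k "Suc i"] k q by simp
  qed
qed

text \<open>
  All strands run from bottom to top, and planarity makes the resulting bijection strictly increasing,
  so it is the identity.
\<close>

lemma no_cups_caps:
  assumes D: "matching m n D" and pl: "planar m n D"
    and top: "\<And>i j. {Top i, Top j} \<notin> D" and bot: "\<And>i j. {Bot i, Bot j} \<notin> D"
  shows "m = n \<and> D = id_diagram n"
proof -
  have "\<exists>j. {Bot i, Top j} \<in> D" if "i < m" for i
  proof -
    have "Bot i \<in> marked_points m n" using that by simp
    then obtain q where "{Bot i, q} \<in> D" using matching_point[OF D] by blast
    then show ?thesis using bot by (cases q) auto
  qed
  then obtain s where s: "\<And>i. i < m \<Longrightarrow> {Bot i, Top (s i)} \<in> D" by metis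
  have sn: "s i < n" if "i < m" for i using matching_block_subset[OF D s[OF that]] by simp
  have inj: "i = k" if "i < m" "k < m" "s i = s k" for i k
    using matching_disjoint[OF D s[OF that(1)] s[OF that(2)], of "Top (s i)"] that by (auto simp: doubleton_eq_iff)
  have mono: "s i < s k" if "i < k" "k < m" for i k
  proof (rule ccontr)
    assume "\<not> s i < s k"
    then have "s k < s i" using inj[of i k] that by (metis less_trans linorder_neqE_nat nat_neq_iff)
    then have "boundary_pos m n (Bot i) < boundary_pos m n (Bot k)"
      "boundary_pos m n (Bot k) < boundary_pos m n (Top (s i))"
      "boundary_pos m n (Top (s i)) < boundary_pos m n (Top (s k))"
      using that sn[of i] by auto
    moreover have "{Bot i, Top (s i)} \<in> D" "{Bot k, Top (s k)} \<in> D" using s that by auto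
    ultimately show False using pl unfolding planar_def by blast
  qed
  have surj: "\<exists>i<m. s i = j" if "j < n" for j
  proof -
    have "Top j \<in> marked_points m n" using that by simp
    then obtain q where q: "{Top j, q} \<in> D" using matching_point[OF D] by blast
    then obtain i where i: "q = Bot i" using top by (cases q) auto
    then have "i < m" using matching_block_subset[OF D q] by simp
    then show ?thesis
      using matching_disjoint[OF D s[of i] q, of "Bot i"] i by (auto simp: doubleton_eq_iff)
  qed
  have img: "s ` {..<m} = {..<n}" using sn surj by auto
  moreover have "inj_on s {..<m}" using inj by (auto simp: inj_on_def)
  ultimately have mn: "m = n" using card_image[of s "{..<m}"] by simp
  have si: "s i = i" if "i < m" for i
    using that
  proof (induction i rule: less_induct)
    case (less i)
    obtain k where k: "k < m" "s k = i" using surj[of i] less mn by auto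
    have "\<not> k < i"
    proof
      assume "k < i"
      then have "s k = k" using less.IH k(1) by blast
      then show False using k(2) \<open>k < i\<close> by simp
    qed
    moreover have "\<not> i < k"
    proof
      assume "i < k"
      then have "s i < i" using mono k by auto
      then have "s i < m" using less.prems by linarith
      then have "s (s i) = s i" using less.IH \<open>s i < i\<close> by blast
      then have "s i = i" using inj \<open>s i < m\<close> less.prems by blast
      then show False using \<open>s i < i\<close> by simp
    qed
    ultimately show ?case using k by simp
  qed
  have "id_diagram n \<subseteq> D" using s si mn by (auto simp: id_diagram_def)
  moreover have "D \<subseteq> id_diagram n"
  proof
    fix a assume a: "a \<in> D"
    then have "a \<noteq> {}" using D by (auto simp: matching_def)
    then obtain p where p: "p \<in> a" by blast
    then have "p \<in> marked_points n n" using matching_block_subset[OF D a] mn by auto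
    then obtain b where "b \<in> id_diagram n" "p \<in> b"
      using matching_id unfolding matching_def partition_on_def by blast
    then show "a \<in> id_diagram n" using matching_disjoint[OF D a, of b p] p \<open>id_diagram n \<subseteq> D\<close> by blast
  qed
  ultimately show ?thesis using mn by blast
qed

text \<open>
  Removing an arc between neighbouring points exhibits a cup at the very top or, by reflection, a cap at
  the very bottom of the diagram. No loops are created by putting it back.
\<close>

lemma tl_diagram_cases:
  assumes D: "D \<in> tl_diagrams m n"
  obtains (identity) "m = n" "D = id_diagram n"
  | (top_arc) k i D' where "n = Suc (Suc k)" "i \<le> k" "D' \<in> tl_diagrams m k" "D = fst (stack (cup k i) D')" "snd (stack (cup k i) D') = 0"
  | (bottom_arc) k i D' where "m = Suc (Suc k)" "i \<le> k" "D' \<in> tl_diagrams k n" "D = fst (stack D' (cap k i))" "snd (stack D' (cap k i)) = 0"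
proof -
  have cup_case: "\<exists>k i E'. n = Suc (Suc k) \<and> i \<le> k \<and> E' \<in> tl_diagrams m k \<and> stack (cup k i) E' = (E, 0)"
    if E: "E \<in> tl_diagrams m n" and arc: "{Top a, Top b} \<in> E" for m n E a b
  proof -
    have E': "matching m n E" "planar m n E" using E by (simp_all add: tl_diagrams_iff)
    have "a \<noteq> b" using E'(1) arc unfolding matching_def by force
    then have "\<exists>i. Suc i < n \<and> {Top i, Top (Suc i)} \<in> E"
      using adjacent_cup[OF E', of a b] adjacent_cup[OF E', of b a] arc
      by (cases "a < b") (auto simp: insert_commute)
    then obtain i where i: "Suc i < n" "{Top i, Top (Suc i)} \<in> E" by blast
    define k where "k = n - 2"
    have k: "n = Suc (Suc k)" "i \<le> k" using i(1) by (auto simp: k_def)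
    have E2: "matching m (Suc (Suc k)) E" "planar m (Suc (Suc k)) E" using E' k by simp_all
    note r = remove_cup[OF E2(1) k(2) i(2)]
    have "core i E \<in> tl_diagrams m k" using r(2) planar_core[OF E2 k(2)] by (simp add: tl_diagrams_iff)
    moreover have "stack (cup k i) (core i E) = (E, 0)" using stack_cup[OF r(2) k(2)] r(1) by argo
    ultimately show ?thesis using k by blast
  qed
  consider a b where "{Top a, Top b} \<in> D" | a b where "{Bot a, Bot b} \<in> D"
    | "\<And>i j. {Top i, Top j} \<notin> D" "\<And>i j. {Bot i, Bot j} \<notin> D" by blast
  then show thesis
  proof cases
    case 1
    then show thesis using cup_case[OF D] top_arc by (metis fst_conv snd_conv)
  next
    case (2 a b)
    then have "{Top a, Top b} \<in> mirror D" by (simp add: arc_mirror)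
    from cup_case[OF tl_mirror[OF D] this] obtain k i E
      where E: "m = Suc (Suc k)" "i \<le> k" "E \<in> tl_diagrams n k" "stack (cup k i) E = (mirror D, 0)" by blast
    have "matching n k E" using E(3) by (simp add: tl_diagrams_iff)
    from stack_mirror[OF this matching_cup[OF E(2)]]
    have "stack (mirror E) (cap k i) = (D, 0)" by (simp add: E(4) cap_def)
    then show thesis using bottom_arc[OF E(1,2) tl_mirror[OF E(3)]] by simp
  next
    case 3
    then show thesis using no_cups_caps[of m n D] D identity by (auto simp: tl_diagrams_iff)
  qed
qed

text \<open>
  Stacking \<open>E\<close> on \<open>D\<close> can be done one elementary cup or cap of \<open>E\<close> at a time, and each of
  these steps preserves planarity.
\<close>

lemma tl_stack:
  assumes "E \<in> tl_diagrams n k" "D \<in> tl_diagrams m n"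
  shows "fst (stack E D) \<in> tl_diagrams m k"
  using assms
proof (induction "n + k" arbitrary: E D n k rule: less_induct)
  case less
  have m: "matching n k E" "matching m n D" using less.prems by (simp_all add: tl_diagrams_iff)
  from less.prems(1) show ?case
  proof (cases rule: tl_diagram_cases)
    case identity
    then show ?thesis using stack_id_left[OF m(2)] less.prems by simp
  next
    case (top_arc k' i E')
    have E'D: "fst (stack E' D) \<in> tl_diagrams m k'" using less.hyps[OF _ top_arc(3) less.prems(2)] top_arc(1) by simp
    then have m': "matching n k' E'" "matching m k' (fst (stack E' D))" using top_arc by (simp_all add: tl_diagrams_iff)
    have "fst (stack E D) = fst (stack (cup k' i) (fst (stack E' D)))"
      using stack_assoc(1)[OF m(2) m'(1) matching_cup[OF top_arc(2)] m'(2)] m(1) top_arc by simp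
    also have "\<dots> = add_cup i (fst (stack E' D))" using stack_cup[OF m'(2) top_arc(2)] by simp
    finally show ?thesis using tl_add_cup[OF E'D top_arc(2)] top_arc(1) by simp
  next
    case (bottom_arc n' i E')
    have D: "D \<in> tl_diagrams m (Suc (Suc n'))" using less.prems(2) bottom_arc(1) by simp
    have cD: "fst (stack (cap n' i) D) \<in> tl_diagrams m n'" using tl_stack_cap[OF D bottom_arc(2)] .
    have m': "matching n' k E'" "matching m n' (fst (stack (cap n' i) D))"
      using bottom_arc cD by (simp_all add: tl_diagrams_iff)
    have "fst (stack E D) = fst (stack E' (fst (stack (cap n' i) D)))"
      using stack_assoc(1)[OF _ matching_cap[OF bottom_arc(2)] m'(1) m'(2)] m bottom_arc by simp
    then show ?thesis using less.hyps[OF _ bottom_arc(3) cD] bottom_arc(1) by simp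
  qed
qed

section \<open>Juxtaposition and the Temperley-Lieb relations\<close>

lemma inj_shift_point: "inj (shift_point m n)"
proof (rule injI)
  fix p q assume "shift_point m n p = shift_point m n q" then show "p = q" by (cases p; cases q) auto
qed

lemma marked_points_add:
  "marked_points (m + m') (n + n') = marked_points m n \<union> shift_point m n ` marked_points m' n'"
proof (rule point_set_eqI)
  have "i \<in> (+) m ` {..<m'} \<longleftrightarrow> m \<le> i \<and> i < m + m'" for i m m' :: nat
    by (auto simp: image_iff intro: bexI[of _ "i - m"])
  then have "Bot i \<in> shift_point m n ` marked_points m' n' \<longleftrightarrow> m \<le> i \<and> i < m + m'"
    "Top j \<in> shift_point m n ` marked_points m' n' \<longleftrightarrow> n \<le> j \<and> j < n + n'" for i j
    by (auto simp: marked_points_def image_Un image_image image_iff)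
  then show "Bot i \<in> marked_points (m + m') (n + n') \<longleftrightarrow> Bot i \<in> marked_points m n \<union> shift_point m n ` marked_points m' n'"
    and "Top j \<in> marked_points (m + m') (n + n') \<longleftrightarrow> Top j \<in> marked_points m n \<union> shift_point m n ` marked_points m' n'" for i j
    by auto
qed

lemma shift_point_new: "shift_point m n p \<notin> marked_points m n"
  by (cases p) auto

lemma matching_juxtapose:
  assumes D: "matching m n D" and E: "matching m' n' E"
  shows "matching (m + m') (n + n') (juxtapose m n D E)"
  unfolding matching_def
proof (intro conjI ballI partition_onI)
  note im = matching_image[OF E inj_shift_point[of m n]]
  have D': "partition_on (marked_points m n) D" using D by (simp add: matching_def)
  show "\<Union>(juxtapose m n D E) = marked_points (m + m') (n + n')"
    using D' im(1) by (simp add: juxtapose_def partition_on_def marked_points_add)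
  show "card a = 2" if "a \<in> juxtapose m n D E" for a
    using that D im(2) by (auto simp: juxtapose_def matching_def)
  show "{} \<notin> juxtapose m n D E"
    using D' im(1) by (simp add: juxtapose_def partition_on_def)
  show "disjnt p q" if "p \<in> juxtapose m n D E" "q \<in> juxtapose m n D E" "p \<noteq> q" for p q
  proof -
    have mixed: "disjnt p q" "disjnt q p" if "p \<in> D" "q \<in> image (shift_point m n) ` E" for p q
      using that matching_block_subset[OF D that(1)] shift_point_new[of m n] by (auto simp: disjnt_def)
    have "disjoint D" "disjoint (image (shift_point m n) ` E)" using D' im(1) by (simp_all add: partition_on_def)
    note same = this[THEN disjointD]
    have "p \<in> D \<or> p \<in> image (shift_point m n) ` E" "q \<in> D \<or> q \<in> image (shift_point m n) ` E"
      using that(1,2) by (simp_all add: juxtapose_def)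
    then show ?thesis
      using mixed same \<open>p \<noteq> q\<close> by (elim disjE) (simp_all add: disjnt_def)
  qed
qed

text \<open>
  Along the boundary, the points of the right-hand diagram form one interval, while those of the
  left-hand diagram surround it; an arc of one kind cannot separate the ends of an arc of the other.
\<close>

lemma planar_juxtapose:
  assumes D: "matching m n D" "planar m n D" and E: "matching m' n' E" "planar m' n' E"
  shows "planar (m + m') (n + n') (juxtapose m n D E)"
  unfolding planar_def
proof (intro notI, elim exE conjE)
  let ?pos = "boundary_pos (m + m') (n + n')"
  fix a b c e
  assume arcs: "{a, b} \<in> juxtapose m n D E" "{c, e} \<in> juxtapose m n D E"
    and less: "?pos a < ?pos c" "?pos c < ?pos b" "?pos b < ?pos e"
  have cases: "{u, v} \<in> D \<and> u \<in> marked_points m n \<and> v \<in> marked_points m n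
    \<or> (\<exists>u' v'. u = shift_point m n u' \<and> v = shift_point m n v' \<and> {u', v'} \<in> E \<and> u' \<in> marked_points m' n' \<and> v' \<in> marked_points m' n')"
    if uv: "{u, v} \<in> juxtapose m n D E" for u v
  proof (cases "{u, v} \<in> D")
    case True
    then show ?thesis using matching_block_subset[OF D(1) True] by blast
  next
    case False
    then have *: "{u, v} \<in> image (shift_point m n) ` E" using uv by (simp add: juxtapose_def)
    then obtain u' v' where uv': "u = shift_point m n u'" "v = shift_point m n v'" by blast
    then have "{u', v'} \<in> E" using * by (simp add: arc_image[OF inj_shift_point])
    then show ?thesis using uv' matching_block_subset[OF E(1)] by blast
  qed
  have left: "?pos p < m \<or> ?pos p \<ge> m + m' + n'" if "p \<in> marked_points m n" for p
    using that by (cases p) auto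
  have left_mono: "?pos p < ?pos q \<longleftrightarrow> boundary_pos m n p < boundary_pos m n q"
    if "p \<in> marked_points m n" "q \<in> marked_points m n" for p q
    using that by (cases p; cases q) auto
  have right: "?pos (shift_point m n p) = m + boundary_pos m' n' p" "boundary_pos m' n' p < m' + n'"
    if "p \<in> marked_points m' n'" for p
    using that by (cases p; auto)+
  from cases[OF arcs(1)] show False
  proof (elim disjE exE conjE)
    assume ab: "{a, b} \<in> D" "a \<in> marked_points m n" "b \<in> marked_points m n"
    from cases[OF arcs(2)] show False
    proof (elim disjE exE conjE)
      assume ce: "{c, e} \<in> D" "c \<in> marked_points m n" "e \<in> marked_points m n"
      then show False using D(2) less left_mono ab unfolding planar_def by blast
    next
      fix c' e' assume ce: "c = shift_point m n c'" "e = shift_point m n e'" "c' \<in> marked_points m' n'" "e' \<in> marked_points m' n'"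
      then show False using left[OF ab(3)] less right[OF ce(3)] right[OF ce(4)] by simp
    qed
  next
    fix a' b' assume ab: "a = shift_point m n a'" "b = shift_point m n b'" "{a', b'} \<in> E" "a' \<in> marked_points m' n'" "b' \<in> marked_points m' n'"
    from cases[OF arcs(2)] show False
    proof (elim disjE exE conjE)
      assume "c \<in> marked_points m n"
      then show False using left[of c] less ab right[OF ab(4)] right[OF ab(5)] by simp
    next
      fix c' e' assume ce: "c = shift_point m n c'" "e = shift_point m n e'" "{c', e'} \<in> E" "c' \<in> marked_points m' n'" "e' \<in> marked_points m' n'"
      have "boundary_pos m' n' a' < boundary_pos m' n' c'" "boundary_pos m' n' c' < boundary_pos m' n' b'"
        "boundary_pos m' n' b' < boundary_pos m' n' e'"
        using less right(1) ab ce by simp_all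
      then show False using E(2) ab(3) ce(3) unfolding planar_def by blast
    qed
  qed
qed

lemma tl_juxtapose:
  "D \<in> tl_diagrams m n \<Longrightarrow> E \<in> tl_diagrams m' n' \<Longrightarrow> juxtapose m n D E \<in> tl_diagrams (m + m') (n + n')"
  by (simp add: tl_diagrams_iff matching_juxtapose planar_juxtapose)

lemma weight_juxtapose:
  "weight (juxtapose m n D E) x y = weight D x y * weight E {i. m + i \<in> x} {j. n + j \<in> y}"
proof -
  have "weight (image (shift_point m n) ` E) x y = weight E {i. m + i \<in> x} {j. n + j \<in> y}"
    by (rule weight_image) (auto intro!: point_set_eqI)
  then show ?thesis by (simp add: juxtapose_def weight_insert_Un)
qed

lemma sum_Pow_add:
  fixes g :: "nat set \<Rightarrow> nat set \<Rightarrow> nat"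
  shows "(\<Sum>y \<in> Pow {..<n + n'}. g (y \<inter> {..<n}) {j. n + j \<in> y}) = (\<Sum>y \<in> Pow {..<n}. \<Sum>y' \<in> Pow {..<n'}. g y y')"
proof -
  have "(\<Sum>y \<in> Pow {..<n + n'}. g (y \<inter> {..<n}) {j. n + j \<in> y})
    = (\<Sum>(y, y') \<in> Pow {..<n} \<times> Pow {..<n'}. g y y')"
  proof (rule sum.reindex_bij_witness[where j = "\<lambda>y. (y \<inter> {..<n}, {j. n + j \<in> y})" and i = "\<lambda>(y, y'). y \<union> (+) n ` y'"])
    fix y assume "y \<in> Pow {..<n + n'}"
    show "(case (y \<inter> {..<n}, {j. n + j \<in> y}) of (y, y') \<Rightarrow> y \<union> (+) n ` y') = y"
    proof (simp, intro set_eqI)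
      fix j show "j \<in> y \<inter> {..<n} \<union> (+) n ` {j. n + j \<in> y} \<longleftrightarrow> j \<in> y"
        by (cases "j < n") (auto simp: image_iff intro: exI[of _ "j - n"])
    qed
  qed auto
  then show ?thesis by (simp add: sum.cartesian_product)
qed

text \<open>
  The matrix of a juxtaposition is a tensor product, and tensor products of matrices multiply factorwise.
\<close>

lemma stack_juxtapose:
  assumes D: "matching m n D" and E: "matching n k E" and D': "matching m' n' D'" and E': "matching n' k' E'"
    and ED: "matching m k (fst (stack E D))" and ED': "matching m' k' (fst (stack E' D'))"
  shows "stack (juxtapose n k E E') (juxtapose m n D D') =
    (juxtapose m k (fst (stack E D)) (fst (stack E' D')), snd (stack E D) + snd (stack E' D'))"
proof (rule stack_eqI[OF matching_juxtapose[OF D D'] matching_juxtapose[OF E E']])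
  show "partition_on (marked_points (m + m') (k + k')) (juxtapose m k (fst (stack E D)) (fst (stack E' D')))"
    using matching_juxtapose[OF ED ED'] by (simp add: matching_def)
  fix x z assume x: "x \<subseteq> {..<m + m'}" and z: "z \<subseteq> {..<k + k'}"
  let ?x = "x \<inter> {..<m}" and ?z = "z \<inter> {..<k}" and ?x' = "{i. m + i \<in> x}" and ?z' = "{i. k + i \<in> z}"
  have sub: "?x \<subseteq> {..<m}" "?z \<subseteq> {..<k}" "?x' \<subseteq> {..<m'}" "?z' \<subseteq> {..<k'}" using x z by auto
  have "weight (juxtapose m n D D') x y * weight (juxtapose n k E E') y z
    = (weight D ?x (y \<inter> {..<n}) * weight E (y \<inter> {..<n}) ?z) *
      (weight D' ?x' {j. n + j \<in> y} * weight E' {j. n + j \<in> y} ?z')" for y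
    unfolding weight_juxtapose weight_restrict[OF D, of x] weight_restrict[OF E, of y z] by (simp add: mult_ac)
  then have "(\<Sum>y \<in> Pow {..<n + n'}. weight (juxtapose m n D D') x y * weight (juxtapose n k E E') y z)
    = (\<Sum>y \<in> Pow {..<n + n'}. (weight D ?x (y \<inter> {..<n}) * weight E (y \<inter> {..<n}) ?z) *
      (weight D' ?x' {j. n + j \<in> y} * weight E' {j. n + j \<in> y} ?z'))" by simp
  also have "\<dots> = (\<Sum>y \<in> Pow {..<n}. \<Sum>y' \<in> Pow {..<n'}. (weight D ?x y * weight E y ?z) * (weight D' ?x' y' * weight E' y' ?z'))"
    by (rule sum_Pow_add)
  also have "\<dots> = (\<Sum>y \<in> Pow {..<n}. weight D ?x y * weight E y ?z) * (\<Sum>y' \<in> Pow {..<n'}. weight D' ?x' y' * weight E' y' ?z')"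
    by (simp add: sum_product)
  also have "\<dots> = 2 ^ (snd (stack E D) + snd (stack E' D')) * weight (juxtapose m k (fst (stack E D)) (fst (stack E' D'))) x z"
    unfolding stack_weight[OF D E sub(1,2)] stack_weight[OF D' E' sub(3,4)] weight_juxtapose
      weight_restrict[OF ED, of x z] by (simp add: power_add mult_ac)
  finally show "(\<Sum>y \<in> Pow {..<n + n'}. weight (juxtapose m n D D') x y * weight (juxtapose n k E E') y z)
    = 2 ^ (snd (stack E D) + snd (stack E' D')) * weight (juxtapose m k (fst (stack E D)) (fst (stack E' D'))) x z" .
qed

lemma matching_eqI:
  assumes "matching m n D" "matching m n E" "\<And>x y. x \<subseteq> {..<m} \<Longrightarrow> y \<subseteq> {..<n} \<Longrightarrow> weight D x y = weight E x y"
  shows "D = E"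
proof -
  have "(D, 0 :: nat) = (E, 0)"
    by (rule diagram_eqI) (use assms in \<open>auto simp: matching_def\<close>)
  then show ?thesis by simp
qed

lemma juxtapose_id: "juxtapose m m (id_diagram m) (id_diagram n) = id_diagram (m + n)"
proof -
  have eq: "{..<m + n} = {..<m} \<union> (+) m ` {..<n}"
    using ivl_disj_un_two(3)[of 0 m "m + n"] by (simp add: lessThan_atLeast0 add.commute)
  show ?thesis
    unfolding juxtapose_def id_diagram_image eq image_Un image_image by simp
qed

definition strand :: "nat \<Rightarrow> nat \<Rightarrow> diagram \<Rightarrow> diagram" where
  "strand m n D = juxtapose m n D (id_diagram 1)"

lemma matching_strand: "matching m n D \<Longrightarrow> matching (Suc m) (Suc n) (strand m n D)"
  using matching_juxtapose[OF _ matching_id[of 1]] by (simp add: strand_def)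

lemma weight_strand: "weight (strand m n D) x y = weight D x y * of_bool (m \<in> x \<longleftrightarrow> n \<in> y)"
proof -
  have "weight (id_diagram 1) {i. m + i \<in> x} {j. n + j \<in> y} = of_bool (m \<in> x \<longleftrightarrow> n \<in> y)"
  proof -
    have "S \<inter> {..<1} = T \<inter> {..<1} \<longleftrightarrow> (0 \<in> S \<longleftrightarrow> 0 \<in> T)" for S T :: "nat set"
      by (auto simp: lessThan_Suc)
    then show ?thesis by (simp add: weight_id)
  qed
  then show ?thesis by (simp add: strand_def weight_juxtapose)
qed

lemma strand_cup:
  assumes i: "i \<le> n"
  shows "strand n (Suc (Suc n)) (cup n i) = cup (Suc n) i"
proof (rule matching_eqI[OF matching_strand[OF matching_cup[OF i]] matching_cup])
  fix x y :: "nat set" assume x: "x \<subseteq> {..<Suc n}"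
  have eq: "x \<inter> {..<n} = {j. skip i j \<in> y} \<inter> {..<n} \<and> (n \<in> x \<longleftrightarrow> Suc (Suc n) \<in> y)
    \<longleftrightarrow> x \<inter> {..<Suc n} = {j. skip i j \<in> y} \<inter> {..<Suc n}"
  proof -
    have "Suc (Suc n) \<in> y \<longleftrightarrow> skip i n \<in> y" using i by (simp add: skip_def)
    then show ?thesis by (auto simp: lessThan_Suc)
  qed
  show "weight (strand n (Suc (Suc n)) (cup n i)) x y = weight (cup (Suc n) i) x y"
    unfolding weight_strand cup_def weight_add_cup weight_id mult.assoc of_bool_conj[symmetric] conj_assoc eq ..
qed (use i in simp)

lemma mirror_strand: "mirror (strand m n D) = strand n m (mirror D)"
proof -
  have "flip (shift_point m n p) = shift_point n m (flip p)" for p by (cases p) auto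
  then have "image flip ` image (shift_point m n) ` E = image (shift_point n m) ` image flip ` E" for E
    by (simp add: image_image)
  then have "mirror (juxtapose m n D E) = juxtapose n m (mirror D) (mirror E)" for E
    by (simp add: mirror_def juxtapose_def image_Un)
  then show ?thesis by (simp add: strand_def mirror_id)
qed

lemma strand_cap: "i \<le> n \<Longrightarrow> strand (Suc (Suc n)) n (cap n i) = cap (Suc n) i"
  by (simp add: cap_def mirror_strand[symmetric] strand_cup)

lemma stack_cap_cup: "i \<le> n \<Longrightarrow> stack (cap n i) (cup n i) = (id_diagram n, 1)"
  unfolding cup_def by (rule stack_cap_add_cup[OF matching_id])

text \<open>
  Straightening a bent strand: the colour \<open>b\<close> of the cap must be the colour of the strand, so exactly one
  middle colouring contributes.
\<close>

lemma zigzag: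
  assumes i: "Suc i \<le> n"
  shows "stack (cap n (Suc i)) (cup n i) = (id_diagram n, 0)"
proof (rule stack_eqI[OF matching_cup matching_cap[OF i]])
  show "partition_on (marked_points n n) (id_diagram n)" using matching_id by (simp add: matching_def)
  fix x z :: "nat set" assume z: "z \<subseteq> {..<n}"
  have "weight (cup n i) x (widen (Suc i) z b) = of_bool (b \<longleftrightarrow> i \<in> z) * weight (id_diagram n) x z" for b
  proof -
    have mem: "skip (Suc i) j \<in> widen (Suc i) z b \<longleftrightarrow> j \<in> z" for j by (rule mem_widen(3))
    have "i \<in> widen (Suc i) z b \<longleftrightarrow> i \<in> z" using mem[of i] by (simp add: skip_def)
    moreover have "{j. skip i j \<in> widen (Suc i) z b} = z" if "b \<longleftrightarrow> i \<in> z"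
    proof (intro set_eqI, unfold mem_Collect_eq)
      fix j show "skip i j \<in> widen (Suc i) z b \<longleftrightarrow> j \<in> z"
      proof (cases "j = i")
        case True
        then show ?thesis using mem_widen(2)[of "Suc i" z b] that by (simp add: skip_def)
      next
        case False
        then have "skip i j = skip (Suc i) j" by (auto simp: skip_def)
        then show ?thesis by (simp only: mem)
      qed
    qed
    ultimately show ?thesis unfolding cup_def weight_add_cup by (cases "b \<longleftrightarrow> i \<in> z") auto
  qed
  then show "(\<Sum>y\<in>Pow {..<Suc (Suc n)}. weight (cup n i) x y * weight (cap n (Suc i)) y z) = 2 ^ 0 * weight (id_diagram n) x z"
    unfolding sum_weight_cap[OF i z] by simp
qed (use i in simp)

lemma zigzag': "Suc i \<le> n \<Longrightarrow> stack (cap n i) (cup n (Suc i)) = (id_diagram n, 0)"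
  using stack_mirror[OF matching_cup matching_cap, of i n "Suc i"] zigzag[of i n] by (simp add: cap_def mirror_id)

text \<open>
  A cup at the far right can be pulled through a diagram that does not touch it.
\<close>

lemma slide_cup:
  assumes D: "matching m n D"
  shows "stack (strand (Suc m) (Suc n) (strand m n D)) (cup m m) = stack (cup n n) D"
proof -
  have "stack (strand (Suc m) (Suc n) (strand m n D)) (cup m m) = (add_cup n D, 0)"
  proof (rule stack_eqI[OF matching_cup matching_strand[OF matching_strand[OF D]]])
    show "partition_on (marked_points m (Suc (Suc n))) (add_cup n D)"
      using matching_add_cup[OF D] by (simp add: matching_def)
    fix x z :: "nat set" assume x: "x \<subseteq> {..<m}"
    have wx: "weight D (widen m x b) z = weight D x z" for b
    proof -
      have "widen m x b \<inter> {..<m} = x \<inter> {..<m}" using x by (force simp: widen_def skip_def)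
      then show ?thesis using weight_restrict[OF D, of "widen m x b" z] weight_restrict[OF D, of x z] by simp
    qed
    have wz: "weight D x {j. skip n j \<in> z} = weight D x z"
    proof -
      have "{j. skip n j \<in> z} \<inter> {..<n} = z \<inter> {..<n}" by (auto simp: skip_def)
      then show ?thesis using weight_restrict[OF D, of x "{j. skip n j \<in> z}"] weight_restrict[OF D, of x z] by simp
    qed
    have "(\<Sum>y\<in>Pow {..<Suc (Suc m)}. weight (cup m m) x y * weight (strand (Suc m) (Suc n) (strand m n D)) y z)
       = (\<Sum>y\<in>Pow {..<Suc (Suc m)}. weight (strand (Suc m) (Suc n) (strand m n D)) y z * weight (cap m m) y x)"
      by (simp add: cap_def weight_mirror mult.commute)
    also have "\<dots> = weight (strand (Suc m) (Suc n) (strand m n D)) (widen m x False) z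
       + weight (strand (Suc m) (Suc n) (strand m n D)) (widen m x True) z"
      by (rule sum_weight_cap[OF _ x]) simp
    also have "\<dots> = weight (add_cup n D) x z"
      unfolding weight_strand weight_add_cup wx wz by auto
    finally show "(\<Sum>y\<in>Pow {..<Suc (Suc m)}. weight (cup m m) x y * weight (strand (Suc m) (Suc n) (strand m n D)) y z)
      = 2 ^ 0 * weight (add_cup n D) x z" by simp
  qed simp
  then show ?thesis using stack_cup[OF D] by simp
qed

lemma slide_cap:
  assumes D: "matching m n D"
  shows "stack (cap n n) (strand (Suc m) (Suc n) (strand m n D)) = stack D (cap m m)"
proof -
  have "stack (cap n n) (strand (Suc m) (Suc n) (strand m n D))
      = stack (mirror (cup n n)) (mirror (strand (Suc n) (Suc m) (strand n m (mirror D))))"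
    by (simp add: mirror_strand cap_def)
  also have "\<dots> = (mirror (fst (stack (cup m m) (mirror D))), snd (stack (cup m m) (mirror D)))"
    using stack_mirror[OF matching_cup matching_strand[OF matching_strand[OF matching_mirror[OF D]]], of n]
      slide_cup[OF matching_mirror[OF D]] by simp
  also have "\<dots> = stack D (cap m m)"
    using stack_mirror[OF matching_mirror[OF D] matching_cup, of m] by (simp add: cap_def)
  finally show ?thesis .
qed

lemma cup_cap_diagram:
  "stack (cup k k) (cap k k) = ({{Bot i, Top i} | i. i < k} \<union> {{Bot k, Bot (Suc k)}, {Top k, Top (Suc k)}}, 0)"
proof -
  have "stack (cup k k) (cap k k) = (add_cup k (cap k k), 0)"
    by (rule stack_cup[OF matching_cap]) simp_all
  moreover have "cap k k = insert {Bot k, Bot (Suc k)} (id_diagram k)"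
  proof -
    have "(\<lambda>i. {Top i, Bot (skip k i)}) ` {..<k} = (\<lambda>i. {Bot i, Top i}) ` {..<k}"
      by (intro image_cong) (auto simp: skip_def)
    then show ?thesis by (simp add: cap_def cup_def mirror_def add_cup_def id_diagram_image image_image)
  qed
  moreover have "add_cup k (insert {Bot k, Bot (Suc k)} (id_diagram k)) = {{Bot i, Top i} | i. i < k} \<union> {{Bot k, Bot (Suc k)}, {Top k, Top (Suc k)}}"
  proof -
    have "(\<lambda>i. {Bot i, Top (skip k i)}) ` {..<k} = {{Bot i, Top i} | i. i < k}"
      unfolding id_diagram_image[unfolded id_diagram_def] by (intro image_cong) (auto simp: skip_def)
    then show ?thesis by (auto simp: add_cup_def id_diagram_image image_image)
  qed
  ultimately show ?thesis by simp
qed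

section \<open>The Temperley-Lieb category\<close>

lemma lookup_tl_scale [simp]: "Poly_Mapping.lookup (tl_scale c f) D = c * Poly_Mapping.lookup f D"
  by (simp add: tl_scale_def Poly_Mapping.map.rep_eq when_def)

lemma tl_scale_add_right: "tl_scale c (f + g) = tl_scale c f + tl_scale c g"
  and tl_scale_scale: "tl_scale a (tl_scale b f) = tl_scale (a * b) f"
  and tl_scale_one: "tl_scale 1 f = f"
  and tl_scale_minus_left: "tl_scale (- a) f = - tl_scale a f"
  by (auto intro!: poly_mapping_eqI simp: lookup_add lookup_minus ring_distribs mult.assoc)

lemma tl_scale_zero_right: "tl_scale c 0 = 0"
  by (auto intro!: poly_mapping_eqI)

lemma tl_comp_add_left: "tl_comp (g + g') f = tl_comp g f + tl_comp g' f"
  unfolding tl_comp_def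
  by (rule additive_extension) (simp_all add: tl_scale_simps ring_distribs sum.distrib)

lemma tl_comp_add_right: "tl_comp g (f + f') = tl_comp g f + tl_comp g f'"
  unfolding tl_comp_def sum.swap[of _ _ "Poly_Mapping.keys g"]
  by (rule additive_extension) (simp_all add: tl_scale_simps ring_distribs sum.distrib)

lemma tl_comp_zero [simp]: "tl_comp 0 f = 0" "tl_comp g 0 = 0"
  by (simp_all add: tl_comp_def)

text \<open>
  On basis diagrams, each closed loop contributes a factor \<open>loop_value\<close>.
\<close>

lemma tl_comp_single:
  "tl_comp (Poly_Mapping.single E a) (Poly_Mapping.single D b)
    = Poly_Mapping.single (fst (stack E D)) (a * b * loop_value ^ snd (stack E D))"
proof -
  have "diagram_class (stack E D) = Poly_Mapping.single (fst (stack E D)) (loop_value ^ snd (stack E D))"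
    by (metis diagram_class.simps prod.collapse)
  then show ?thesis by (cases "a = 0"; cases "b = 0") (simp_all add: tl_comp_def tl_scale_simps)
qed

lemma tl_comp_scale_right: "tl_comp g (tl_scale c f) = tl_scale c (tl_comp g f)"
proof (induction g rule: formal_sum_induct)
  case (single E a)
  show ?case
    by (induction f rule: formal_sum_induct)
      (simp_all add: tl_scale_simps tl_scale_add_right tl_comp_single tl_comp_add_right mult_ac)
qed (simp add: tl_comp_add_left tl_scale_add_right)

lemma tl_comp_scale_left: "tl_comp (tl_scale c g) f = tl_scale c (tl_comp g f)"
proof (induction g rule: formal_sum_induct)
  case (single E a)
  show ?case
    by (induction f rule: formal_sum_induct)
      (simp_all add: tl_scale_simps tl_scale_add_right tl_comp_single tl_comp_add_right mult_ac)
qed (simp add: tl_comp_add_left tl_scale_add_right)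

lemma tl_comp_diff_left: "tl_comp (g - g') f = tl_comp g f - tl_comp g' f"
  using tl_comp_add_left[of "g - g'" g' f] by (simp add: algebra_simps)

lemma tl_comp_diff_right: "tl_comp g (f - f') = tl_comp g f - tl_comp g f'"
  using tl_comp_add_right[of g "f - f'" f'] by (simp add: algebra_simps)

lemma tl_hom_zero [simp]: "0 \<in> tl_hom m n"
  by (simp add: tl_hom_def)

lemma tl_hom_add: "f \<in> tl_hom m n \<Longrightarrow> g \<in> tl_hom m n \<Longrightarrow> f + g \<in> tl_hom m n"
  unfolding tl_hom_def using Poly_Mapping.keys_add[of f g] by blast

lemma tl_hom_scale: "f \<in> tl_hom m n \<Longrightarrow> tl_scale c f \<in> tl_hom m n"
  by (auto simp: tl_hom_def in_keys_iff)

lemma tl_hom_diff: "f \<in> tl_hom m n \<Longrightarrow> g \<in> tl_hom m n \<Longrightarrow> f - g \<in> tl_hom m n"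
  using tl_hom_add[of f m n "tl_scale (- 1) g"] tl_hom_scale[of g m n "- 1"]
  by (simp add: tl_scale_minus_left tl_scale_one)

lemma tl_hom_single: "D \<in> tl_diagrams m n \<Longrightarrow> Poly_Mapping.single D c \<in> tl_hom m n"
  by (simp add: tl_hom_def)

text \<open>
  Statements about morphisms that respect sums have to be checked on basis diagrams only.
\<close>

lemma tl_hom_induct [consumes 1, case_names zero single add]:
  assumes f: "f \<in> tl_hom m n"
    and zero: "P 0"
    and single: "\<And>D c. D \<in> tl_diagrams m n \<Longrightarrow> P (Poly_Mapping.single D c)"
    and add: "\<And>f g. f \<in> tl_hom m n \<Longrightarrow> g \<in> tl_hom m n \<Longrightarrow> P f \<Longrightarrow> P g \<Longrightarrow> P (f + g)"
  shows "P f"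
proof -
  have "finite A \<Longrightarrow> A \<subseteq> tl_diagrams m n \<Longrightarrow> Poly_Mapping.keys f \<subseteq> A \<Longrightarrow> P f" for A
  proof (induction A arbitrary: f rule: finite_induct)
    case empty
    then show ?case using zero by simp
  next
    case (insert x A)
    let ?s = "Poly_Mapping.single x (Poly_Mapping.lookup f x)"
    have k: "Poly_Mapping.keys (f - ?s) \<subseteq> A"
      using insert.prems by (auto simp: in_keys_iff lookup_minus lookup_single when_def split: if_splits)
    have "f - ?s \<in> tl_hom m n" using k insert.prems by (auto simp: tl_hom_def)
    moreover have "?s \<in> tl_hom m n" using insert.prems by (intro tl_hom_single) simp
    ultimately have "P ((f - ?s) + ?s)"
      using insert.IH[OF _ k] insert.prems by (intro add single) auto
    then show ?case by simp
  qed
  from this[of "Poly_Mapping.keys f"] show ?thesis using f by (simp add: tl_hom_def)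
qed

lemma tl_comp_hom:
  assumes g: "g \<in> tl_hom n k" and f: "f \<in> tl_hom m n"
  shows "tl_comp g f \<in> tl_hom m k"
  using g
proof (induction rule: tl_hom_induct)
  case (single E a)
  show ?case using f
  proof (induction rule: tl_hom_induct)
    case (single D b)
    then show ?case using \<open>E \<in> _\<close> by (simp add: tl_comp_single tl_hom_single tl_stack)
  qed (simp_all add: tl_comp_add_right tl_hom_add)
qed (simp_all add: tl_comp_add_left tl_hom_add)

lemma tl_comp_assoc:
  assumes h: "h \<in> tl_hom k l" and g: "g \<in> tl_hom n k" and f: "f \<in> tl_hom m n"
  shows "tl_comp (tl_comp h g) f = tl_comp h (tl_comp g f)"
  using h
proof (induction rule: tl_hom_induct)
  case (single G c)
  note G = this
  show ?case using g
  proof (induction rule: tl_hom_induct)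
    case (single E b)
    note E = this
    show ?case using f
    proof (induction rule: tl_hom_induct)
      case (single D a)
      have "matching m k (fst (stack E D))" "matching n l (fst (stack G E))"
        using tl_stack[OF E single] tl_stack[OF G E] by (simp_all add: tl_diagrams_iff)
      moreover have "matching m n D" "matching n k E" "matching k l G"
        using single E G by (simp_all add: tl_diagrams_iff)
      ultimately have "fst (stack G (fst (stack E D))) = fst (stack (fst (stack G E)) D)"
        "snd (stack (fst (stack G E)) D) + snd (stack G E) = snd (stack G (fst (stack E D))) + snd (stack E D)"
        using stack_assoc[of m n D k E l G] by simp_all
      then show ?case
        by (simp add: tl_comp_single mult_ac power_add[symmetric] add.commute)
    qed (simp_all add: tl_comp_add_right)
  qed (simp_all add: tl_comp_add_right tl_comp_add_left)
qed (simp_all add: tl_comp_add_left)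

lemma tl_id_hom: "tl_id n \<in> tl_hom n n"
  by (simp add: tl_id_def tl_hom_single tl_id_diagram)

lemma tl_comp_id_left: "f \<in> tl_hom m n \<Longrightarrow> tl_comp (tl_id n) f = f"
proof (induction rule: tl_hom_induct)
  case (single D c)
  then have "matching m n D" by (simp add: tl_diagrams_iff)
  then show ?case by (simp add: tl_id_def tl_comp_single stack_id_left)
qed (simp_all add: tl_comp_add_right)

lemma tl_comp_id_right: "f \<in> tl_hom m n \<Longrightarrow> tl_comp f (tl_id m) = f"
proof (induction rule: tl_hom_induct)
  case (single D c)
  then have "matching m n D" by (simp add: tl_diagrams_iff)
  then show ?case by (simp add: tl_id_def tl_comp_single stack_id_right)
qed (simp_all add: tl_comp_add_left)

lemma linear_category_TL: "linear_category TL"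
  by unfold_locales
    (simp_all add: TL_def tl_hom_add tl_hom_scale tl_scale_add_right tl_scale_simps tl_scale_scale tl_scale_one
      tl_id_hom tl_comp_hom tl_comp_id_left tl_comp_id_right tl_comp_assoc tl_comp_add_left tl_comp_add_right
      tl_comp_scale_left tl_comp_scale_right)

lemma tl_tensor_add_left: "tl_tensor m n (f + f') g = tl_tensor m n f g + tl_tensor m n f' g"
  unfolding tl_tensor_def
  by (rule additive_extension) (simp_all add: single_add ring_distribs sum.distrib)

lemma tl_tensor_add_right: "tl_tensor m n f (g + g') = tl_tensor m n f g + tl_tensor m n f g'"
  unfolding tl_tensor_def sum.swap[of _ _ "Poly_Mapping.keys f"]
  by (rule additive_extension) (simp_all add: single_add ring_distribs sum.distrib)

lemma tl_tensor_zero [simp]: "tl_tensor m n 0 g = 0" "tl_tensor m n f 0 = 0"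
  by (simp_all add: tl_tensor_def)

lemma tl_tensor_single:
  "tl_tensor m n (Poly_Mapping.single D a) (Poly_Mapping.single E b) = Poly_Mapping.single (juxtapose m n D E) (a * b)"
  by (cases "a = 0"; cases "b = 0") (simp_all add: tl_tensor_def)

lemma tl_tensor_scale_left: "tl_tensor m n (tl_scale c f) g = tl_scale c (tl_tensor m n f g)"
proof (induction f rule: formal_sum_induct)
  case (single E a)
  show ?case
    by (induction g rule: formal_sum_induct)
      (simp_all add: tl_scale_simps tl_scale_add_right tl_tensor_single tl_tensor_add_right mult_ac)
qed (simp add: tl_tensor_add_left tl_scale_add_right)

lemma tl_tensor_diff_left: "tl_tensor m n (f - f') g = tl_tensor m n f g - tl_tensor m n f' g"
  using tl_tensor_add_left[of m n "f - f'" f' g] by (simp add: algebra_simps)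

lemma tl_tensor_hom:
  assumes f: "f \<in> tl_hom m n" and g: "g \<in> tl_hom m' n'"
  shows "tl_tensor m n f g \<in> tl_hom (m + m') (n + n')"
  using f
proof (induction rule: tl_hom_induct)
  case (single D a)
  show ?case using g
  proof (induction rule: tl_hom_induct)
    case (single E b)
    then show ?case using \<open>D \<in> _\<close> by (simp add: tl_tensor_single tl_hom_single tl_juxtapose)
  qed (simp_all add: tl_tensor_add_right tl_hom_add)
qed (simp_all add: tl_tensor_add_left tl_hom_add)

lemma tl_tensor_comp:
  assumes g: "g \<in> tl_hom n k" and f: "f \<in> tl_hom m n" and g': "g' \<in> tl_hom n' k'" and f': "f' \<in> tl_hom m' n'"
  shows "tl_comp (tl_tensor n k g g') (tl_tensor m n f f') = tl_tensor m k (tl_comp g f) (tl_comp g' f')"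
  using g
proof (induction rule: tl_hom_induct)
  case (single E a)
  note E = this
  show ?case using f
  proof (induction rule: tl_hom_induct)
    case (single D b)
    note D = this
    show ?case using g'
    proof (induction rule: tl_hom_induct)
      case (single E' c)
      note E' = this
      show ?case using f'
      proof (induction rule: tl_hom_induct)
        case (single D' d)
        note D' = this
        have "matching m n D" "matching n k E" "matching m' n' D'" "matching n' k' E'"
          "matching m k (fst (stack E D))" "matching m' k' (fst (stack E' D'))"
          using D E D' E' tl_stack[OF E D] tl_stack[OF E' D'] by (simp_all add: tl_diagrams_iff)
        from stack_juxtapose[OF this] show ?case
          by (simp add: tl_tensor_single tl_comp_single power_add mult_ac)
      qed (simp_all add: tl_comp_add_right tl_tensor_add_right)
    qed (simp_all add: tl_comp_add_right tl_comp_add_left tl_tensor_add_right)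
  qed (simp_all add: tl_comp_add_right tl_tensor_add_left)
qed (simp_all add: tl_comp_add_left tl_tensor_add_left)

lemma tl_tensor_id: "tl_tensor m m (tl_id m) (tl_id n) = tl_id (m + n)"
  by (simp add: tl_id_def tl_tensor_single juxtapose_id)

definition add_strand :: "nat \<Rightarrow> nat \<Rightarrow> tl_morphism \<Rightarrow> tl_morphism" where
  "add_strand m n f = tl_tensor m n f (tl_id 1)"

definition cup_mor :: "nat \<Rightarrow> nat \<Rightarrow> tl_morphism" where
  "cup_mor n i = Poly_Mapping.single (cup n i) 1"

definition cap_mor :: "nat \<Rightarrow> nat \<Rightarrow> tl_morphism" where
  "cap_mor n i = Poly_Mapping.single (cap n i) 1"

lemma cup_mor_hom: "i \<le> n \<Longrightarrow> cup_mor n i \<in> tl_hom n (Suc (Suc n))"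
  and cap_mor_hom: "i \<le> n \<Longrightarrow> cap_mor n i \<in> tl_hom (Suc (Suc n)) n"
  by (simp_all add: cup_mor_def cap_mor_def tl_hom_single tl_cup tl_cap)

lemma add_strand_hom: "f \<in> tl_hom m n \<Longrightarrow> add_strand m n f \<in> tl_hom (Suc m) (Suc n)"
  using tl_tensor_hom[OF _ tl_id_hom, of f m n 1] by (simp add: add_strand_def)

lemma add_strand_comp:
  "g \<in> tl_hom n k \<Longrightarrow> f \<in> tl_hom m n \<Longrightarrow> add_strand m k (tl_comp g f) = tl_comp (add_strand n k g) (add_strand m n f)"
  by (simp add: add_strand_def tl_tensor_comp[OF _ _ tl_id_hom tl_id_hom] tl_comp_id_left[OF tl_id_hom])

lemma add_strand_add: "add_strand m n (f + g) = add_strand m n f + add_strand m n g"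
  and add_strand_diff: "add_strand m n (f - g) = add_strand m n f - add_strand m n g"
  and add_strand_scale: "add_strand m n (tl_scale c f) = tl_scale c (add_strand m n f)"
  and add_strand_zero [simp]: "add_strand m n 0 = 0"
  by (simp_all add: add_strand_def tl_tensor_add_left tl_tensor_diff_left tl_tensor_scale_left)

lemma add_strand_id: "add_strand n n (tl_id n) = tl_id (Suc n)"
  by (simp add: add_strand_def tl_tensor_id)

lemma add_strand_single: "add_strand m n (Poly_Mapping.single D c) = Poly_Mapping.single (strand m n D) c"
  by (simp add: add_strand_def tl_id_def tl_tensor_single strand_def)

lemma add_strand_cup: "i \<le> n \<Longrightarrow> add_strand n (Suc (Suc n)) (cup_mor n i) = cup_mor (Suc n) i"
  and add_strand_cap: "i \<le> n \<Longrightarrow> add_strand (Suc (Suc n)) n (cap_mor n i) = cap_mor (Suc n) i"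
  by (simp_all add: cup_mor_def cap_mor_def add_strand_single strand_cup strand_cap)

lemma cap_cup: "i \<le> n \<Longrightarrow> tl_comp (cap_mor n i) (cup_mor n i) = tl_scale loop_value (tl_id n)"
  by (simp add: cup_mor_def cap_mor_def tl_comp_single stack_cap_cup tl_id_def tl_scale_simps)

lemma cap_cup_zigzag:
  "Suc i \<le> n \<Longrightarrow> tl_comp (cap_mor n (Suc i)) (cup_mor n i) = tl_id n"
  "Suc i \<le> n \<Longrightarrow> tl_comp (cap_mor n i) (cup_mor n (Suc i)) = tl_id n"
  by (simp_all add: cup_mor_def cap_mor_def tl_comp_single zigzag zigzag' tl_id_def)

lemma cup_slide:
  assumes "f \<in> tl_hom m n"
  shows "tl_comp (add_strand (Suc m) (Suc n) (add_strand m n f)) (cup_mor m m) = tl_comp (cup_mor n n) f"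
  using assms
proof (induction rule: tl_hom_induct)
  case (single D c)
  then show ?case
    by (simp add: add_strand_single cup_mor_def tl_comp_single slide_cup tl_diagrams_iff)
qed (simp_all add: add_strand_add tl_comp_add_left tl_comp_add_right)

lemma cap_slide:
  assumes "f \<in> tl_hom m n"
  shows "tl_comp (cap_mor n n) (add_strand (Suc m) (Suc n) (add_strand m n f)) = tl_comp f (cap_mor m m)"
  using assms
proof (induction rule: tl_hom_induct)
  case (single D c)
  then show ?case
    by (simp add: add_strand_single cap_mor_def tl_comp_single slide_cap tl_diagrams_iff)
qed (simp_all add: add_strand_add tl_comp_add_left tl_comp_add_right)

lemma cup_cap_factor: "cup_cap (Suc k) = tl_comp (cup_mor k k) (cap_mor k k)"
  by (simp add: cup_cap_def cup_mor_def cap_mor_def tl_comp_single cup_cap_diagram)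

lemma jones_wenzl_Suc:
  assumes "P = add_strand (Suc k) (Suc k) (jones_wenzl (Suc k))"
  shows "jones_wenzl (Suc (Suc k)) =
    P - tl_scale (qint (Suc k) / qint (Suc (Suc k))) (tl_comp (tl_comp P (tl_comp (cup_mor k k) (cap_mor k k))) P)"
  by (simp add: assms Let_def add_strand_def cup_cap_factor)

section \<open>Jones-Wenzl idempotents\<close>

lemma qvar_nonzero: "qvar \<noteq> 0"
  by (simp add: qvar_def Zero_fract_def eq_fract)

lemma qvar_power: "qvar ^ n = Fract ([:0, 1:] ^ n) 1"
  by (induction n) (simp_all add: qvar_def One_fract_def)

lemma qvar_power_neq_1: "0 < n \<Longrightarrow> qvar ^ n \<noteq> 1"
proof
  assume "0 < n" "qvar ^ n = 1"
  then have "([:0, 1:] :: complex poly) ^ n = 1" by (simp add: qvar_power One_fract_def eq_fract)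
  then have "poly ([:0, 1:] ^ n) (0 :: complex) = 1" by simp
  then show False using \<open>0 < n\<close> by (simp add: zero_power)
qed

lemma qdiff_nonzero: "0 < n \<Longrightarrow> qvar ^ n - inverse qvar ^ n \<noteq> 0"
proof
  assume n: "0 < n" and "qvar ^ n - inverse qvar ^ n = 0"
  then have "qvar ^ n * qvar ^ n = 1" using qvar_nonzero by (simp add: power_inverse field_simps)
  then have "qvar ^ (n + n) = 1" by (simp add: power_add)
  then show False using qvar_power_neq_1[of "n + n"] n by simp
qed

text \<open>
  \<open>q\<close> is transcendental, so it is not a root of unity.
\<close>

lemma qint_nonzero: "0 < n \<Longrightarrow> qint n \<noteq> 0"
  using qdiff_nonzero[of n] qdiff_nonzero[of 1] by (simp add: qint_def)

lemma qint_one: "qint (Suc 0) = 1"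
  using qdiff_nonzero[of 1] by (simp add: qint_def)

lemma qint_recurrence: "loop_value * qint (Suc n) = qint (Suc (Suc n)) + qint n"
proof -
  have cancel: "qvar * (inverse qvar * x) = x" "inverse qvar * (qvar * x) = x" for x
    using qvar_nonzero by simp_all
  have "(qvar + inverse qvar) * (qvar ^ Suc n - inverse qvar ^ Suc n)
    = (qvar ^ Suc (Suc n) - inverse qvar ^ Suc (Suc n)) + (qvar ^ n - inverse qvar ^ n)"
    by (simp add: ring_distribs mult.assoc cancel)
  then show ?thesis unfolding qint_def loop_value_def by (simp add: add_divide_distrib[symmetric])
qed

lemma loop_value_diff:
  "loop_value - qint (Suc k) / qint (Suc (Suc k)) = qint (Suc (Suc (Suc k))) / qint (Suc (Suc k))"
  using qint_recurrence[of "Suc k"] qint_nonzero[of "Suc (Suc k)"] by (simp add: field_simps)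

text \<open>
  The idempotent \<open>p\<^sub>0\<close> slides through the cup to the left-hand strands of \<open>p\<close>, where it is absorbed.
\<close>

lemma strand_cup_absorb:
  assumes p: "p \<in> tl_hom (Suc k) (Suc k)" and p0: "p0 \<in> tl_hom k k" and abs: "tl_comp p (add_strand k k p0) = p"
  shows "tl_comp (tl_comp (add_strand (Suc k) (Suc k) p) (cup_mor k k)) p0
    = tl_comp (add_strand (Suc k) (Suc k) p) (cup_mor k k)"
proof -
  let ?P = "add_strand (Suc k) (Suc k) p" and ?u = "cup_mor k k" and ?Q = "add_strand (Suc k) (Suc k) (add_strand k k p0)"
  have P: "?P \<in> tl_hom (Suc (Suc k)) (Suc (Suc k))" and Q: "?Q \<in> tl_hom (Suc (Suc k)) (Suc (Suc k))"
    and u: "?u \<in> tl_hom k (Suc (Suc k))"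
    by (simp_all add: add_strand_hom p p0 cup_mor_hom)
  have "tl_comp (tl_comp ?P ?u) p0 = tl_comp ?P (tl_comp ?Q ?u)"
    by (simp only: tl_comp_assoc[OF P u p0] cup_slide[OF p0])
  also have "\<dots> = tl_comp (add_strand (Suc k) (Suc k) (tl_comp p (add_strand k k p0))) ?u"
    by (simp only: tl_comp_assoc[OF P Q u] add_strand_comp[OF p add_strand_hom[OF p0]])
  finally show ?thesis by (simp only: abs)
qed

lemma cap_strand_absorb:
  assumes p: "p \<in> tl_hom (Suc k) (Suc k)" and p0: "p0 \<in> tl_hom k k" and abs: "tl_comp (add_strand k k p0) p = p"
  shows "tl_comp p0 (tl_comp (cap_mor k k) (add_strand (Suc k) (Suc k) p))
    = tl_comp (cap_mor k k) (add_strand (Suc k) (Suc k) p)"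
proof -
  let ?P = "add_strand (Suc k) (Suc k) p" and ?v = "cap_mor k k" and ?Q = "add_strand (Suc k) (Suc k) (add_strand k k p0)"
  have P: "?P \<in> tl_hom (Suc (Suc k)) (Suc (Suc k))" and Q: "?Q \<in> tl_hom (Suc (Suc k)) (Suc (Suc k))"
    and v: "?v \<in> tl_hom (Suc (Suc k)) k"
    by (simp_all add: add_strand_hom p p0 cap_mor_hom)
  have "tl_comp p0 (tl_comp ?v ?P) = tl_comp (tl_comp ?v ?Q) ?P"
    by (simp only: tl_comp_assoc[OF p0 v P] cap_slide[OF p0])
  also have "\<dots> = tl_comp ?v (add_strand (Suc k) (Suc k) (tl_comp (add_strand k k p0) p))"
    by (simp only: tl_comp_assoc[OF v Q P] add_strand_comp[OF add_strand_hom[OF p0] p])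
  finally show ?thesis by (simp only: abs)
qed

definition jw_relations :: "nat \<Rightarrow> bool" where
  "jw_relations k \<longleftrightarrow> (let p = jones_wenzl (Suc k); p' = jones_wenzl k in
     p \<in> tl_hom (Suc k) (Suc k) \<and> p' \<in> tl_hom k k \<and> tl_comp p p = p \<and>
     tl_comp p (add_strand k k p') = p \<and> tl_comp (add_strand k k p') p = p \<and>
     tl_comp (tl_comp (cap_mor k k) (add_strand (Suc k) (Suc k) p)) (cup_mor k k)
       = tl_scale (qint (Suc (Suc k)) / qint (Suc k)) p' \<and>
     (\<forall>j i. k = Suc j \<longrightarrow> i \<le> j \<longrightarrow> tl_comp p (cup_mor j i) = 0 \<and> tl_comp (cap_mor j i) p = 0))"

text \<open>
  The properties of \<open>p\<^sub>k\<^sub>+\<^sub>1\<close> are proved together because they need each other. With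
  \<open>P = p \<otimes> id\<^sub>1\<close>, cup \<open>u\<close> and cap \<open>v\<close>, the partial trace of \<open>p\<close> gives \<open>v P u = c\<^sup>-\<^sup>1 p\<^sub>0\<close>, where \<open>c\<close> is the
  coefficient in the recursion \<open>p' = P - c P u v P\<close>. Hence \<open>p' u = P u - P u p\<^sub>0 = 0\<close> and dually
  \<open>v p' = 0\<close>; then \<open>p' p' = p' P = p'\<close>, and the new partial trace is
  \<open>(loop_value - c) p\<close> by the zigzag relations.
\<close>

lemma jw_relations: "jw_relations k"
proof (induction k)
  case 0
  have "jones_wenzl (Suc 0) = tl_id (Suc 0)" by simp
  moreover have "tl_comp (tl_id (Suc (Suc 0))) (cup_mor 0 0) = cup_mor 0 0"
    by (rule tl_comp_id_left[OF cup_mor_hom]) simp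
  moreover have "tl_comp (tl_comp (cap_mor 0 0) (tl_id (Suc (Suc 0)))) (cup_mor 0 0)
     = tl_scale loop_value (tl_id 0)"
    using tl_comp_id_right[OF cap_mor_hom, of 0 0] cap_cup[of 0 0] by simp
  ultimately show ?case
    using tl_id_hom[of 0] tl_id_hom[of "Suc 0"] tl_comp_id_left[OF tl_id_hom]
    by (simp add: jw_relations_def add_strand_id qint_one loop_value_eq_qint numeral_2_eq_2)
next
  case (Suc k)
  define n where "n = Suc k"
  define p where "p = jones_wenzl n"
  define p0 where "p0 = jones_wenzl k"
  define P where "P = add_strand n n p"
  define u where "u = cup_mor k k"
  define v where "v = cap_mor k k"
  define c where "c = qint n / qint (Suc n)"
  define p' where "p' = jones_wenzl (Suc n)"
  have c: "c \<noteq> 0" "c * (qint (Suc n) / qint n) = 1"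
    using qint_nonzero[of n] qint_nonzero[of "Suc n"] by (simp_all add: c_def n_def)
  have p: "p \<in> tl_hom n n" and p0: "p0 \<in> tl_hom k k" and pp: "tl_comp p p = p"
    and abs: "tl_comp p (add_strand k k p0) = p" "tl_comp (add_strand k k p0) p = p"
    and trace: "tl_comp (tl_comp v P) u = tl_scale (qint (Suc n) / qint n) p0"
    and kill: "\<And>j i. k = Suc j \<Longrightarrow> i \<le> j \<Longrightarrow> tl_comp p (cup_mor j i) = 0"
      "\<And>j i. k = Suc j \<Longrightarrow> i \<le> j \<Longrightarrow> tl_comp (cap_mor j i) p = 0"
    using Suc unfolding jw_relations_def Let_def p_def p0_def P_def u_def v_def n_def by blast+
  have P: "P \<in> tl_hom (Suc n) (Suc n)" unfolding P_def by (rule add_strand_hom[OF p])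
  have u: "u \<in> tl_hom k (Suc n)" and v: "v \<in> tl_hom (Suc n) k"
    unfolding u_def v_def n_def by (simp_all add: cup_mor_hom cap_mor_hom)
  have PP: "tl_comp P P = P" unfolding P_def add_strand_comp[OF p p, symmetric] pp ..
  have Pu: "tl_comp P u \<in> tl_hom k (Suc n)" and vP: "tl_comp v P \<in> tl_hom (Suc n) k"
    using tl_comp_hom[OF P u] tl_comp_hom[OF v P] .
  have p'_eq: "p' = P - tl_scale c (tl_comp (tl_comp P u) (tl_comp v P))"
    unfolding p'_def n_def jones_wenzl_Suc[OF refl]
    unfolding n_def[symmetric] u_def[symmetric] v_def[symmetric] p_def[symmetric] P_def[symmetric] c_def[symmetric]
    using tl_comp_assoc[OF P u v] tl_comp_assoc[OF Pu v P] by simp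
  have p': "p' \<in> tl_hom (Suc n) (Suc n)"
    unfolding p'_eq by (intro tl_hom_diff tl_hom_scale P tl_comp_hom[OF Pu vP])
  have up0: "tl_comp (tl_comp P u) p0 = tl_comp P u"
    unfolding P_def u_def n_def by (rule strand_cup_absorb[OF p[unfolded n_def] p0 abs(1)])
  have p0v: "tl_comp p0 (tl_comp v P) = tl_comp v P"
    unfolding P_def v_def n_def by (rule cap_strand_absorb[OF p[unfolded n_def] p0 abs(2)])
  have p'u: "tl_comp p' u = 0"
  proof -
    have "tl_comp (tl_comp (tl_comp P u) (tl_comp v P)) u = tl_comp (tl_comp P u) (tl_comp (tl_comp v P) u)"
      by (rule tl_comp_assoc[OF Pu vP u])
    also have "\<dots> = tl_scale (qint (Suc n) / qint n) (tl_comp P u)"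
      by (simp add: trace tl_comp_scale_right up0)
    finally show ?thesis
      unfolding p'_eq by (simp add: tl_comp_diff_left tl_comp_scale_left tl_scale_scale c(2) tl_scale_one del: times_divide_eq_right)
  qed
  have vp': "tl_comp v p' = 0"
  proof -
    have "tl_comp v (tl_comp (tl_comp P u) (tl_comp v P)) = tl_comp (tl_comp v (tl_comp P u)) (tl_comp v P)"
      by (rule tl_comp_assoc[OF v Pu vP, symmetric])
    also have "tl_comp v (tl_comp P u) = tl_comp (tl_comp v P) u" by (rule tl_comp_assoc[OF v P u, symmetric])
    also have "tl_comp \<dots> (tl_comp v P) = tl_scale (qint (Suc n) / qint n) (tl_comp v P)"
      by (simp add: trace tl_comp_scale_left p0v)
    finally show ?thesis
      unfolding p'_eq by (simp add: tl_comp_diff_right tl_comp_scale_right tl_scale_scale c(2) tl_scale_one del: times_divide_eq_right)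
  qed
  have p'P: "tl_comp p' P = p'"
    using tl_comp_assoc[OF Pu vP P] tl_comp_assoc[OF v P P]
    unfolding p'_eq by (simp add: tl_comp_diff_left tl_comp_scale_left PP)
  have Pp': "tl_comp P p' = p'"
    using tl_comp_assoc[OF P Pu vP] tl_comp_assoc[OF P P u]
    unfolding p'_eq by (simp add: tl_comp_diff_right tl_comp_scale_right PP)
  have p'p': "tl_comp p' p' = p'"
  proof -
    have "tl_comp p' (tl_comp (tl_comp P u) (tl_comp v P)) = tl_comp (tl_comp p' (tl_comp P u)) (tl_comp v P)"
      by (rule tl_comp_assoc[OF p' Pu vP, symmetric])
    also have "tl_comp p' (tl_comp P u) = 0"
      using tl_comp_assoc[OF p' P u] p'P p'u by simp
    finally have "tl_comp p' (P - tl_scale c (tl_comp (tl_comp P u) (tl_comp v P))) = p'"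
      by (simp add: tl_comp_diff_right tl_comp_scale_right p'P tl_scale_zero_right)
    then show ?thesis by (simp only: p'_eq[symmetric])
  qed
  have kill': "tl_comp p' (cup_mor k i) = 0" "tl_comp (cap_mor k i) p' = 0" if ik: "i \<le> k" for i
  proof -
    have "tl_comp p' (cup_mor k i) = 0 \<and> tl_comp (cap_mor k i) p' = 0"
    proof (cases "i = k")
      case True
      then show ?thesis using p'u vp' by (simp add: u_def v_def)
    next
      case False
      then obtain j where j: "k = Suc j" "i \<le> j" using ik by (cases k) auto
      have cu: "cup_mor j i \<in> tl_hom j n" and ca: "cap_mor j i \<in> tl_hom n j"
        using cup_mor_hom[OF j(2)] cap_mor_hom[OF j(2)] j(1) by (simp_all add: n_def)
      have S: "add_strand j n (cup_mor j i) = cup_mor k i" "add_strand n j (cap_mor j i) = cap_mor k i"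
        using add_strand_cup[OF j(2)] add_strand_cap[OF j(2)] j(1) by (simp_all add: n_def)
      have Sh: "cup_mor k i \<in> tl_hom k (Suc n)" "cap_mor k i \<in> tl_hom (Suc n) k"
        using add_strand_hom[OF cu] add_strand_hom[OF ca] j(1) unfolding S by simp_all
      have "tl_comp P (cup_mor k i) = 0"
        using add_strand_comp[OF p cu] kill(1)[OF j] by (simp add: P_def S)
      then have "tl_comp p' (cup_mor k i) = 0" using tl_comp_assoc[OF p' P Sh(1)] p'P by simp
      moreover have "tl_comp (cap_mor k i) P = 0"
        using add_strand_comp[OF ca p] kill(2)[OF j] by (simp add: P_def S)
      then have "tl_comp (cap_mor k i) p' = 0" using tl_comp_assoc[OF Sh(2) P p'] Pp' by simp
      ultimately show ?thesis ..
    qed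
    then show "tl_comp p' (cup_mor k i) = 0" "tl_comp (cap_mor k i) p' = 0" by blast+
  qed
  \<comment> \<open>The correction term of the recursion straightens to a single \<open>p\<close>, by one zigzag on each side.\<close>
  have trace': "tl_comp (tl_comp (cap_mor n n) (add_strand (Suc n) (Suc n) p')) (cup_mor n n)
      = tl_scale (qint (Suc (Suc n)) / qint (Suc n)) p"
  proof -
    let ?Q = "add_strand (Suc n) (Suc n) P" and ?cap = "cap_mor n n" and ?cup = "cup_mor n n"
    have Q: "?Q \<in> tl_hom (Suc (Suc n)) (Suc (Suc n))" by (rule add_strand_hom[OF P])
    have cap: "?cap \<in> tl_hom (Suc (Suc n)) n" and cup: "?cup \<in> tl_hom n (Suc (Suc n))"
      by (simp_all add: cap_mor_hom cup_mor_hom)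
    have capQ: "tl_comp ?cap ?Q = tl_comp p ?cap" unfolding P_def by (rule cap_slide[OF p])
    have Qcup: "tl_comp ?Q ?cup = tl_comp ?cup p" unfolding P_def by (rule cup_slide[OF p])
    have Su: "add_strand k (Suc n) u = cup_mor n k" and Sv: "add_strand (Suc n) k v = cap_mor n k"
      unfolding u_def v_def n_def by (simp_all add: add_strand_cup add_strand_cap)
    have u': "cup_mor n k \<in> tl_hom n (Suc (Suc n))" and v': "cap_mor n k \<in> tl_hom (Suc (Suc n)) n"
      by (simp_all add: cup_mor_hom cap_mor_hom n_def)
    have Sp': "add_strand (Suc n) (Suc n) p'
        = ?Q - tl_scale c (tl_comp (tl_comp ?Q (cup_mor n k)) (tl_comp (cap_mor n k) ?Q))"
      unfolding p'_eq add_strand_diff add_strand_scale add_strand_comp[OF Pu vP] add_strand_comp[OF P u] add_strand_comp[OF v P]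
        Su Sv n_def[symmetric] ..
    have 1: "tl_comp (tl_comp ?cap ?Q) ?cup = tl_scale loop_value p"
      using tl_comp_assoc[OF p cap cup] cap_cup[of n n] tl_comp_id_right[OF p]
      by (simp add: capQ tl_comp_scale_right)
    have zig: "tl_comp (cap_mor n n) (cup_mor n k) = tl_id n" "tl_comp (cap_mor n k) (cup_mor n n) = tl_id n"
      using cap_cup_zigzag[of k n] by (simp_all add: n_def)
    \<comment> \<open>\<open>l\<close> and \<open>r\<close> are the halves of that term to the left and to the right of the middle object \<open>n\<close>.\<close>
    have l: "tl_comp ?cap (tl_comp ?Q (cup_mor n k)) = p"
      by (simp only: tl_comp_assoc[OF cap Q u', symmetric] capQ tl_comp_assoc[OF p cap u'] zig tl_comp_id_right[OF p])
    have r: "tl_comp (tl_comp (cap_mor n k) ?Q) ?cup = p"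
      by (simp only: tl_comp_assoc[OF v' Q cup] Qcup tl_comp_assoc[OF v' cup p, symmetric] zig tl_comp_id_left[OF p])
    have Qu: "tl_comp ?Q (cup_mor n k) \<in> tl_hom n (Suc (Suc n))" and vQ: "tl_comp (cap_mor n k) ?Q \<in> tl_hom (Suc (Suc n)) n"
      using tl_comp_hom[OF Q u'] tl_comp_hom[OF v' Q] .
    have 2: "tl_comp (tl_comp ?cap (tl_comp (tl_comp ?Q (cup_mor n k)) (tl_comp (cap_mor n k) ?Q))) ?cup = p"
      using tl_comp_assoc[OF cap Qu vQ] tl_comp_assoc[OF p vQ cup] by (simp add: l r pp)
    have "tl_comp (tl_comp ?cap (add_strand (Suc n) (Suc n) p')) ?cup = tl_scale loop_value p - tl_scale c p"
      unfolding Sp' by (simp add: tl_comp_diff_left tl_comp_diff_right tl_comp_scale_left tl_comp_scale_right 1 2)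
    also have "\<dots> = tl_scale (loop_value - c) p"
      using tl_scale_simps(2)[of loop_value "- c" p] by (simp add: tl_scale_minus_left)
    also have "loop_value - c = qint (Suc (Suc n)) / qint (Suc n)"
      unfolding c_def n_def by (rule loop_value_diff)
    finally show ?thesis .
  qed
  show ?case
    unfolding jw_relations_def Let_def n_def[symmetric] p_def[symmetric] p'_def[symmetric] P_def[symmetric]
    using p p' p'p' p'P Pp' trace' kill' by (auto simp: n_def)
qed

lemma jones_wenzl_hom: "jones_wenzl n \<in> tl_hom n n"
  using jw_relations[of n] by (simp add: jw_relations_def Let_def)

lemma jones_wenzl_idempotent: "tl_comp (jones_wenzl n) (jones_wenzl n) = jones_wenzl n"
proof (cases n)
  case 0
  then show ?thesis by (simp add: tl_comp_id_left[OF tl_id_hom])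
next
  case (Suc k)
  then show ?thesis using jw_relations[of k] by (simp add: jw_relations_def Let_def)
qed

lemma jones_wenzl_cup: "i \<le> j \<Longrightarrow> tl_comp (jones_wenzl (Suc (Suc j))) (cup_mor j i) = 0"
  and cap_jones_wenzl: "i \<le> j \<Longrightarrow> tl_comp (cap_mor j i) (jones_wenzl (Suc (Suc j))) = 0"
  using jw_relations[of "Suc j"] unfolding jw_relations_def Let_def by blast+

text \<open>
  A diagram other than an identity ends in a cup or begins with a cap, which one of the two
  idempotents annihilates.
\<close>

lemma jw_diagram_jw:
  assumes D: "D \<in> tl_diagrams m n" and ne: "\<not> (m = n \<and> D = id_diagram n)"
  shows "tl_comp (tl_comp (jones_wenzl n) (Poly_Mapping.single D c)) (jones_wenzl m) = 0"
  using D
proof (cases rule: tl_diagram_cases)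
  case (top_arc k i E)
  have "Poly_Mapping.single D c = tl_comp (cup_mor k i) (Poly_Mapping.single E c)"
    using top_arc by (simp add: cup_mor_def tl_comp_single)
  then show ?thesis
    using tl_comp_assoc[OF jones_wenzl_hom[of n], of "cup_mor k i" k "Poly_Mapping.single E c" m]
      top_arc(1) cup_mor_hom[OF top_arc(2)] tl_hom_single[OF top_arc(3)] jones_wenzl_cup[OF top_arc(2)] by simp
next
  case (bottom_arc k i E)
  have *: "Poly_Mapping.single D c = tl_comp (Poly_Mapping.single E c) (cap_mor k i)"
    using bottom_arc by (simp add: cap_mor_def tl_comp_single)
  have h: "cap_mor k i \<in> tl_hom m k" "Poly_Mapping.single E c \<in> tl_hom k n"
    using cap_mor_hom[OF bottom_arc(2)] tl_hom_single[OF bottom_arc(3)] bottom_arc(1) by simp_all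
  have "tl_comp (tl_comp (jones_wenzl n) (Poly_Mapping.single D c)) (jones_wenzl m)
      = tl_comp (tl_comp (jones_wenzl n) (Poly_Mapping.single E c)) (tl_comp (cap_mor k i) (jones_wenzl m))"
    unfolding * tl_comp_assoc[OF jones_wenzl_hom h(2,1), symmetric]
    by (rule tl_comp_assoc[OF tl_comp_hom[OF jones_wenzl_hom h(2)] h(1) jones_wenzl_hom])
  then show ?thesis using cap_jones_wenzl[OF bottom_arc(2)] bottom_arc(1) by simp
qed (use ne in simp)

lemma schur_distinct:
  assumes "f \<in> tl_hom m n" "m \<noteq> n"
  shows "tl_comp (tl_comp (jones_wenzl n) f) (jones_wenzl m) = 0"
  using assms(1)
proof (induction rule: tl_hom_induct)
  case (single D c)
  then show ?case using jw_diagram_jw assms(2) by blast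
qed (simp_all add: tl_comp_add_left tl_comp_add_right)

lemma schur_endo:
  assumes "f \<in> tl_hom n n"
  shows "\<exists>c. tl_comp (tl_comp (jones_wenzl n) f) (jones_wenzl n) = tl_scale c (jones_wenzl n)"
  using assms
proof (induction rule: tl_hom_induct)
  case zero
  show ?case by (rule exI[of _ 0]) (simp add: tl_scale_simps)
next
  case (single D c)
  show ?case
  proof (cases "D = id_diagram n")
    case True
    then have "Poly_Mapping.single D c = tl_scale c (tl_id n)" by (simp add: tl_id_def tl_scale_simps)
    then show ?thesis
      by (auto simp: tl_comp_scale_right tl_comp_scale_left tl_comp_id_right[OF jones_wenzl_hom] jones_wenzl_idempotent)
  next
    case False
    then show ?thesis using jw_diagram_jw[OF single] by (intro exI[of _ 0]) (simp add: tl_scale_simps)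
  qed
next
  case (add f g)
  then show ?case by (auto simp: tl_comp_add_left tl_comp_add_right tl_scale_simps(2)[symmetric])
qed

section \<open>Idempotents split into Jones-Wenzl idempotents\<close>

type_synonym jw_factor = "nat \<times> tl_morphism \<times> tl_morphism"

text \<open>
  A triple \<open>(k, a, b)\<close> stands for the endomorphism \<open>a b\<close> that factors through \<open>p\<^sub>k\<close>; in \<open>Kar TL\<close> these
  are morphisms from \<open>p\<^sub>k\<close> to \<open>id\<^sub>n\<close> and back.
\<close>

fun through_jw :: "nat \<Rightarrow> jw_factor \<Rightarrow> bool" where
  "through_jw n (k, a, b) \<longleftrightarrow> a \<in> tl_hom k n \<and> b \<in> tl_hom n k \<and>
     tl_comp a (jones_wenzl k) = a \<and> tl_comp (jones_wenzl k) b = b"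

fun factor_comp :: "jw_factor \<Rightarrow> tl_morphism" where
  "factor_comp (k, a, b) = tl_comp a b"

definition jw_sum :: "jw_factor list \<Rightarrow> tl_morphism" where
  "jw_sum ts = sum_list (map factor_comp ts)"

lemma jw_sum_simps [simp]: "jw_sum [] = 0" "jw_sum (t # ts) = factor_comp t + jw_sum ts"
  "jw_sum (ts @ us) = jw_sum ts + jw_sum us"
  by (simp_all add: jw_sum_def)

text \<open>
  By the recursion, \<open>p\<^sub>l \<otimes> id\<^sub>1 = p\<^sub>l\<^sub>+\<^sub>1 + c (P u) (v P)\<close>, and \<open>P u\<close> and \<open>v P\<close> absorb \<open>p\<^sub>l\<^sub>-\<^sub>1\<close> on
  the side of the smaller object. For \<open>l = 0\<close> the second term is absent.
\<close>

lemma strand_factor: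
  assumes "through_jw n t"
  shows "\<exists>ts. (\<forall>t \<in> set ts. through_jw (Suc n) t) \<and> add_strand n n (factor_comp t) = jw_sum ts"
proof -
  obtain l a b where t: "t = (l, a, b)" by (cases t)
  have a: "a \<in> tl_hom l n" "tl_comp a (jones_wenzl l) = a" and b: "b \<in> tl_hom n l" "tl_comp (jones_wenzl l) b = b"
    using assms by (simp_all add: t)
  let ?a = "add_strand l n a" and ?b = "add_strand n l b"
  have h: "?a \<in> tl_hom (Suc l) (Suc n)" "?b \<in> tl_hom (Suc n) (Suc l)" by (simp_all add: add_strand_hom a b)
  have comp: "add_strand n n (factor_comp t) = tl_comp ?a ?b" by (simp add: t add_strand_comp[OF a(1) b(1)])
  show ?thesis
  proof (cases l)
    case 0
    then have "through_jw (Suc n) (Suc l, ?a, ?b)"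
      using h tl_comp_id_left[OF h(2)] tl_comp_id_right[OF h(1)] by simp
    then show ?thesis by (intro exI[of _ "[(Suc l, ?a, ?b)]"]) (simp add: comp)
  next
    case (Suc k)
    let ?p = "jones_wenzl (Suc l)" and ?P = "add_strand l l (jones_wenzl l)"
      and ?c = "qint l / qint (Suc l)" and ?u = "cup_mor k k" and ?v = "cap_mor k k"
    let ?q = "jones_wenzl k"
    note good = jw_relations[of k, unfolded jw_relations_def Let_def, folded Suc]
    have p: "?p \<in> tl_hom (Suc l) (Suc l)" and P: "?P \<in> tl_hom (Suc l) (Suc l)"
      and u: "?u \<in> tl_hom k (Suc l)" and v: "?v \<in> tl_hom (Suc l) k" and q: "?q \<in> tl_hom k k"
      using Suc by (simp_all add: jones_wenzl_hom add_strand_hom cup_mor_hom cap_mor_hom del: jones_wenzl.simps)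
    have abs: "tl_comp (tl_comp ?P ?u) ?q = tl_comp ?P ?u" "tl_comp ?q (tl_comp ?v ?P) = tl_comp ?v ?P"
      using strand_cup_absorb[OF jones_wenzl_hom q] cap_strand_absorb[OF jones_wenzl_hom q] good Suc by blast+
    have aP: "tl_comp ?a ?P = ?a"
      using add_strand_comp[OF a(1) jones_wenzl_hom] a by simp
    have Pu: "tl_comp ?P ?u \<in> tl_hom k (Suc l)" and vP: "tl_comp ?v ?P \<in> tl_hom (Suc l) k"
      using tl_comp_hom[OF P u] tl_comp_hom[OF v P] .
    have eq: "?P = ?p + tl_scale ?c (tl_comp (tl_comp ?P ?u) (tl_comp ?v ?P))"
    proof -
      have "tl_comp (tl_comp ?P (tl_comp ?u ?v)) ?P = tl_comp (tl_comp ?P ?u) (tl_comp ?v ?P)"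
        by (simp only: tl_comp_assoc[OF P u v, symmetric] tl_comp_assoc[OF Pu v P])
      moreover have "?p = ?P - tl_scale ?c (tl_comp (tl_comp ?P (tl_comp ?u ?v)) ?P)"
        unfolding Suc by (rule jones_wenzl_Suc[OF refl])
      ultimately show ?thesis by simp
    qed
    let ?a1 = "tl_comp ?a ?p" and ?b1 = "tl_comp ?p ?b"
    let ?a2 = "tl_scale ?c (tl_comp ?a (tl_comp ?P ?u))" and ?b2 = "tl_comp (tl_comp ?v ?P) ?b"
    have 1: "through_jw (Suc n) (Suc l, ?a1, ?b1)"
      using tl_comp_hom[OF h(1) p] tl_comp_hom[OF p h(2)] tl_comp_assoc[OF h(1) p p] tl_comp_assoc[OF p p h(2)]
        jones_wenzl_idempotent[of "Suc l"] by (simp del: jones_wenzl.simps)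
    have 2: "through_jw (Suc n) (k, ?a2, ?b2)"
      using tl_comp_hom[OF h(1) Pu] tl_comp_hom[OF vP h(2)] tl_comp_assoc[OF h(1) Pu q] tl_comp_assoc[OF q vP h(2)]
      by (simp add: abs tl_hom_scale tl_comp_scale_left del: jones_wenzl.simps)
    have "tl_comp ?a ?b = tl_comp (tl_comp ?a ?P) ?b" by (simp only: aP)
    also have "\<dots> = tl_comp (tl_comp ?a (?p + tl_scale ?c (tl_comp (tl_comp ?P ?u) (tl_comp ?v ?P)))) ?b"
      by (simp only: eq[symmetric])
    also have "\<dots> = tl_comp (tl_comp ?a ?p) ?b + tl_scale ?c (tl_comp (tl_comp ?a (tl_comp (tl_comp ?P ?u) (tl_comp ?v ?P))) ?b)"
      by (simp add: tl_comp_add_left tl_comp_add_right tl_comp_scale_left tl_comp_scale_right del: jones_wenzl.simps)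
    also have "tl_comp (tl_comp ?a ?p) ?b = tl_comp ?a1 ?b1"
      using tl_comp_assoc[OF h(1) p p] tl_comp_assoc[OF tl_comp_hom[OF h(1) p] p h(2)] jones_wenzl_idempotent[of "Suc l"]
      by (simp del: jones_wenzl.simps)
    also have "tl_comp (tl_comp ?a (tl_comp (tl_comp ?P ?u) (tl_comp ?v ?P))) ?b = tl_comp (tl_comp ?a (tl_comp ?P ?u)) ?b2"
      by (simp only: tl_comp_assoc[OF h(1) Pu vP, symmetric] tl_comp_assoc[OF tl_comp_hom[OF h(1) Pu] vP h(2)])
    finally have "tl_comp ?a ?b = jw_sum [(Suc l, ?a1, ?b1), (k, ?a2, ?b2)]"
      by (simp add: tl_comp_scale_left del: jones_wenzl.simps)
    then show ?thesis
      using 1 2 by (intro exI[of _ "[(Suc l, ?a1, ?b1), (k, ?a2, ?b2)]"]) (simp add: comp del: jones_wenzl.simps jw_sum_simps(2))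
  qed
qed

lemma strand_jw_sum:
  assumes "\<forall>t \<in> set ts. through_jw n t"
  shows "\<exists>us. (\<forall>t \<in> set us. through_jw (Suc n) t) \<and> add_strand n n (jw_sum ts) = jw_sum us"
  using assms
proof (induction ts)
  case Nil
  show ?case by (rule exI[of _ "[]"]) simp
next
  case (Cons t ts)
  obtain us where us: "\<forall>t \<in> set us. through_jw (Suc n) t" "add_strand n n (jw_sum ts) = jw_sum us"
    using Cons by auto
  obtain vs where vs: "\<forall>t \<in> set vs. through_jw (Suc n) t" "add_strand n n (factor_comp t) = jw_sum vs"
    using strand_factor[of n t] Cons.prems by auto
  show ?case using us vs by (intro exI[of _ "vs @ us"]) (auto simp: add_strand_add)
qed

lemma identity_jw_sum: "\<exists>ts. (\<forall>t \<in> set ts. through_jw n t) \<and> tl_id n = jw_sum ts"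
proof (induction n)
  case 0
  show ?case
    by (rule exI[of _ "[(0, tl_id 0, tl_id 0)]"]) (simp add: tl_id_hom tl_comp_id_left[OF tl_id_hom])
next
  case (Suc n)
  then obtain ts where "\<forall>t \<in> set ts. through_jw n t" "tl_id n = jw_sum ts" by blast
  then show ?case using strand_jw_sum[of ts n] add_strand_id[of n] by simp
qed

text \<open>
  The last condition is orthonormality, which makes the factors of \<open>ts\<close> the inclusions and projections of a
  biproduct.
\<close>

definition jw_decomposition :: "nat \<Rightarrow> tl_morphism \<Rightarrow> jw_factor list \<Rightarrow> bool" where
  "jw_decomposition n e ts \<longleftrightarrow> (\<forall>t \<in> set ts. through_jw n t) \<and> e = jw_sum ts \<and>
    (\<forall>(k, a, b) \<in> set ts. tl_comp e a = a \<and> tl_comp b e = b) \<and>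
    (\<forall>i < length ts. \<forall>j < length ts. tl_comp (snd (snd (ts ! i))) (fst (snd (ts ! j)))
       = (if i = j then jones_wenzl (fst (ts ! i)) else 0))"

text \<open>
  Cutting all factors down to the image of \<open>e\<close> turns a decomposition of \<open>f\<close> into one of \<open>e f e\<close>.
\<close>

lemma corner_factors:
  assumes ts: "\<forall>t \<in> set ts. through_jw n t" and e: "e \<in> tl_hom n n"
  shows "(\<forall>t \<in> set (map (\<lambda>(k, a, b). (k, tl_comp e a, tl_comp b e)) ts). through_jw n t)"
    and "jw_sum (map (\<lambda>(k, a, b). (k, tl_comp e a, tl_comp b e)) ts) = tl_comp (tl_comp e (jw_sum ts)) e"
proof -
  have 1: "through_jw n (k, tl_comp e a, tl_comp b e) \<and> tl_comp (tl_comp e a) (tl_comp b e) = tl_comp (tl_comp e (tl_comp a b)) e"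
    if "through_jw n (k, a, b)" for k a b
  proof -
    have a: "a \<in> tl_hom k n" "tl_comp a (jones_wenzl k) = a" and b: "b \<in> tl_hom n k" "tl_comp (jones_wenzl k) b = b"
      using that by simp_all
    show ?thesis
      using tl_comp_hom[OF e a(1)] tl_comp_hom[OF b(1) e] tl_comp_assoc[OF e a(1) jones_wenzl_hom] tl_comp_assoc[OF jones_wenzl_hom b(1) e] a b
        tl_comp_assoc[OF tl_comp_hom[OF e a(1)] b(1) e] tl_comp_assoc[OF e a(1) b(1)] by simp
  qed
  show "(\<forall>t \<in> set (map (\<lambda>(k, a, b). (k, tl_comp e a, tl_comp b e)) ts). through_jw n t)"
    using ts 1 by (auto simp del: through_jw.simps)
  show "jw_sum (map (\<lambda>(k, a, b). (k, tl_comp e a, tl_comp b e)) ts) = tl_comp (tl_comp e (jw_sum ts)) e"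
    using ts
  proof (induction ts)
    case (Cons t ts)
    obtain k a b where t: "t = (k, a, b)" by (cases t)
    then have "tl_comp (tl_comp e a) (tl_comp b e) = tl_comp (tl_comp e (tl_comp a b)) e"
      using 1[of k a b] Cons.prems by simp
    then show ?case using Cons by (simp add: t tl_comp_add_left tl_comp_add_right)
  qed simp
qed

lemma jw_sum_comp_zero:
  assumes "\<forall>t \<in> set ts. through_jw n t" "\<forall>u \<in> set us. through_jw n u"
    and zero: "\<forall>(k, a, b) \<in> set ts. \<forall>(k', a', b') \<in> set us. tl_comp b a' = 0"
  shows "tl_comp (jw_sum ts) (jw_sum us) = 0"
proof -
  have "tl_comp (factor_comp t) (factor_comp u) = 0" if "t \<in> set ts" "u \<in> set us" for t u
  proof -
    obtain k a b k' a' b' where tu: "t = (k, a, b)" "u = (k', a', b')" by (cases t; cases u)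
    then have h: "a \<in> tl_hom k n" "b \<in> tl_hom n k" "a' \<in> tl_hom k' n" "b' \<in> tl_hom n k'"
      using assms(1,2) that by fastforce+
    have "tl_comp b a' = 0" using zero that tu by fastforce
    then show ?thesis
      using tl_comp_assoc[OF h(1,2) tl_comp_hom[OF h(3,4)]] tl_comp_assoc[OF h(2-4)] by (simp add: tu)
  qed
  then have "tl_comp (factor_comp t) (jw_sum us) = 0" if "t \<in> set ts" for t
    using that by (induction us) (simp_all add: tl_comp_add_right)
  then show ?thesis by (induction ts) (simp_all add: tl_comp_add_left)
qed

lemma schur_factor:
  assumes t: "through_jw n (k, a, b)" and u: "through_jw n (k', a', b')" and ne: "tl_comp b a' \<noteq> 0"
  obtains c where "k = k'" "c \<noteq> 0" "tl_comp b a' = tl_scale c (jones_wenzl k)"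
proof -
  have h: "b \<in> tl_hom n k" "a' \<in> tl_hom k' n" using t u by simp_all
  have "tl_comp (tl_comp (jones_wenzl k) (tl_comp b a')) (jones_wenzl k') = tl_comp b a'"
    using tl_comp_assoc[OF jones_wenzl_hom h] tl_comp_assoc[OF h jones_wenzl_hom] t u by simp
  then show thesis
    using schur_distinct[OF tl_comp_hom[OF h]] schur_endo[of "tl_comp b a'" k] tl_comp_hom[OF h] ne that
    by (metis tl_scale_simps(1))
qed

text \<open>
  Induction on the number of terms. A nonzero idempotent \<open>e = e e\<close> has a pair of terms with
  \<open>b a' \<noteq> 0\<close>; rescaling gives \<open>B a' = p\<^sub>k\<close>, so \<open>a' B\<close> is an idempotent below \<open>e\<close>. In the complement
  \<open>f = e - a' B\<close> we have \<open>b f = 0\<close>, so cutting the sum down to \<open>f\<close> loses the term that contains \<open>b\<close>.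
\<close>

lemma idempotent_sum_decomposition:
  assumes "e \<in> tl_hom n n" "tl_comp e e = e" "\<forall>t \<in> set ts. through_jw n t" "e = jw_sum ts"
  shows "\<exists>us. jw_decomposition n e us"
  using assms
proof (induction "length ts" arbitrary: e ts rule: less_induct)
  case less
  show ?case
  proof (cases "e = 0")
    case True
    then show ?thesis by (intro exI[of _ "[]"]) (simp add: jw_decomposition_def)
  next
    case False
    note e = less.prems(1,2)
    let ?ts = "map (\<lambda>(k, a, b). (k, tl_comp e a, tl_comp b e)) ts"
    have ts: "\<forall>t \<in> set ?ts. through_jw n t" "jw_sum ?ts = e"
      using corner_factors[OF less.prems(3,1)] less.prems by simp_all
    \<comment> \<open>Otherwise all products of terms vanish, and with them \<open>e = e e\<close>.\<close>
    have "\<not> (\<forall>(k, a, b) \<in> set ?ts. \<forall>(k', a', b') \<in> set ?ts. tl_comp b a' = 0)"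
    proof
      assume "\<forall>(k, a, b) \<in> set ?ts. \<forall>(k', a', b') \<in> set ?ts. tl_comp b a' = 0"
      from jw_sum_comp_zero[OF ts(1) ts(1) this] show False unfolding ts(2) e(2) using False by contradiction
    qed
    then obtain k a b k' a' b' where in_ts: "(k, a, b) \<in> set ?ts" "(k', a', b') \<in> set ?ts" and ne: "tl_comp b a' \<noteq> 0"
      by fast
    obtain c where c: "k = k'" "c \<noteq> 0" "tl_comp b a' = tl_scale c (jones_wenzl k)"
      by (rule schur_factor[OF bspec[OF ts(1) in_ts(1)] bspec[OF ts(1) in_ts(2)] ne])
    define B where "B = tl_scale (inverse c) b"
    have thr: "through_jw n (k, a', B)"
      using bspec[OF ts(1) in_ts(1)] bspec[OF ts(1) in_ts(2)] c(1)
      by (simp add: B_def tl_hom_scale tl_comp_scale_right)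
    then have h: "a' \<in> tl_hom k n" "B \<in> tl_hom n k" "tl_comp (jones_wenzl k) B = B" "tl_comp a' (jones_wenzl k) = a'" by simp_all
    have Ba: "tl_comp B a' = jones_wenzl k"
      using c by (simp add: B_def tl_comp_scale_left tl_scale_scale tl_scale_one)
    have ea: "tl_comp e a' = a'" and be: "tl_comp b e = b"
    proof -
      obtain x where x: "a' = tl_comp e x" "x \<in> tl_hom k n"
        using in_ts(2) less.prems(3) c(1) by fastforce
      then show "tl_comp e a' = a'" using tl_comp_assoc[OF e(1) e(1) x(2)] e(2) by simp
      obtain y where y: "b = tl_comp y e" "y \<in> tl_hom n k"
        using in_ts(1) less.prems(3) by fastforce
      then show "tl_comp b e = b" using tl_comp_assoc[OF y(2) e(1) e(1)] e(2) by simp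
    qed
    have Be: "tl_comp B e = B" by (simp add: B_def tl_comp_scale_left be)
    define f where "f = e - tl_comp a' B"
    have aB: "tl_comp a' B \<in> tl_hom n n" by (rule tl_comp_hom[OF h(1,2)])
    have f: "f \<in> tl_hom n n" unfolding f_def by (rule tl_hom_diff[OF e(1) aB])
    have Bf: "tl_comp B f = 0"
      using tl_comp_assoc[OF h(2,1,2)] by (simp add: f_def tl_comp_diff_right Be Ba h(3))
    have fa: "tl_comp f a' = 0"
      using tl_comp_assoc[OF h(1,2,1)] by (simp add: f_def tl_comp_diff_left ea Ba h(4))
    have ef: "tl_comp e f = f" and fe: "tl_comp f e = f"
      using tl_comp_assoc[OF e(1) h(1,2)] tl_comp_assoc[OF h(1,2) e(1)] e(2)
      by (simp_all add: f_def tl_comp_diff_left tl_comp_diff_right ea Be)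
    have faB: "tl_comp f (tl_comp a' B) = 0" using tl_comp_assoc[OF f h(1,2)] fa by simp
    have ff: "tl_comp f f = f"
    proof -
      have "tl_comp f f = tl_comp f (e - tl_comp a' B)" by (simp add: f_def)
      also have "\<dots> = f" by (simp only: tl_comp_diff_right fe faB) simp
      finally show ?thesis .
    qed
    obtain us vs where split: "?ts = us @ (k, a, b) # vs" using in_ts(1) by (meson split_list)
    \<comment> \<open>Cutting down to \<open>f\<close> kills the term of \<open>b\<close>, which can be removed from the list.\<close>
    let ?cut = "map (\<lambda>(k, a, b). (k, tl_comp f a, tl_comp b f))"
    have bf: "tl_comp b f = 0"
      using Bf c(2) by (simp add: B_def tl_comp_scale_left)
        (metis tl_scale_scale tl_scale_one tl_scale_zero_right right_inverse)
    have "jw_sum (?cut ?ts) = tl_comp (tl_comp f e) f" using corner_factors(2)[OF ts(1) f] ts(2) by simp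
    also have "\<dots> = f" by (simp only: fe ff)
    finally have "f = jw_sum (?cut (us @ vs))" by (simp add: split bf)
    moreover have "\<forall>t \<in> set (?cut (us @ vs)). through_jw n t"
      using ts(1) by (intro corner_factors(1)[OF _ f]) (simp add: split)
    moreover have "length (?cut (us @ vs)) < length ts"
    proof -
      have "length ts = length (us @ (k, a, b) # vs)" using split by (metis length_map)
      then show ?thesis by simp
    qed
    ultimately obtain ws where ws: "jw_decomposition n f ws"
      using less.hyps[of "?cut (us @ vs)" f] f ff by blast
    have wsf: "tl_comp f x = x \<and> tl_comp y f = y \<and> x \<in> tl_hom l n \<and> y \<in> tl_hom n l" if "(l, x, y) \<in> set ws" for l x y
      using ws that unfolding jw_decomposition_def by fastforce
    have "jw_decomposition n e ((k, a', B) # ws)"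
      unfolding jw_decomposition_def
    proof (intro conjI)
      show "\<forall>t \<in> set ((k, a', B) # ws). through_jw n t"
        using thr ws by (simp add: jw_decomposition_def del: through_jw.simps)
      have "f = jw_sum ws" using ws by (simp add: jw_decomposition_def)
      then show "e = jw_sum ((k, a', B) # ws)" by (simp add: f_def algebra_simps)
      have "tl_comp e x = x \<and> tl_comp y e = y" if "(l, x, y) \<in> set ws" for l x y
        using wsf[OF that] tl_comp_assoc[OF e(1) f, of x l] tl_comp_assoc[OF _ f e(1), of y l] ef fe by auto
      then show "\<forall>(k, a, b) \<in> set ((k, a', B) # ws). tl_comp e a = a \<and> tl_comp b e = b"
        using ea Be by auto
      have cross: "tl_comp B x = 0" "tl_comp y a' = 0" if "(l, x, y) \<in> set ws" for l x y
      proof -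
        have w: "tl_comp f x = x" "tl_comp y f = y" "x \<in> tl_hom l n" "y \<in> tl_hom n l" using wsf[OF that] by simp_all
        show "tl_comp B x = 0" using tl_comp_assoc[OF h(2) f w(3)] w(1) Bf by simp
        show "tl_comp y a' = 0" using tl_comp_assoc[OF w(4) f h(1)] w(2) fa by simp
      qed
      have orth: "\<forall>i < length ws. \<forall>j < length ws. tl_comp (snd (snd (ws ! i))) (fst (snd (ws ! j)))
       = (if i = j then jones_wenzl (fst (ws ! i)) else 0)"
        using ws unfolding jw_decomposition_def by blast
      have cross': "tl_comp B (fst (snd (ws ! i))) = 0" "tl_comp (snd (snd (ws ! i))) a' = 0" if "i < length ws" for i
        using cross[of "fst (ws ! i)" "fst (snd (ws ! i))" "snd (snd (ws ! i))"] nth_mem[OF that] by simp_all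
      show "\<forall>i < length ((k, a', B) # ws). \<forall>j < length ((k, a', B) # ws).
        tl_comp (snd (snd (((k, a', B) # ws) ! i))) (fst (snd (((k, a', B) # ws) ! j)))
         = (if i = j then jones_wenzl (fst (((k, a', B) # ws) ! i)) else 0)"
      proof (intro allI impI)
        fix i j assume "i < length ((k, a', B) # ws)" "j < length ((k, a', B) # ws)"
        then show "tl_comp (snd (snd (((k, a', B) # ws) ! i))) (fst (snd (((k, a', B) # ws) ! j)))
         = (if i = j then jones_wenzl (fst (((k, a', B) # ws) ! i)) else 0)"
          using orth cross' Ba by (cases i; cases j) auto
      qed
    qed
    then show ?thesis by blast
  qed
qed

lemma idempotent_decomposition:
  assumes e: "e \<in> tl_hom n n" "tl_comp e e = e"
  shows "\<exists>ts. jw_decomposition n e ts"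
proof -
  obtain ts where ts: "\<forall>t \<in> set ts. through_jw n t" "tl_id n = jw_sum ts" using identity_jw_sum by blast
  let ?ts = "map (\<lambda>(k, a, b). (k, tl_comp e a, tl_comp b e)) ts"
  have "\<forall>t \<in> set ?ts. through_jw n t" by (rule corner_factors(1)[OF ts(1) e(1)])
  moreover have "e = jw_sum ?ts"
    using corner_factors(2)[OF ts(1) e(1)] tl_comp_id_right[OF e(1)] e(2) by (simp add: ts(2)[symmetric])
  ultimately show ?thesis using idempotent_sum_decomposition[OF e] by blast
qed

section \<open>Karoubi envelopes and biproducts\<close>

lemma sum_fun_apply: "(\<Sum>i \<in> A. f i) x = (\<Sum>i \<in> A. f i x)"
  by (induction A rule: infinite_finite_induct) simp_all

lemma sum_lessThan_add:
  fixes f :: "nat \<Rightarrow> 'a::comm_monoid_add"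
  shows "(\<Sum>i < m + n. f i) = (\<Sum>i < m. f i) + (\<Sum>i < n. f (m + i))"
  by (induction n) (simp_all add: add.assoc)

lemma is_biproductI:
  assumes "set xs \<subseteq> Obj C" "z \<in> Obj C"
    and "\<And>i. i < length xs \<Longrightarrow> \<iota> i \<in> Hom C (xs ! i) z" "\<And>i. i < length xs \<Longrightarrow> \<pi> i \<in> Hom C z (xs ! i)"
    and "\<And>i j. i < length xs \<Longrightarrow> j < length xs \<Longrightarrow>
      Comp C (xs ! j) z (xs ! i) (\<pi> i) (\<iota> j) = (if i = j then Ident C (xs ! i) else 0)"
    and "(\<Sum>i < length xs. Comp C z (xs ! i) z (\<iota> i) (\<pi> i)) = Ident C z"
  shows "is_biproduct C xs z"
  unfolding is_biproduct_def using assms by (intro conjI exI[of _ \<iota>] exI[of _ \<pi>]) simp_all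

context linear_category
begin

lemma comp_zero_right:
  assumes "x \<in> Obj C" "y \<in> Obj C" "z \<in> Obj C" "g \<in> Hom C y z"
  shows "Comp C x y z g 0 = 0"
  using comp_add_right[OF assms(1-3) hom_zero hom_zero assms(4)] assms by simp

lemma comp_zero_left:
  assumes "x \<in> Obj C" "y \<in> Obj C" "z \<in> Obj C" "f \<in> Hom C x y"
  shows "Comp C x y z 0 f = 0"
  using comp_add_left[OF assms(1-4) hom_zero hom_zero] assms by simp

lemma scale_zero:
  assumes "x \<in> Obj C"
  shows "Scale C a 0 = 0"
  using scale_add_right[OF assms assms hom_zero hom_zero, of a] assms by simp

lemma hom_sum:
  assumes "x \<in> Obj C" "y \<in> Obj C" "\<And>i. i \<in> A \<Longrightarrow> f i \<in> Hom C x y"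
  shows "(\<Sum>i \<in> A. f i) \<in> Hom C x y"
  using assms(3) by (induction A rule: infinite_finite_induct) (simp_all add: hom_zero hom_add assms(1,2))

lemma comp_sum_right:
  assumes "x \<in> Obj C" "y \<in> Obj C" "z \<in> Obj C" "g \<in> Hom C y z" "\<And>i. i \<in> A \<Longrightarrow> f i \<in> Hom C x y"
  shows "Comp C x y z g (\<Sum>i \<in> A. f i) = (\<Sum>i \<in> A. Comp C x y z g (f i))"
  using assms(5)
  by (induction A rule: infinite_finite_induct)
    (simp_all add: comp_zero_right comp_add_right hom_sum assms(1-4))

lemma comp_sum_left:
  assumes "x \<in> Obj C" "y \<in> Obj C" "z \<in> Obj C" "f \<in> Hom C x y" "\<And>i. i \<in> A \<Longrightarrow> g i \<in> Hom C y z"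
  shows "Comp C x y z (\<Sum>i \<in> A. g i) f = (\<Sum>i \<in> A. Comp C x y z (g i) f)"
  using assms(5)
  by (induction A rule: infinite_finite_induct)
    (simp_all add: comp_zero_left comp_add_left hom_sum assms(1-4))

lemma comp_sum_middle:
  assumes "w \<in> Obj C" "x \<in> Obj C" "y \<in> Obj C" "z \<in> Obj C" "h \<in> Hom C y z" "f \<in> Hom C w x"
    and g: "\<And>i. i \<in> A \<Longrightarrow> g i \<in> Hom C x y"
  shows "(\<Sum>i \<in> A. Comp C w y z h (Comp C w x y (g i) f)) = Comp C w y z h (Comp C w x y (\<Sum>i \<in> A. g i) f)"
proof -
  have "Comp C w x y (\<Sum>i \<in> A. g i) f = (\<Sum>i \<in> A. Comp C w x y (g i) f)"
    by (rule comp_sum_left) (use assms in simp_all)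
  moreover have "Comp C w y z h (\<Sum>i \<in> A. Comp C w x y (g i) f) = (\<Sum>i \<in> A. Comp C w y z h (Comp C w x y (g i) f))"
    by (rule comp_sum_right) (use assms in \<open>simp_all add: comp_hom\<close>)
  ultimately show ?thesis by simp
qed

lemma scale_sum:
  assumes "x \<in> Obj C" "y \<in> Obj C" "\<And>i. i \<in> A \<Longrightarrow> f i \<in> Hom C x y"
  shows "Scale C a (\<Sum>i \<in> A. f i) = (\<Sum>i \<in> A. Scale C a (f i))"
  using assms(3)
  by (induction A rule: infinite_finite_induct)
    (simp_all add: scale_zero[OF assms(1)] scale_add_right[OF assms(1,2)] hom_sum[OF assms(1,2)])

lemma Kar_simps:
  "(a, p) \<in> Obj (Kar C) \<longleftrightarrow> a \<in> Obj C \<and> p \<in> Hom C a a \<and> Comp C a a a p p = p"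
  "f \<in> Hom (Kar C) (a, p) (b, r) \<longleftrightarrow> f \<in> Hom C a b \<and> Comp C a a b f p = f \<and> Comp C a b b r f = f"
  "Comp (Kar C) (a, p) (b, r) (c, s) = Comp C a b c"
  "Ident (Kar C) (a, p) = p"
  "Scale (Kar C) = Scale C"
  by (simp_all add: Kar_def)

text \<open>
  All axioms but those on identities are inherited; the identity of \<open>p\<close> is \<open>p\<close>, by the definition of morphisms.
\<close>

lemma linear_category_Kar: "linear_category (Kar C)"
proof (unfold_locales, goal_cases)
  case (1 x y)
  then show ?case by (cases x; cases y) (simp add: Kar_simps hom_zero comp_zero_left comp_zero_right)
next
  case (2 x y f g)
  then show ?case by (cases x; cases y) (simp add: Kar_simps hom_add comp_add_left comp_add_right)
next
  case (3 x y f a)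
  then show ?case by (cases x; cases y) (simp add: Kar_simps hom_scale comp_scale_left comp_scale_right)
next
  case (4 x y f g a)
  then show ?case using scale_add_right[of "fst x" "fst y" f g] by (cases x; cases y) (simp add: Kar_simps)
next
  case (5 x y f a b)
  then show ?case using scale_add_left[of "fst x" "fst y" f] by (cases x; cases y) (simp add: Kar_simps)
next
  case (6 x y f a b)
  then show ?case using scale_scale[of "fst x" "fst y" f] by (cases x; cases y) (simp add: Kar_simps)
next
  case (7 x y f)
  then show ?case using scale_one[of "fst x" "fst y" f] by (cases x; cases y) (simp add: Kar_simps)
next
  case (8 x)
  then show ?case by (cases x) (simp add: Kar_simps)
next
  case (9 x y z f g)
  obtain a p b r c s where "x = (a, p)" "y = (b, r)" "z = (c, s)" by (cases x; cases y; cases z)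
  with 9 show ?case
    using comp_assoc[of a a b c p f g] comp_assoc[of a b c c f g s] by (simp add: Kar_simps comp_hom)
next
  case (10 x y f)
  then show ?case by (cases x; cases y) (simp add: Kar_simps)
next
  case (11 x y f)
  then show ?case by (cases x; cases y) (simp add: Kar_simps)
next
  case (12 w x y z f g h)
  then show ?case by (cases w; cases x; cases y; cases z) (simp add: Kar_simps comp_assoc)
next
  case (13 x y z f f' g)
  then show ?case by (cases x; cases y; cases z) (simp add: Kar_simps comp_add_right)
next
  case (14 x y z f g g')
  then show ?case by (cases x; cases y; cases z) (simp add: Kar_simps comp_add_left)
next
  case (15 x y z f g a)
  then show ?case by (cases x; cases y; cases z) (simp add: Kar_simps comp_scale_right)
next
  case (16 x y z f g a)
  then show ?case by (cases x; cases y; cases z) (simp add: Kar_simps comp_scale_left)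
qed

text \<open>
  The witnesses of \<open>is_biproduct\<close>, named so that they can be obtained together.
\<close>

definition biproduct_data :: "'o list \<Rightarrow> 'o \<Rightarrow> (nat \<Rightarrow> 'm) \<Rightarrow> (nat \<Rightarrow> 'm) \<Rightarrow> bool" where
  "biproduct_data xs z \<iota> \<pi> \<longleftrightarrow> set xs \<subseteq> Obj C \<and> z \<in> Obj C \<and>
     (\<forall>i < length xs. \<iota> i \<in> Hom C (xs ! i) z \<and> \<pi> i \<in> Hom C z (xs ! i)) \<and>
     (\<forall>i < length xs. \<forall>j < length xs.
        Comp C (xs ! j) z (xs ! i) (\<pi> i) (\<iota> j) = (if i = j then Ident C (xs ! i) else 0)) \<and>
     (\<Sum>i < length xs. Comp C z (xs ! i) z (\<iota> i) (\<pi> i)) = Ident C z"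

lemma is_biproduct_iff: "is_biproduct C xs z \<longleftrightarrow> (\<exists>\<iota> \<pi>. biproduct_data xs z \<iota> \<pi>)"
  unfolding is_biproduct_def biproduct_data_def by blast

lemma biproduct_dataD:
  assumes "biproduct_data xs z \<iota> \<pi>"
  shows "set xs \<subseteq> Obj C" "z \<in> Obj C"
    and "\<And>i. i < length xs \<Longrightarrow> \<iota> i \<in> Hom C (xs ! i) z" "\<And>i. i < length xs \<Longrightarrow> \<pi> i \<in> Hom C z (xs ! i)"
    and "\<And>i j. i < length xs \<Longrightarrow> j < length xs \<Longrightarrow>
      Comp C (xs ! j) z (xs ! i) (\<pi> i) (\<iota> j) = (if i = j then Ident C (xs ! i) else 0)"
    and "(\<Sum>i < length xs. Comp C z (xs ! i) z (\<iota> i) (\<pi> i)) = Ident C z"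
  using assms unfolding biproduct_data_def by blast+

lemma biproduct_singleton:
  assumes "x \<in> Obj C"
  shows "is_biproduct C [x] x"
  by (rule is_biproductI[where \<iota> = "\<lambda>_. Ident C x" and \<pi> = "\<lambda>_. Ident C x"])
    (use assms in \<open>simp_all add: ident_hom comp_ident_left\<close>)

text \<open>
  Inclusions and projections are composed with those of \<open>x\<close> and \<open>y\<close> in \<open>z\<close>.
\<close>

lemma biproduct_append:
  assumes xs: "is_biproduct C xs x" and ys: "is_biproduct C ys y" and z: "is_biproduct C [x, y] z"
  shows "is_biproduct C (xs @ ys) z"
proof -
  obtain \<iota>1 \<pi>1 where "biproduct_data xs x \<iota>1 \<pi>1"
    using xs is_biproduct_iff by blast
  note x = biproduct_dataD[OF this]
  obtain \<iota>2 \<pi>2 where "biproduct_data ys y \<iota>2 \<pi>2"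
    using ys is_biproduct_iff by blast
  note y = biproduct_dataD[OF this]
  obtain \<kappa> \<rho> where "biproduct_data [x, y] z \<kappa> \<rho>"
    using z is_biproduct_iff by blast
  note z = biproduct_dataD(2-6)[OF this]
  have k: "\<kappa> 0 \<in> Hom C x z" "\<kappa> 1 \<in> Hom C y z" and r: "\<rho> 0 \<in> Hom C z x" "\<rho> 1 \<in> Hom C z y"
    using z(2)[of 0] z(2)[of 1] z(3)[of 0] z(3)[of 1] by simp_all
  have rk: "Comp C x z x (\<rho> 0) (\<kappa> 0) = Ident C x" "Comp C y z y (\<rho> 1) (\<kappa> 1) = Ident C y"
    "Comp C y z x (\<rho> 0) (\<kappa> 1) = 0" "Comp C x z y (\<rho> 1) (\<kappa> 0) = 0"
    using z(4)[of 0 0] z(4)[of 1 1] z(4)[of 0 1] z(4)[of 1 0] by simp_all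
  note rk = rk rk[unfolded One_nat_def]
  have one: "Comp C z x z (\<kappa> 0) (\<rho> 0) + Comp C z y z (\<kappa> 1) (\<rho> 1) = Ident C z"
    using z(5) by (simp add: numeral_2_eq_2)
  have xo: "xs ! i \<in> Obj C" if "i < length xs" for i using x(1) that by auto
  have yo: "ys ! i \<in> Obj C" if "i < length ys" for i using y(1) that by auto
  have mid: "Comp C a z b (Comp C z v b q (\<rho>')) (Comp C a u z (\<kappa>') p) = Comp C a v b q (Comp C a u v (Comp C u z v \<rho>' \<kappa>') p)"
    if "a \<in> Obj C" "b \<in> Obj C" "u \<in> Obj C" "v \<in> Obj C" "q \<in> Hom C v b" "\<rho>' \<in> Hom C z v" "\<kappa>' \<in> Hom C u z" "p \<in> Hom C a u"
    for a b u v q \<rho>' \<kappa>' p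
    using that z(1) by (simp add: comp_assoc comp_hom)
  have outer: "Comp C z a z (Comp C a u z \<kappa>' p) (Comp C z u a q \<rho>') = Comp C z u z \<kappa>' (Comp C z u u (Comp C u a u p q) \<rho>')"
    if "a \<in> Obj C" "u \<in> Obj C" "q \<in> Hom C u a" "\<rho>' \<in> Hom C z u" "\<kappa>' \<in> Hom C u z" "p \<in> Hom C a u"
    for a u q \<rho>' \<kappa>' p
    using that z(1) by (simp add: comp_assoc comp_hom)
  let ?n = "length xs"
  \<comment> \<open>Indices below \<open>?n\<close> go through \<open>x\<close>, the others through \<open>y\<close>.\<close>
  let ?\<iota> = "\<lambda>i. if i < ?n then Comp C (xs ! i) x z (\<kappa> 0) (\<iota>1 i) else Comp C (ys ! (i - ?n)) y z (\<kappa> 1) (\<iota>2 (i - ?n))"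
  let ?\<pi> = "\<lambda>i. if i < ?n then Comp C z x (xs ! i) (\<pi>1 i) (\<rho> 0) else Comp C z y (ys ! (i - ?n)) (\<pi>2 (i - ?n)) (\<rho> 1)"
  show ?thesis
  proof (rule is_biproductI[where \<iota> = ?\<iota> and \<pi> = ?\<pi>])
    show "set (xs @ ys) \<subseteq> Obj C" using x(1) y(1) by simp
    show "z \<in> Obj C" by (rule z(1))
    fix i assume i: "i < length (xs @ ys)"
    show "?\<iota> i \<in> Hom C ((xs @ ys) ! i) z"
      using i x y z(1) k xo yo by (auto simp: nth_append intro!: comp_hom)
    show "?\<pi> i \<in> Hom C z ((xs @ ys) ! i)"
      using i x y z(1) r xo yo by (auto simp: nth_append intro!: comp_hom)
    fix j assume j: "j < length (xs @ ys)"
    show "Comp C ((xs @ ys) ! j) z ((xs @ ys) ! i) (?\<pi> i) (?\<iota> j) = (if i = j then Ident C ((xs @ ys) ! i) else 0)"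
    proof (cases "i < ?n")
      case i': True
      show ?thesis
      proof (cases "j < ?n")
        case True
        then show ?thesis
          using i' mid[OF xo[OF True] xo[OF i'] x(2) x(2) x(4)[OF i'] r(1) k(1) x(3)[OF True]] x(5)[OF i' True]
          by (simp add: nth_append rk comp_ident_left x(2) xo x(3))
      next
        case False
        then have j': "j - ?n < length ys" using j by simp
        show ?thesis
          using False i' mid[OF yo[OF j'] xo[OF i'] y(2) x(2) x(4)[OF i'] r(1) k(2) y(3)[OF j']]
          by (auto simp: nth_append rk comp_zero_left comp_zero_right x(2) y(2) xo yo j' x(4) y(3))
      qed
    next
      case False
      then have i': "i - ?n < length ys" using i by simp
      show ?thesis
      proof (cases "j < ?n")
        case True
        then show ?thesis
          using False i' mid[OF xo[OF True] yo[OF i'] x(2) y(2) y(4)[OF i'] r(2) k(1) x(3)[OF True]]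
          by (auto simp: nth_append rk comp_zero_left comp_zero_right x(2) y(2) xo yo x(3) y(4))
      next
        case Fj: False
        then have j': "j - ?n < length ys" using j by simp
        show ?thesis
          using False Fj i' mid[OF yo[OF j'] yo[OF i'] y(2) y(2) y(4)[OF i'] r(2) k(2) y(3)[OF j']] y(5)[OF i' j']
          by (auto simp: nth_append rk comp_ident_left y(2) yo y(3) j')
      qed
    qed
  next
    have "(\<Sum>i < length (xs @ ys). Comp C z ((xs @ ys) ! i) z (?\<iota> i) (?\<pi> i))
      = (\<Sum>i < ?n. Comp C z (xs ! i) z (Comp C (xs ! i) x z (\<kappa> 0) (\<iota>1 i)) (Comp C z x (xs ! i) (\<pi>1 i) (\<rho> 0)))
      + (\<Sum>i < length ys. Comp C z (ys ! i) z (Comp C (ys ! i) y z (\<kappa> 1) (\<iota>2 i)) (Comp C z y (ys ! i) (\<pi>2 i) (\<rho> 1)))"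
      by (simp add: sum_lessThan_add nth_append)
    also have "(\<Sum>i < ?n. Comp C z (xs ! i) z (Comp C (xs ! i) x z (\<kappa> 0) (\<iota>1 i)) (Comp C z x (xs ! i) (\<pi>1 i) (\<rho> 0)))
      = (\<Sum>i < ?n. Comp C z x z (\<kappa> 0) (Comp C z x x (Comp C x (xs ! i) x (\<iota>1 i) (\<pi>1 i)) (\<rho> 0)))"
      using x(3,4) r(1) k(1) by (intro sum.cong refl outer xo x(2)) auto
    also have "\<dots> = Comp C z x z (\<kappa> 0) (Comp C z x x (\<Sum>i < ?n. Comp C x (xs ! i) x (\<iota>1 i) (\<pi>1 i)) (\<rho> 0))"
      using x(2-4) z(1) r(1) k(1) xo by (intro comp_sum_middle) (auto intro!: comp_hom)
    also have "\<dots> = Comp C z x z (\<kappa> 0) (\<rho> 0)" using x(2) z(1) r(1) by (simp add: x(6) comp_ident_left)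
    also have "(\<Sum>i < length ys. Comp C z (ys ! i) z (Comp C (ys ! i) y z (\<kappa> 1) (\<iota>2 i)) (Comp C z y (ys ! i) (\<pi>2 i) (\<rho> 1)))
      = (\<Sum>i < length ys. Comp C z y z (\<kappa> 1) (Comp C z y y (Comp C y (ys ! i) y (\<iota>2 i) (\<pi>2 i)) (\<rho> 1)))"
      using y(3,4) r(2) k(2) by (intro sum.cong refl outer yo y(2)) auto
    also have "\<dots> = Comp C z y z (\<kappa> 1) (Comp C z y y (\<Sum>i < length ys. Comp C y (ys ! i) y (\<iota>2 i) (\<pi>2 i)) (\<rho> 1))"
      using y(2-4) z(1) r(2) k(2) yo by (intro comp_sum_middle) (auto intro!: comp_hom)
    also have "\<dots> = Comp C z y z (\<kappa> 1) (\<rho> 1)" using y(2) z(1) r(2) by (simp add: y(6) comp_ident_left)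
    finally show "(\<Sum>i < length (xs @ ys). Comp C z ((xs @ ys) ! i) z (?\<iota> i) (?\<pi> i)) = Ident C z"
      using one by simp
  qed
qed

text \<open>
  The isomorphism goes from one biproduct to the summands and on into the other one; a round trip is
  \<open>\<Sum>\<^sub>i \<iota>\<^sub>i \<pi>\<^sub>i\<close> because the mixed terms vanish.
\<close>

lemma biproduct_unique:
  assumes z: "is_biproduct C xs z" and w: "is_biproduct C xs w"
  shows "isomorphic C z w"
proof -
  obtain \<iota> \<pi> where "biproduct_data xs z \<iota> \<pi>"
    using z is_biproduct_iff by blast
  note z = biproduct_dataD[OF this]
  obtain \<kappa> \<rho> where "biproduct_data xs w \<kappa> \<rho>"
    using w is_biproduct_iff by blast
  note w = biproduct_dataD(2-6)[OF this]
  have xo: "xs ! i \<in> Obj C" if "i < length xs" for i using z(1) that by auto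
  have roundtrip: "Comp C u v u (\<Sum>i < length xs. Comp C v (xs ! i) u (\<alpha> i) (\<delta> i)) (\<Sum>i < length xs. Comp C u (xs ! i) v (\<gamma> i) (\<beta> i)) = Ident C u"
    if u: "u \<in> Obj C" and v: "v \<in> Obj C"
      and a: "\<And>i. i < length xs \<Longrightarrow> \<alpha> i \<in> Hom C (xs ! i) u" and b: "\<And>i. i < length xs \<Longrightarrow> \<beta> i \<in> Hom C u (xs ! i)"
      and g: "\<And>i. i < length xs \<Longrightarrow> \<gamma> i \<in> Hom C (xs ! i) v" and d: "\<And>i. i < length xs \<Longrightarrow> \<delta> i \<in> Hom C v (xs ! i)"
      and dg: "\<And>i j. i < length xs \<Longrightarrow> j < length xs \<Longrightarrow>
        Comp C (xs ! j) v (xs ! i) (\<delta> i) (\<gamma> j) = (if i = j then Ident C (xs ! i) else 0)"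
      and ab: "(\<Sum>i < length xs. Comp C u (xs ! i) u (\<alpha> i) (\<beta> i)) = Ident C u"
    for u v \<alpha> \<beta> \<gamma> \<delta>
  proof -
    have "Comp C u v u (\<Sum>i < length xs. Comp C v (xs ! i) u (\<alpha> i) (\<delta> i)) (\<Sum>j < length xs. Comp C u (xs ! j) v (\<gamma> j) (\<beta> j))
      = (\<Sum>i < length xs. \<Sum>j < length xs. Comp C u v u (Comp C v (xs ! i) u (\<alpha> i) (\<delta> i)) (Comp C u (xs ! j) v (\<gamma> j) (\<beta> j)))"
    proof -
      have F: "Comp C v (xs ! i) u (\<alpha> i) (\<delta> i) \<in> Hom C v u" "Comp C u (xs ! i) v (\<gamma> i) (\<beta> i) \<in> Hom C u v"
        if "i \<in> {..<length xs}" for i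
        using that u v xo a b g d by (auto intro!: comp_hom)
      note F2 = hom_sum[OF u v F(2), of "{..<length xs}"]
      have "Comp C u v u (\<Sum>i < length xs. Comp C v (xs ! i) u (\<alpha> i) (\<delta> i)) (\<Sum>j < length xs. Comp C u (xs ! j) v (\<gamma> j) (\<beta> j))
        = (\<Sum>i < length xs. Comp C u v u (Comp C v (xs ! i) u (\<alpha> i) (\<delta> i)) (\<Sum>j < length xs. Comp C u (xs ! j) v (\<gamma> j) (\<beta> j)))"
        by (rule comp_sum_left[OF u v u F2 F(1)])
      also have "\<dots> = (\<Sum>i < length xs. \<Sum>j < length xs. Comp C u v u (Comp C v (xs ! i) u (\<alpha> i) (\<delta> i)) (Comp C u (xs ! j) v (\<gamma> j) (\<beta> j)))"
        by (intro sum.cong refl comp_sum_right[OF u v u F(1) F(2)])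
      finally show ?thesis .
    qed
    also have "\<dots> = (\<Sum>i < length xs. \<Sum>j < length xs. if i = j then Comp C u (xs ! i) u (\<alpha> i) (\<beta> i) else 0)"
    proof (intro sum.cong refl)
      fix i j assume "i \<in> {..<length xs}" "j \<in> {..<length xs}"
      then have i: "i < length xs" and j: "j < length xs" by simp_all
      have "Comp C u v u (Comp C v (xs ! i) u (\<alpha> i) (\<delta> i)) (Comp C u (xs ! j) v (\<gamma> j) (\<beta> j))
        = Comp C u (xs ! i) u (\<alpha> i) (Comp C u (xs ! j) (xs ! i) (Comp C (xs ! j) v (xs ! i) (\<delta> i) (\<gamma> j)) (\<beta> j))"
        using u v xo[OF i] xo[OF j] a[OF i] b[OF j] g[OF j] d[OF i] by (simp add: comp_assoc comp_hom)
      also have "\<dots> = (if i = j then Comp C u (xs ! i) u (\<alpha> i) (\<beta> i) else 0)"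
        using u xo[OF i] xo[OF j] a[OF i] b[OF j] dg[OF i j] by (auto simp: comp_ident_left comp_zero_left comp_zero_right)
      finally show "Comp C u v u (Comp C v (xs ! i) u (\<alpha> i) (\<delta> i)) (Comp C u (xs ! j) v (\<gamma> j) (\<beta> j))
        = (if i = j then Comp C u (xs ! i) u (\<alpha> i) (\<beta> i) else 0)" .
    qed
    also have "\<dots> = Ident C u" by (simp add: ab)
    finally show ?thesis .
  qed
  have "(\<Sum>i < length xs. Comp C z (xs ! i) w (\<kappa> i) (\<pi> i)) \<in> Hom C z w"
    "(\<Sum>i < length xs. Comp C w (xs ! i) z (\<iota> i) (\<rho> i)) \<in> Hom C w z"
    using z(2-4) w(1-3) xo by (auto intro!: hom_sum comp_hom)
  then show ?thesis
    unfolding isomorphic_def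
    using z(2) w(1) roundtrip[OF z(2) w(1) z(3,4) w(2,3) w(4) z(6)] roundtrip[OF w(1) z(2) w(2,3) z(3,4) z(5) w(5)] by blast
qed

end

section \<open>Additive completions\<close>

context linear_category
begin

lemma Mat_Obj: "xs \<in> Obj (Mat C) \<longleftrightarrow> set xs \<subseteq> Obj C"
  by (simp add: Mat_def)

lemma Mat_Obj_nth: "xs \<in> Obj (Mat C) \<Longrightarrow> i < length xs \<Longrightarrow> xs ! i \<in> Obj C"
  by (auto simp: Mat_def)

lemma Mat_Hom: "A \<in> Hom (Mat C) xs ys \<longleftrightarrow>
    (\<forall>i < length ys. \<forall>j < length xs. A i j \<in> Hom C (xs ! j) (ys ! i)) \<and>
    (\<forall>i j. \<not> (i < length ys \<and> j < length xs) \<longrightarrow> A i j = 0)"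
  unfolding Mat_def by auto

lemma Mat_Comp: "Comp (Mat C) xs ys zs B A i k =
    (if i < length zs \<and> k < length xs
     then \<Sum>j < length ys. Comp C (xs ! k) (ys ! j) (zs ! i) (B i j) (A j k) else 0)"
  by (simp add: Mat_def)

lemma Mat_Ident: "Ident (Mat C) xs i j = (if i = j \<and> i < length xs then Ident C (xs ! i) else 0)"
  by (simp add: Mat_def)

lemma Mat_Scale: "Scale (Mat C) a A i j = Scale C a (A i j)"
  by (simp add: Mat_def)

text \<open>
  There must be an object: matrices are extended by zero, and only inside some \<open>Hom\<close> set do the axioms force
  \<open>Scale C a 0 = 0\<close>.
\<close>

lemma linear_category_Mat:
  assumes "Obj C \<noteq> {}"
  shows "linear_category (Mat C)"
proof -
  obtain o' where o': "o' \<in> Obj C" using assms by blast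
  note sz = scale_zero[OF o']
  note nth = Mat_Obj_nth
  show ?thesis
  proof (unfold_locales, goal_cases)
    case (1 x y)
    then show ?case by (auto simp: Mat_Hom hom_zero nth)
  next
    case (2 x y f g)
    then show ?case by (auto simp: Mat_Hom hom_add nth)
  next
    case (3 x y f a)
    then show ?case by (auto simp: Mat_Hom Mat_Scale hom_scale nth sz)
  next
    case (4 x y f g a)
    show ?case
    proof (intro ext)
      fix i j show "Scale (Mat C) a (f + g) i j = (Scale (Mat C) a f + Scale (Mat C) a g) i j"
        using 4 scale_add_right[of "x ! j" "y ! i" "f i j" "g i j" a]
        by (cases "i < length y \<and> j < length x") (auto simp: Mat_Hom Mat_Scale nth sz)
    qed
  next
    case (5 x y f a b)
    show ?case
    proof (intro ext)
      fix i j show "Scale (Mat C) (a + b) f i j = (Scale (Mat C) a f + Scale (Mat C) b f) i j"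
        using 5 scale_add_left[of "x ! j" "y ! i" "f i j" a b]
        by (cases "i < length y \<and> j < length x") (auto simp: Mat_Hom Mat_Scale nth sz)
    qed
  next
    case (6 x y f a b)
    show ?case
    proof (intro ext)
      fix i j show "Scale (Mat C) a (Scale (Mat C) b f) i j = Scale (Mat C) (a * b) f i j"
        using 6 scale_scale[of "x ! j" "y ! i" "f i j" a b]
        by (cases "i < length y \<and> j < length x") (auto simp: Mat_Hom Mat_Scale nth sz)
    qed
  next
    case (7 x y f)
    show ?case
    proof (intro ext)
      fix i j show "Scale (Mat C) 1 f i j = f i j"
        using 7 scale_one[of "x ! j" "y ! i" "f i j"]
        by (cases "i < length y \<and> j < length x") (auto simp: Mat_Hom Mat_Scale nth sz)
    qed
  next
    case (8 x)
    then show ?case by (auto simp: Mat_Hom Mat_Ident nth hom_zero ident_hom)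
  next
    case (9 x y z f g)
    then show ?case by (auto simp: Mat_Hom Mat_Comp nth intro!: hom_sum comp_hom)
  next
    case (10 x y f)
    show ?case
    proof (intro ext)
      fix i k show "Comp (Mat C) x x y f (Ident (Mat C) x) i k = f i k"
      proof (cases "i < length y \<and> k < length x")
        case True
        have "(\<Sum>j < length x. Comp C (x ! k) (x ! j) (y ! i) (f i j) (Ident (Mat C) x j k))
          = (\<Sum>j < length x. if j = k then f i k else 0)"
          using 10 True by (intro sum.cong refl) (auto simp: Mat_Ident Mat_Hom nth comp_ident_right comp_zero_right)
        then show ?thesis using True by (simp add: Mat_Comp)
      qed (use 10 in \<open>auto simp: Mat_Hom Mat_Comp\<close>)
    qed
  next
    case (11 x y f)
    show ?case
    proof (intro ext)
      fix i k show "Comp (Mat C) x y y (Ident (Mat C) y) f i k = f i k"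
      proof (cases "i < length y \<and> k < length x")
        case True
        have "(\<Sum>j < length y. Comp C (x ! k) (y ! j) (y ! i) (Ident (Mat C) y i j) (f j k))
          = (\<Sum>j < length y. if j = i then f i k else 0)"
          using 11 True by (intro sum.cong refl) (auto simp: Mat_Ident Mat_Hom nth comp_ident_left comp_zero_left)
        then show ?thesis using True by (simp add: Mat_Comp)
      qed (use 11 in \<open>auto simp: Mat_Hom Mat_Comp\<close>)
    qed
  next
    case (12 w x y z f g h)
    show ?case
    proof (intro ext)
      fix i k
      show "Comp (Mat C) w x z (Comp (Mat C) x y z h g) f i k = Comp (Mat C) w y z h (Comp (Mat C) w x y g f) i k"
      proof (cases "i < length z \<and> k < length w")
        case True
        have o: "w ! k \<in> Obj C" "z ! i \<in> Obj C" "\<And>j. j < length x \<Longrightarrow> x ! j \<in> Obj C" "\<And>l. l < length y \<Longrightarrow> y ! l \<in> Obj C"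
          using 12 True nth by blast+
        have hom: "f j k \<in> Hom C (w ! k) (x ! j)" "g l j \<in> Hom C (x ! j) (y ! l)" "h i l \<in> Hom C (y ! l) (z ! i)"
          if "j < length x" "l < length y" for j l
          using 12(5-7) True that by (simp_all add: Mat_Hom)
        have fh: "f j k \<in> Hom C (w ! k) (x ! j)" if "j < length x" for j using 12(5) True that by (simp add: Mat_Hom)
        have hh: "h i l \<in> Hom C (y ! l) (z ! i)" if "l < length y" for l using 12(7) True that by (simp add: Mat_Hom)
        have "Comp (Mat C) w x z (Comp (Mat C) x y z h g) f i k
          = (\<Sum>j < length x. Comp C (w ! k) (x ! j) (z ! i) (\<Sum>l < length y. Comp C (x ! j) (y ! l) (z ! i) (h i l) (g l j)) (f j k))"
          using True by (simp add: Mat_Comp)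
        also have "\<dots> = (\<Sum>j < length x. \<Sum>l < length y. Comp C (w ! k) (x ! j) (z ! i) (Comp C (x ! j) (y ! l) (z ! i) (h i l) (g l j)) (f j k))"
          by (intro sum.cong refl comp_sum_left) (auto intro!: comp_hom o fh hom)
        also have "\<dots> = (\<Sum>j < length x. \<Sum>l < length y. Comp C (w ! k) (y ! l) (z ! i) (h i l) (Comp C (w ! k) (x ! j) (y ! l) (g l j) (f j k)))"
          by (intro sum.cong refl comp_assoc) (auto intro: o fh hom)
        also have "\<dots> = (\<Sum>l < length y. \<Sum>j < length x. Comp C (w ! k) (y ! l) (z ! i) (h i l) (Comp C (w ! k) (x ! j) (y ! l) (g l j) (f j k)))"
          by (rule sum.swap)
        also have "\<dots> = (\<Sum>l < length y. Comp C (w ! k) (y ! l) (z ! i) (h i l) (\<Sum>j < length x. Comp C (w ! k) (x ! j) (y ! l) (g l j) (f j k)))"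
          by (intro sum.cong refl comp_sum_right[symmetric]) (auto intro!: comp_hom o hh hom)
        also have "\<dots> = Comp (Mat C) w y z h (Comp (Mat C) w x y g f) i k"
          using True by (simp add: Mat_Comp)
        finally show ?thesis .
      qed (auto simp: Mat_Comp)
    qed
  next
    case (13 x y z f f' g)
    show ?case
      using 13 by (intro ext) (auto simp: Mat_Comp Mat_Hom nth comp_add_right sum.distrib[symmetric] intro!: sum.cong)
  next
    case (14 x y z f g g')
    show ?case
      using 14 by (intro ext) (auto simp: Mat_Comp Mat_Hom nth comp_add_left sum.distrib[symmetric] intro!: sum.cong)
  next
    case (15 x y z f g a)
    show ?case
    proof (intro ext)
      fix i k show "Comp (Mat C) x y z g (Scale (Mat C) a f) i k = Scale (Mat C) a (Comp (Mat C) x y z g f) i k"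
      proof (cases "i < length z \<and> k < length x")
        case True
        then have o: "x ! k \<in> Obj C" "z ! i \<in> Obj C" using 15 nth by auto
        have "Scale C a (\<Sum>j < length y. Comp C (x ! k) (y ! j) (z ! i) (g i j) (f j k))
          = (\<Sum>j < length y. Scale C a (Comp C (x ! k) (y ! j) (z ! i) (g i j) (f j k)))"
          using True 15 by (intro scale_sum[OF o] comp_hom o) (auto simp: Mat_Hom nth)
        then show ?thesis
          using True 15 o by (auto simp: Mat_Comp Mat_Scale Mat_Hom nth comp_scale_right)
      qed (auto simp: Mat_Comp Mat_Scale sz)
    qed
  next
    case (16 x y z f g a)
    show ?case
    proof (intro ext)
      fix i k show "Comp (Mat C) x y z (Scale (Mat C) a g) f i k = Scale (Mat C) a (Comp (Mat C) x y z g f) i k"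
      proof (cases "i < length z \<and> k < length x")
        case True
        then have o: "x ! k \<in> Obj C" "z ! i \<in> Obj C" using 16 nth by auto
        have "Scale C a (\<Sum>j < length y. Comp C (x ! k) (y ! j) (z ! i) (g i j) (f j k))
          = (\<Sum>j < length y. Scale C a (Comp C (x ! k) (y ! j) (z ! i) (g i j) (f j k)))"
          using True 16 by (intro scale_sum[OF o] comp_hom o) (auto simp: Mat_Hom nth)
        then show ?thesis
          using True 16 o by (auto simp: Mat_Comp Mat_Scale Mat_Hom nth comp_scale_left)
      qed (auto simp: Mat_Comp Mat_Scale sz)
    qed
  qed
qed

text \<open>
  The inclusion of a formal direct sum \<open>us\<close> as the summands with indices from \<open>a\<close> on.
\<close>

definition inclusion :: "nat \<Rightarrow> 'o list \<Rightarrow> nat \<Rightarrow> nat \<Rightarrow> 'm" where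
  "inclusion a us = (\<lambda>i j. if i = a + j \<and> j < length us then Ident C (us ! j) else 0)"

definition projection :: "nat \<Rightarrow> 'o list \<Rightarrow> nat \<Rightarrow> nat \<Rightarrow> 'm" where
  "projection a us = (\<lambda>i j. if j = a + i \<and> i < length us then Ident C (us ! i) else 0)"

definition segment :: "nat \<Rightarrow> 'o list \<Rightarrow> 'o list \<Rightarrow> bool" where
  "segment a us zs \<longleftrightarrow> (\<forall>j < length us. a + j < length zs \<and> zs ! (a + j) = us ! j)"

lemma inclusion_hom:
  assumes "segment a us zs" "us \<in> Obj (Mat C)" "zs \<in> Obj (Mat C)"
  shows "inclusion a us \<in> Hom (Mat C) us zs" "projection a us \<in> Hom (Mat C) zs us"
  using assms by (auto simp: Mat_Hom inclusion_def projection_def segment_def Mat_Obj_nth ident_hom hom_zero)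

lemma projection_inclusion:
  assumes us: "segment a us zs" "us \<in> Obj (Mat C)" and vs: "segment b vs zs" "vs \<in> Obj (Mat C)" and zs: "zs \<in> Obj (Mat C)"
  shows "Comp (Mat C) vs zs us (projection a us) (inclusion b vs) i k
    = (if i < length us \<and> k < length vs \<and> a + i = b + k then Ident C (us ! i) else 0)"
proof (cases "i < length us \<and> k < length vs")
  case True
  then have o: "us ! i \<in> Obj C" "vs ! k \<in> Obj C" using us vs Mat_Obj_nth by auto
  have n: "a + i < length zs" "zs ! (a + i) = us ! i" "b + k < length zs" "zs ! (b + k) = vs ! k"
    using us(1) vs(1) True by (auto simp: segment_def)
  have zo: "zs ! j \<in> Obj C" if "j < length zs" for j using zs that by (rule Mat_Obj_nth)
  have "(\<Sum>j < length zs. Comp C (vs ! k) (zs ! j) (us ! i) (projection a us i j) (inclusion b vs j k))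
    = (\<Sum>j < length zs. if j = a + i then (if a + i = b + k then Ident C (us ! i) else 0) else 0)"
  proof (intro sum.cong refl)
    fix j assume "j \<in> {..<length zs}"
    then have j: "j < length zs" by simp
    show "Comp C (vs ! k) (zs ! j) (us ! i) (projection a us i j) (inclusion b vs j k)
      = (if j = a + i then (if a + i = b + k then Ident C (us ! i) else 0) else 0)"
    proof (cases "j = a + i")
      case ja: True
      show ?thesis
      proof (cases "a + i = b + k")
        case eq: True
        then have "us ! i = vs ! k" using n by simp
        then show ?thesis using True ja eq n o
          by (simp add: projection_def inclusion_def comp_ident_left ident_hom)
      next
        case False
        then show ?thesis using True ja n o
          by (simp add: projection_def inclusion_def comp_zero_right ident_hom)
      qed
    next
      case False
      have "inclusion b vs j k \<in> Hom C (vs ! k) (zs ! j)"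
        using inclusion_hom(1)[OF vs zs] True j by (simp add: Mat_Hom)
      then show ?thesis using False o zo[OF j] by (simp add: projection_def comp_zero_left)
    qed
  qed
  also have "\<dots> = (if a + i = b + k then Ident C (us ! i) else 0)" using n(1) by simp
  finally show ?thesis using True by (simp add: Mat_Comp)
qed (auto simp: Mat_Comp)

lemma inclusion_projection:
  assumes us: "segment a us zs" "us \<in> Obj (Mat C)" and zs: "zs \<in> Obj (Mat C)"
  shows "Comp (Mat C) zs us zs (inclusion a us) (projection a us) i k
    = (if i = k \<and> a \<le> i \<and> i < a + length us then Ident C (zs ! i) else 0)"
proof (cases "i < length zs \<and> k < length zs")
  case True
  have zo: "zs ! j \<in> Obj C" if "j < length zs" for j using zs that by (rule Mat_Obj_nth)
  have uo: "us ! j \<in> Obj C" if "j < length us" for j using us(2) that by (rule Mat_Obj_nth)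
  have "(\<Sum>j < length us. Comp C (zs ! k) (us ! j) (zs ! i) (inclusion a us i j) (projection a us j k))
    = (\<Sum>j < length us. if j = i - a then (if i = k \<and> a \<le> i then Ident C (zs ! i) else 0) else 0)"
  proof (intro sum.cong refl)
    fix j assume "j \<in> {..<length us}"
    then have j: "j < length us" by simp
    have pr: "projection a us j k \<in> Hom C (zs ! k) (us ! j)"
      using inclusion_hom(2)[OF us zs] True j by (simp add: Mat_Hom)
    show "Comp C (zs ! k) (us ! j) (zs ! i) (inclusion a us i j) (projection a us j k)
      = (if j = i - a then (if i = k \<and> a \<le> i then Ident C (zs ! i) else 0) else 0)"
    proof (cases "i = a + j")
      case ia: True
      then have n: "zs ! i = us ! j" using us(1) j by (simp add: segment_def)
      show ?thesis
      proof (cases "i = k")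
        case True
        then show ?thesis using ia j n uo[OF j]
          by (auto simp: projection_def inclusion_def comp_ident_left ident_hom)
      next
        case False
        then show ?thesis using ia j n uo[OF j] zo True
          by (simp add: projection_def inclusion_def comp_zero_right ident_hom)
      qed
    next
      case False
      then have "inclusion a us i j = 0" by (simp add: inclusion_def)
      then show ?thesis using False pr zo uo[OF j] True by (auto simp: comp_zero_left)
    qed
  qed
  also have "\<dots> = (if i = k \<and> a \<le> i \<and> i < a + length us then Ident C (zs ! i) else 0)"
    by auto
  finally show ?thesis using True by (simp add: Mat_Comp)
next
  case False
  then have "\<not> (i = k \<and> a \<le> i \<and> i < a + length us)"
    using us(1) unfolding segment_def by (metis le_add_diff_inverse nat_add_left_cancel_less)
  then show ?thesis using False by (auto simp: Mat_Comp)
qed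

lemma biproduct_Mat_append:
  assumes xs: "xs \<in> Obj (Mat C)" and ys: "ys \<in> Obj (Mat C)"
  shows "is_biproduct (Mat C) [xs, ys] (xs @ ys)"
proof -
  let ?z = "xs @ ys" and ?n = "length xs"
  have z: "?z \<in> Obj (Mat C)" using xs ys by (simp add: Mat_Obj)
  have s: "segment 0 xs ?z" "segment ?n ys ?z" by (simp_all add: segment_def nth_append)
  note pi = projection_inclusion[OF s(1) xs s(1) xs z] projection_inclusion[OF s(1) xs s(2) ys z]
    projection_inclusion[OF s(2) ys s(1) xs z] projection_inclusion[OF s(2) ys s(2) ys z]
  have comps: "Comp (Mat C) xs ?z xs (projection 0 xs) (inclusion 0 xs) = Ident (Mat C) xs"
    "Comp (Mat C) ys ?z xs (projection 0 xs) (inclusion ?n ys) = 0"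
    "Comp (Mat C) xs ?z ys (projection ?n ys) (inclusion 0 xs) = 0"
    "Comp (Mat C) ys ?z ys (projection ?n ys) (inclusion ?n ys) = Ident (Mat C) ys"
    by (intro ext; auto simp: pi Mat_Ident)+
  have total: "Comp (Mat C) ?z xs ?z (inclusion 0 xs) (projection 0 xs)
      + Comp (Mat C) ?z ys ?z (inclusion ?n ys) (projection ?n ys) = Ident (Mat C) ?z"
    by (intro ext) (auto simp: inclusion_projection[OF s(1) xs z] inclusion_projection[OF s(2) ys z] Mat_Ident)
  show ?thesis
  proof (rule is_biproductI[where \<iota> = "\<lambda>i. if i = 0 then inclusion 0 xs else inclusion ?n ys"
      and \<pi> = "\<lambda>i. if i = 0 then projection 0 xs else projection ?n ys"])
    show "set [xs, ys] \<subseteq> Obj (Mat C)" using xs ys by simp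
    show "?z \<in> Obj (Mat C)" by (rule z)
  qed (use comps total inclusion_hom[OF s(1) xs z] inclusion_hom[OF s(2) ys z] in
      \<open>auto simp: less_Suc_eq numeral_2_eq_2\<close>)
qed

definition one_by_one :: "'m \<Rightarrow> nat \<Rightarrow> nat \<Rightarrow> 'm" where
  "one_by_one f = (\<lambda>i j. if i = 0 \<and> j = 0 then f else 0)"

lemma one_by_one_zero: "one_by_one 0 = 0"
  by (intro ext) (simp add: one_by_one_def)

lemma Mat_Hom_singleton: "A \<in> Hom (Mat C) [x] [y] \<longleftrightarrow> (\<exists>f \<in> Hom C x y. A = one_by_one f)"
proof
  assume "A \<in> Hom (Mat C) [x] [y]"
  then have "A 0 0 \<in> Hom C x y" "A = one_by_one (A 0 0)"
    by (auto simp: Mat_Hom one_by_one_def fun_eq_iff)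
  then show "\<exists>f \<in> Hom C x y. A = one_by_one f" by blast
qed (auto simp: Mat_Hom one_by_one_def)

lemma one_by_one_Comp: "Comp (Mat C) [x] [y] [z] (one_by_one g) (one_by_one f) = one_by_one (Comp C x y z g f)"
  by (intro ext) (simp add: Mat_Comp one_by_one_def)

lemma one_by_one_Ident: "Ident (Mat C) [x] = one_by_one (Ident C x)"
  by (intro ext) (simp add: Mat_Ident one_by_one_def)

text \<open>
  The embedding of a category into its additive completion preserves biproducts.
\<close>

lemma biproduct_Mat_singletons:
  assumes "is_biproduct C xs z"
  shows "is_biproduct (Mat C) (map (\<lambda>x. [x]) xs) [z]"
proof -
  obtain \<iota> \<pi> where "biproduct_data xs z \<iota> \<pi>" using assms is_biproduct_iff by blast
  note d = biproduct_dataD[OF this]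
  have sum: "(\<Sum>i < n. one_by_one (f i)) = one_by_one (\<Sum>i < n. f i)" for f n
    by (intro ext) (simp add: sum_fun_apply one_by_one_def)
  show ?thesis
  proof (rule is_biproductI[where \<iota> = "\<lambda>i. one_by_one (\<iota> i)" and \<pi> = "\<lambda>i. one_by_one (\<pi> i)"])
    show "set (map (\<lambda>x. [x]) xs) \<subseteq> Obj (Mat C)" "[z] \<in> Obj (Mat C)" using d(1,2) by (auto simp: Mat_Obj)
    show "(\<Sum>i < length (map (\<lambda>x. [x]) xs). Comp (Mat C) [z] (map (\<lambda>x. [x]) xs ! i) [z] (one_by_one (\<iota> i)) (one_by_one (\<pi> i)))
      = Ident (Mat C) [z]"
      by (simp add: one_by_one_Comp sum d(6) one_by_one_Ident)
  next
    fix i assume "i < length (map (\<lambda>x. [x]) xs)"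
    then have i: "i < length xs" by simp
    show "one_by_one (\<iota> i) \<in> Hom (Mat C) (map (\<lambda>x. [x]) xs ! i) [z]" "one_by_one (\<pi> i) \<in> Hom (Mat C) [z] (map (\<lambda>x. [x]) xs ! i)"
      using d(3,4)[OF i] i by (auto simp: Mat_Hom_singleton)
    fix j assume "j < length (map (\<lambda>x. [x]) xs)"
    then have j: "j < length xs" by simp
    show "Comp (Mat C) (map (\<lambda>x. [x]) xs ! j) [z] (map (\<lambda>x. [x]) xs ! i) (one_by_one (\<pi> i)) (one_by_one (\<iota> j))
      = (if i = j then Ident (Mat C) (map (\<lambda>x. [x]) xs ! i) else 0)"
      using i j d(5)[OF i j] by (auto simp: one_by_one_Comp one_by_one_Ident one_by_one_zero)
  qed
qed

lemma biproduct_Mat_empty: "is_biproduct (Mat C) [] []"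
  unfolding is_biproduct_def by (auto simp: Mat_Obj Mat_Ident fun_eq_iff)

lemma concat_Mat_Obj: "set xss \<subseteq> Obj (Mat C) \<Longrightarrow> concat xss \<in> Obj (Mat C)"
  by (induction xss) (simp_all add: Mat_Obj)

lemma biproduct_Mat_concat:
  assumes "Obj C \<noteq> {}" "set xss \<subseteq> Obj (Mat C)"
  shows "is_biproduct (Mat C) xss (concat xss)"
  using assms(2)
proof (induction xss)
  case Nil
  show ?case using biproduct_Mat_empty by simp
next
  case (Cons xs xss)
  interpret M: linear_category "Mat C" by (rule linear_category_Mat[OF assms(1)])
  have "concat xss \<in> Obj (Mat C)" using Cons.prems by (simp add: concat_Mat_Obj)
  then have "is_biproduct (Mat C) [xs, concat xss] (xs @ concat xss)"
    using Cons.prems by (intro biproduct_Mat_append) auto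
  then have "is_biproduct (Mat C) ([xs] @ xss) (xs @ concat xss)"
    using M.biproduct_append[OF M.biproduct_singleton] Cons by simp
  then show ?case by simp
qed

end

lemma linear_category_full_subcategory:
  assumes "linear_category C" "T \<subseteq> Obj C"
  shows "linear_category (full_subcategory C T)"
proof -
  interpret linear_category C by (rule assms(1))
  note T = subsetD[OF assms(2)]
  show ?thesis
    by unfold_locales
      (simp_all add: full_subcategory_def T hom_zero hom_add hom_scale scale_add_right[OF T T] scale_add_left[OF T T]
        scale_scale[OF T T] scale_one[OF T T] ident_hom comp_hom comp_ident_right comp_ident_left comp_assoc
        comp_add_right comp_add_left comp_scale_right comp_scale_left)
qed

text \<open>
  Biproducts and isomorphisms only involve morphisms between the given objects, so they can be transported
  between a category and a full subcategory.
\<close>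

lemma biproduct_full_subcategory:
  "T \<subseteq> Obj C \<Longrightarrow> is_biproduct (full_subcategory C T) xs z \<longleftrightarrow> set xs \<subseteq> T \<and> z \<in> T \<and> is_biproduct C xs z"
  unfolding is_biproduct_def full_subcategory_def by auto

lemma isomorphic_full_subcategory:
  "T \<subseteq> Obj C \<Longrightarrow> isomorphic (full_subcategory C T) x y \<longleftrightarrow> x \<in> T \<and> y \<in> T \<and> isomorphic C x y"
  unfolding isomorphic_def full_subcategory_def by auto

section \<open>Semisimplicity of TLJ\<close>

lemma TL_simps [simp]: "Obj TL = UNIV" "Hom TL = tl_hom" "Comp TL x y z = tl_comp" "Ident TL = tl_id" "Scale TL = tl_scale"
  by (simp_all add: TL_def)

interpretation TL: linear_category TL
  by (rule linear_category_TL)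

interpretation Kar_TL: linear_category "Kar TL"
  by (rule TL.linear_category_Kar)

lemma jw_Kar_object: "(n, jones_wenzl n) \<in> Obj (Kar TL)"
  by (simp add: TL.Kar_simps jones_wenzl_hom jones_wenzl_idempotent)

lemma Kar_TL_nonempty: "Obj (Kar TL) \<noteq> {}"
  using jw_Kar_object by blast

interpretation Mat_TL: linear_category "Mat (Kar TL)"
  by (rule Kar_TL.linear_category_Mat[OF Kar_TL_nonempty])

text \<open>
  The interchange law makes a tensor product of idempotents idempotent.
\<close>

lemma kar_tensor_object:
  assumes "x \<in> Obj (Kar TL)" "y \<in> Obj (Kar TL)"
  shows "kar_tensor x y \<in> Obj (Kar TL)"
proof -
  obtain m p n r where xy: "x = (m, p)" "y = (n, r)" by (cases x; cases y)
  then have p: "p \<in> tl_hom m m" "tl_comp p p = p" and r: "r \<in> tl_hom n n" "tl_comp r r = r"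
    using assms by (simp_all add: TL.Kar_simps)
  then show ?thesis
    using tl_tensor_comp[OF p(1) p(1) r(1) r(1)] by (simp add: xy TL.Kar_simps tl_tensor_hom)
qed

lemma tlj_objects_Mat: "X \<in> tlj_objects \<Longrightarrow> X \<in> Obj (Mat (Kar TL))"
proof (induction rule: tlj_objects.induct)
  case (jw n)
  then show ?case using jw_Kar_object by (simp add: Kar_TL.Mat_Obj jw_object_def)
next
  case (sum Xs)
  then show ?case by (intro Kar_TL.concat_Mat_Obj) blast
next
  case (tensor X Y)
  then have "kar_tensor x y \<in> Obj (Kar TL)" if "x \<in> set X" "y \<in> set Y" for x y
    using that by (intro kar_tensor_object) (auto simp: Kar_TL.Mat_Obj)
  then show ?case unfolding Kar_TL.Mat_Obj mat_tensor_def by (auto simp del: kar_tensor.simps)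
qed

lemma decomposition_biproduct:
  assumes ts: "jw_decomposition n e ts" and e: "e \<in> tl_hom n n" "tl_comp e e = e"
  shows "is_biproduct (Kar TL) (map (\<lambda>k. (k, jones_wenzl k)) (map fst ts)) (n, e)"
    (is "is_biproduct _ ?ps _")
proof (rule is_biproductI[where \<iota> = "\<lambda>i. fst (snd (ts ! i))" and \<pi> = "\<lambda>i. snd (snd (ts ! i))"])
  show "set ?ps \<subseteq> Obj (Kar TL)" using jw_Kar_object by auto
  show "(n, e) \<in> Obj (Kar TL)" using e by (simp add: TL.Kar_simps)
  have "e = (\<Sum>i < length ts. factor_comp (ts ! i))"
    using ts by (simp add: jw_decomposition_def jw_sum_def sum_list_sum_nth lessThan_atLeast0)
  also have "\<dots> = (\<Sum>i < length ts. tl_comp (fst (snd (ts ! i))) (snd (snd (ts ! i))))"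
    by (intro sum.cong refl) (metis factor_comp.simps prod.collapse)
  finally show "(\<Sum>i < length ?ps.
      Comp (Kar TL) (n, e) (?ps ! i) (n, e) (fst (snd (ts ! i))) (snd (snd (ts ! i))))
    = Ident (Kar TL) (n, e)"
    by (simp add: TL.Kar_simps)
next
  fix i assume "i < length ?ps"
  then have i: "i < length ts" by simp
  obtain k a b where t: "ts ! i = (k, a, b)" by (metis prod_cases3)
  have "(k, a, b) \<in> set ts" using nth_mem[OF i] t by simp
  then have "through_jw n (k, a, b)" "tl_comp e a = a" "tl_comp b e = b"
    using ts unfolding jw_decomposition_def by blast+
  then show "fst (snd (ts ! i)) \<in> Hom (Kar TL) (?ps ! i) (n, e)"
    "snd (snd (ts ! i)) \<in> Hom (Kar TL) (n, e) (?ps ! i)"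
    using i by (simp_all add: t TL.Kar_simps)
  fix j assume "j < length ?ps"
  then have j: "j < length ts" by simp
  have "tl_comp (snd (snd (ts ! i))) (fst (snd (ts ! j))) = (if i = j then jones_wenzl (fst (ts ! i)) else 0)"
    using ts i j unfolding jw_decomposition_def by blast
  then show "Comp (Kar TL) (?ps ! j) (n, e)
      (?ps ! i) (snd (snd (ts ! i))) (fst (snd (ts ! j)))
    = (if i = j then Ident (Kar TL) (?ps ! i) else 0)"
    using i j by (simp add: TL.Kar_simps)
qed

lemma Kar_object_biproduct:
  assumes "x \<in> Obj (Kar TL)"
  shows "\<exists>ks. is_biproduct (Mat (Kar TL)) (map jw_object ks) [x]"
proof -
  obtain n e where x: "x = (n, e)" "e \<in> tl_hom n n" "tl_comp e e = e"
    using assms by (cases x) (auto simp: TL.Kar_simps)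
  obtain ts where "jw_decomposition n e ts" using idempotent_decomposition[OF x(2,3)] by blast
  from Kar_TL.biproduct_Mat_singletons[OF decomposition_biproduct[OF this x(2,3)]]
  show ?thesis by (intro exI[of _ "map fst ts"]) (simp add: x jw_object_def comp_def)
qed

text \<open>
  This holds in the whole additive completion. The induction needs that generality, because the tail of an object
  of \<open>TLJ\<close> need not belong to \<open>TLJ\<close>.
\<close>

lemma Mat_object_biproduct:
  assumes "X \<in> Obj (Mat (Kar TL))"
  shows "\<exists>ks. is_biproduct (Mat (Kar TL)) (map jw_object ks) X"
  using assms
proof (induction X)
  case Nil
  show ?case using Kar_TL.biproduct_Mat_empty by (intro exI[of _ "[]"]) simp
next
  case (Cons x X)
  then have x: "x \<in> Obj (Kar TL)" "[x] \<in> Obj (Mat (Kar TL))" and X: "X \<in> Obj (Mat (Kar TL))"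
    by (simp_all add: Kar_TL.Mat_Obj)
  obtain ks where ks: "is_biproduct (Mat (Kar TL)) (map jw_object ks) [x]" using Kar_object_biproduct[OF x(1)] by blast
  obtain ls where ls: "is_biproduct (Mat (Kar TL)) (map jw_object ls) X" using Cons X by blast
  show ?case
    using Mat_TL.biproduct_append[OF ks ls Kar_TL.biproduct_Mat_append[OF x(2) X]]
    by (intro exI[of _ "ks @ ls"]) simp
qed

lemma TLJ_objects: "tlj_objects \<subseteq> Obj (Mat (Kar TL))"
  using tlj_objects_Mat by blast

lemma jw_sum_object: "direct_sum (map jw_object ks) \<in> tlj_objects"
  by (rule tlj_objects.sum) (auto intro: tlj_objects.jw)

lemma jw_biproduct_TLJ: "is_biproduct TLJ (map jw_object ks) (direct_sum (map jw_object ks))"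
  unfolding TLJ_def biproduct_full_subcategory[OF TLJ_objects]
  using jw_sum_object Kar_TL.biproduct_Mat_concat[OF Kar_TL_nonempty, of "map jw_object ks"]
    tlj_objects_Mat[OF tlj_objects.jw] by (auto intro: tlj_objects.jw)

lemma TLJ_object_isomorphic:
  assumes P: "P \<in> tlj_objects"
  shows "\<exists>ks. isomorphic TLJ P (direct_sum (map jw_object ks))"
proof -
  obtain ks where "is_biproduct (Mat (Kar TL)) (map jw_object ks) P"
    using Mat_object_biproduct[OF tlj_objects_Mat[OF P]] by blast
  moreover have "is_biproduct (Mat (Kar TL)) (map jw_object ks) (direct_sum (map jw_object ks))"
    using jw_biproduct_TLJ unfolding TLJ_def biproduct_full_subcategory[OF TLJ_objects] by blast
  ultimately have "isomorphic (Mat (Kar TL)) P (direct_sum (map jw_object ks))"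
    by (rule Mat_TL.biproduct_unique)
  then show ?thesis
    using P jw_sum_object unfolding TLJ_def isomorphic_full_subcategory[OF TLJ_objects] by blast
qed

text \<open>
  Morphisms between Jones-Wenzl objects are \<open>1 \<times> 1\<close> matrices of morphisms \<open>f = p\<^sub>n f p\<^sub>m\<close> of \<open>TL\<close>.
\<close>

lemma TLJ_Hom_jw:
  "A \<in> Hom TLJ (jw_object m) (jw_object n) \<longleftrightarrow>
    (\<exists>f \<in> tl_hom m n. tl_comp f (jones_wenzl m) = f \<and> tl_comp (jones_wenzl n) f = f \<and> A = Kar_TL.one_by_one f)"
  by (auto simp: TLJ_def full_subcategory_def jw_object_def Kar_TL.Mat_Hom_singleton TL.Kar_simps)

lemma TLJ_Scale_jw: "Scale TLJ c (Kar_TL.one_by_one f) = Kar_TL.one_by_one (tl_scale c f)"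
  by (intro ext)
    (simp add: TLJ_def full_subcategory_def Kar_TL.Mat_Scale TL.Kar_simps Kar_TL.one_by_one_def tl_scale_zero_right)

lemma TLJ_Ident_jw: "Ident TLJ (jw_object n) = Kar_TL.one_by_one (jones_wenzl n)"
  by (simp add: TLJ_def full_subcategory_def jw_object_def Kar_TL.one_by_one_Ident TL.Kar_simps)

lemma simple_jw: "simple_object TLJ (jw_object n)"
proof -
  have "A \<in> Hom TLJ (jw_object n) (jw_object n) \<longleftrightarrow> (\<exists>c. A = Scale TLJ c (Ident TLJ (jw_object n)))" for A
  proof
    assume "A \<in> Hom TLJ (jw_object n) (jw_object n)"
    then obtain f where f: "f \<in> tl_hom n n" "tl_comp f (jones_wenzl n) = f" "tl_comp (jones_wenzl n) f = f"
      "A = Kar_TL.one_by_one f" unfolding TLJ_Hom_jw by blast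
    then show "\<exists>c. A = Scale TLJ c (Ident TLJ (jw_object n))"
      using schur_endo[OF f(1)] by (auto simp: TLJ_Scale_jw TLJ_Ident_jw)
  next
    assume "\<exists>c. A = Scale TLJ c (Ident TLJ (jw_object n))"
    then obtain c where "A = Kar_TL.one_by_one (tl_scale c (jones_wenzl n))"
      by (auto simp: TLJ_Scale_jw TLJ_Ident_jw)
    then show "A \<in> Hom TLJ (jw_object n) (jw_object n)"
      unfolding TLJ_Hom_jw
      by (intro bexI[of _ "tl_scale c (jones_wenzl n)"])
        (simp_all add: tl_hom_scale jones_wenzl_hom tl_comp_scale_left tl_comp_scale_right jones_wenzl_idempotent)
  qed
  then show ?thesis
    by (auto simp: simple_object_def TLJ_def full_subcategory_def intro: tlj_objects.jw)
qed

lemma disjoint_jw: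
  assumes "m \<noteq> n"
  shows "Hom TLJ (jw_object m) (jw_object n) = {0}"
proof -
  have "f = 0" if "f \<in> tl_hom m n" "tl_comp f (jones_wenzl m) = f" "tl_comp (jones_wenzl n) f = f" for f
    using schur_distinct[OF that(1) assms] that by simp
  then have "A \<in> Hom TLJ (jw_object m) (jw_object n) \<longleftrightarrow> A = 0" for A
    unfolding TLJ_Hom_jw using Kar_TL.one_by_one_zero by (auto intro!: bexI[of _ 0])
  then show ?thesis by blast
qed

theorem theorem4p0p3:
  shows "semisimple TLJ \<and>
    (\<forall>P \<in> Obj TLJ. \<exists>ns. isomorphic TLJ P (direct_sum (map jw_object ns)))"
proof -
  have obj: "Obj TLJ = tlj_objects" by (simp add: TLJ_def full_subcategory_def)
  have iso: "\<exists>ns. isomorphic TLJ P (direct_sum (map jw_object ns))" if "P \<in> Obj TLJ" for P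
    using TLJ_object_isomorphic that obj by blast
  have "linear_category TLJ"
    unfolding TLJ_def by (rule linear_category_full_subcategory[OF Mat_TL.linear_category_axioms TLJ_objects])
  moreover have "has_biproducts TLJ"
    unfolding has_biproducts_def obj
  proof (intro allI impI)
    fix Xs assume Xs: "set Xs \<subseteq> tlj_objects"
    then have "is_biproduct (Mat (Kar TL)) Xs (direct_sum Xs)"
      using TLJ_objects by (intro Kar_TL.biproduct_Mat_concat[OF Kar_TL_nonempty]) blast
    moreover have "direct_sum Xs \<in> tlj_objects" using Xs by (intro tlj_objects.sum) blast
    ultimately show "\<exists>Z. is_biproduct TLJ Xs Z"
      unfolding TLJ_def biproduct_full_subcategory[OF TLJ_objects] using Xs by blast
  qed
  moreover have "disjoint_simples TLJ (range jw_object)"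
    unfolding disjoint_simples_def using simple_jw disjoint_jw by (metis rangeE)
  moreover have "\<exists>Xs Z. set Xs \<subseteq> range jw_object \<and> is_biproduct TLJ Xs Z \<and> isomorphic TLJ P Z" if P: "P \<in> Obj TLJ" for P
  proof -
    obtain ns where ns: "isomorphic TLJ P (direct_sum (map jw_object ns))" using iso[OF P] by blast
    have "set (map jw_object ns) \<subseteq> range jw_object" by auto
    then show ?thesis using ns jw_biproduct_TLJ by blast
  qed
  ultimately have "semisimple TLJ" unfolding semisimple_def by blast
  then show ?thesis using iso by blast
qed

end
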